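(* A graph $G$ is bp-reconstructible unless $G$ is one of the following graphs, where $t\ge 0$ is an integer: (a) $C_2+(t+2)P_1$, $\;P_3+(t+1)P_1$, $\;2P_2+tP_1$; (b) $C_3+(t+1)P_1$, $\;K_{1,3}+tP_1$. In particular, all graphs with at least four edges are bp-reconstructible.
   Context: Graphs are finite and undirected, parallel edges are allowed, loops are not. For $G=(V,E)$ and $W\subseteq V$, the edge boundary $\partial W$ is the set of edges with exactly one end vertex in $W$, and for a spanning subgraph $(V,F)$, $N_{(V,F)}(W)$ is the set of vertices of $V\setminus W$ that are joined by an edge of $F$ to a vertex of $W$. The bipartition polynomial is $B(G)=B(G;x,y,z)=\sum_{W\subseteq V}x^{|W|}\sum_{F\subseteq\partial W}y^{|N_{(V,F)}(W)|}z^{|F|}$. The polynomial-deck of $G$ is the multiset $\{B(G-e)\}_{e\in E(G)}$, where $G-e$ is $G$ with the edge $e$ deleted (all vertices kept). A graph $G$ is bp-reconstructible if whenever a graph $H$ has the same polynomial-deck as $G$, we have $B(H)=B(G)$. $P_s$ and $C_s$ denote the path and the cycle on $s$ vertices ($C_2$ is two vertices joined by two parallel edges), $K_{1,3}$ is the star with three leaves, $+$ denotes disjoint union, $tP_1$ denotes $t$ isolated vertices, and $2P_2$ two disjoint copies of $P_2$.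
   Formalization: The exceptions P_3, C_2+P_1 and the edgeless graphs tP_1 are added, since these are not bp-reconstructible: P_3 and C_2+P_1 share a deck but differ in B, and all edgeless graphs have the empty deck. The listed graphs are also shown to be genuine exceptions. *)

theory Defs
  imports "HOL-Computational_Algebra.Polynomial" "HOL-Library.Multiset"
begin

section \<open>Finite loopless multigraphs\<close>

text \<open>Edges are named objects, so that parallel edges are distinct edges with the same set of ends.\<close>

record ('v, 'e) mgraph =
  verts :: "'v set"
  edges :: "'e set"
  ends :: "'e \<Rightarrow> 'v set"

definition multigraph :: "('v, 'e) mgraph \<Rightarrow> bool" where
  "multigraph G \<longleftrightarrow> finite (verts G) \<and> finite (edges G) \<and>
     (\<forall>e\<in>edges G. ends G e \<subseteq> verts G \<and> card (ends G e) = 2)"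

definition isomorphic :: "('v, 'e) mgraph \<Rightarrow> ('w, 'f) mgraph \<Rightarrow> bool" where
  "isomorphic G H \<longleftrightarrow> (\<exists>f g. bij_betw f (verts G) (verts H) \<and> bij_betw g (edges G) (edges H) \<and>
     (\<forall>e\<in>edges G. ends H (g e) = f ` ends G e))"

definition spanning :: "('v, 'e) mgraph \<Rightarrow> 'e set \<Rightarrow> ('v, 'e) mgraph" where
  "spanning G F = G\<lparr>edges := F\<rparr>"

definition delete_edge :: "('v, 'e) mgraph \<Rightarrow> 'e \<Rightarrow> ('v, 'e) mgraph" where
  "delete_edge G e = spanning G (edges G - {e})"

definition edge_boundary :: "('v, 'e) mgraph \<Rightarrow> 'v set \<Rightarrow> 'e set" where
  "edge_boundary G W = {e \<in> edges G. card (ends G e \<inter> W) = 1}"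

definition neighbours :: "('v, 'e) mgraph \<Rightarrow> 'v set \<Rightarrow> 'v set" where
  "neighbours G W = {v \<in> verts G - W. \<exists>e\<in>edges G. \<exists>w\<in>W. ends G e = {v, w}}"


section \<open>The bipartition polynomial and its deck\<close>

text \<open>
  The ring of integer polynomials in three variables is the iterated polynomial ring
  \<open>int poly poly poly\<close>; \<open>varx\<close> is the innermost variable and \<open>varz\<close> the outermost one.
\<close>

definition varx :: "int poly poly poly" where "varx = [:[:[:0, 1:]:]:]"
definition vary :: "int poly poly poly" where "vary = [:[:0, 1:]:]"
definition varz :: "int poly poly poly" where "varz = [:0, 1:]"

definition bipartition_poly :: "('v, 'e) mgraph \<Rightarrow> int poly poly poly" where
  "bipartition_poly G = (\<Sum>W\<in>Pow (verts G). varx ^ card W *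
     (\<Sum>F\<in>Pow (edge_boundary G W). vary ^ card (neighbours (spanning G F) W) * varz ^ card F))"

definition poly_deck :: "('v, 'e) mgraph \<Rightarrow> int poly poly poly multiset" where
  "poly_deck G = image_mset (\<lambda>e. bipartition_poly (delete_edge G e)) (mset_set (edges G))"

text \<open>
  The competitor \<open>H\<close> ranges over the finite multigraphs whose vertices and edges are natural numbers;
  every finite multigraph is isomorphic to one of these, and decks and polynomials are
  isomorphism invariants.
\<close>

definition bp_reconstructible :: "('v, 'e) mgraph \<Rightarrow> bool" where
  "bp_reconstructible G \<longleftrightarrow> (\<forall>H :: (nat, nat) mgraph.
     multigraph H \<and> poly_deck H = poly_deck G \<longrightarrow> bipartition_poly H = bipartition_poly G)"


section \<open>Particular graphs\<close>

definition path_graph :: "nat \<Rightarrow> (nat, nat) mgraph" where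
  "path_graph s = \<lparr>verts = {..<s}, edges = {i. Suc i < s}, ends = (\<lambda>i. {i, Suc i})\<rparr>"

text \<open>Intended for \<open>s \<ge> 2\<close>; for \<open>s = 2\<close> the edges \<open>0\<close> and \<open>1\<close> both have the ends \<open>{0, 1}\<close>.\<close>

definition cycle_graph :: "nat \<Rightarrow> (nat, nat) mgraph" where
  "cycle_graph s = \<lparr>verts = {..<s}, edges = {..<s}, ends = (\<lambda>i. {i, Suc i mod s})\<rparr>"

definition star_graph :: "nat \<Rightarrow> (nat, nat) mgraph" where
  "star_graph s = \<lparr>verts = {0..s}, edges = {1..s}, ends = (\<lambda>i. {0, i})\<rparr>"

definition disjoint_union ::
    "('v, 'e) mgraph \<Rightarrow> ('w, 'f) mgraph \<Rightarrow> ('v + 'w, 'e + 'f) mgraph" (infixl "\<uplus>" 65) where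
  "G \<uplus> H = \<lparr>verts = verts G <+> verts H, edges = edges G <+> edges H,
     ends = case_sum (\<lambda>e. Inl ` ends G e) (\<lambda>e. Inr ` ends H e)\<rparr>"

definition copies :: "nat \<Rightarrow> ('v, 'e) mgraph \<Rightarrow> (nat \<times> 'v, nat \<times> 'e) mgraph" where
  "copies t G = \<lparr>verts = {..<t} \<times> verts G, edges = {..<t} \<times> edges G,
     ends = (\<lambda>(i, e). Pair i ` ends G e)\<rparr>"

end

theory Submission
  imports Defs
begin

text \<open>
  Sorted by \<open>F\<close>, the polynomial has as its coefficient at \<open>z\<^sup>k\<close> a sum over the edge sets \<open>F\<close> of size
  \<open>k\<close>, and each \<open>F\<close> smaller than \<open>E\<close> survives in \<open>m - k\<close> of the \<open>m\<close> cards.  Hence the deck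
  determines all coefficients except the one at \<open>z\<^sup>m\<close>, \<open>top_coeff\<close>, which is a sum over the cuts, the
  sets \<open>W\<close> whose boundary is all of \<open>E\<close>.  It vanishes unless the graph is bipartite, and otherwise it is
  the product of a factor \<open>1 + x\<close> for each isolated vertex and \<open>x\<^sup>a y\<^sup>b + x\<^sup>b y\<^sup>a\<close> for each other
  component, where \<open>a\<close> and \<open>b\<close> are the sizes of its sides.  So it amounts to the number of isolated
  vertices and the multiset of the differences \<open>d = \<bar>a - b\<bar>\<close>.  Throughout, connectivity is treated by
  linear algebra modulo two: \<open>W \<mapsto> \<partial>W\<close> is linear, components are the atoms of its kernel, an edge \<open>e\<close>
  is a bridge iff \<open>{e}\<close> is in its image, and a forest is a graph for which it is onto.

  At \<open>y = 1\<close> the coefficients become \<open>\<Sum>\<^sub>W (\<bar>\<partial>W\<bar> choose k) x\<^bsup>\<bar>W\<bar>\<^esup>\<close>.  At \<open>x = 1\<close> their alternating sum is the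
  size of the kernel, and the terms linear in \<open>x\<close> give the binomial moments of the degrees.  Let
  \<open>G\<close> and \<open>H\<close> have the same deck and \<open>m \<ge> 3\<close> edges.  If both have cycles and \<open>G\<close> is
  bipartite, a non-bridge \<open>e\<close> gives \<open>top_coeff G = top_coeff (G - e)\<close>, and the alternating sum forbids
  that \<open>H\<close> is not bipartite.  If
  only \<open>G\<close> is a forest, \<open>H\<close> is a cycle with isolated vertices, and the moments of the degrees leave
  only the claw against the triangle.

  If both are forests, their degrees agree, and the essential information is in the cards obtained by
  isolating a single leaf.  Such a card changes one difference \<open>d\<close> by one, and since the larger side of a
  tree contains a leaf, every \<open>d > 0\<close> is decremented by some card.  Recovering the multiset from its
  decrements is recovering a partition from its partitions with one corner removed.  This fails only for
  the pairs \<open>{0}, {2}\<close> and \<open>{0,0}, {1,1}\<close> and \<open>{0,2}, {1,1}\<close>.  For these, the cards that split a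
  component into two larger parts show that every edge of the forest with even differences has an odd
  number of vertices on either side in its component, so that all its degrees are odd; by the
  handshake lemma the other forest then has no component of odd order apart from isolated vertices, which
  leaves the first pair, and there only the claw.

  Conversely, all graphs with two edges on the same number of vertices have the same deck, and so have
  the claw and the triangle when they are completed to the same number of vertices.  In either
  case two graphs on at least three or four vertices with different degrees, hence with different
  polynomials, show that no graph with this deck is reconstructible.
\<close>

section \<open>Boundaries of vertex sets modulo two\<close>

lemma multigraph_finite [simp]:
  assumes "multigraph G"
  shows "finite (verts G)" "finite (edges G)"
  using assms by (auto simp: multigraph_def)

lemma multigraph_ends:
  assumes "multigraph G" "e \<in> edges G"
  obtains u v where "ends G e = {u, v}" "u \<noteq> v" "u \<in> verts G" "v \<in> verts G"
proof -
  have "card (ends G e) = 2" and sub: "ends G e \<subseteq> verts G"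
    using assms unfolding multigraph_def by blast+
  then obtain u v where "ends G e = {u, v}" "u \<noteq> v"
    unfolding card_2_iff by blast
  then show thesis
    using sub by (intro that[of u v]) auto
qed

lemma spanning_simps [simp]:
  "verts (spanning G F) = verts G" "edges (spanning G F) = F" "ends (spanning G F) = ends G"
  "spanning (spanning G F) F' = spanning G F'"
  by (auto simp: spanning_def)

lemma spanning_edges [simp]: "spanning G (edges G) = G"
  by (simp add: spanning_def)

lemma delete_edge_simps [simp]:
  "verts (delete_edge G e) = verts G" "edges (delete_edge G e) = edges G - {e}"
  "ends (delete_edge G e) = ends G" "spanning (delete_edge G e) F = spanning G F"
  by (auto simp: delete_edge_def)

lemma multigraph_spanning: "multigraph G \<Longrightarrow> F \<subseteq> edges G \<Longrightarrow> multigraph (spanning G F)"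
  unfolding multigraph_def by (auto intro: finite_subset)

lemma multigraph_delete_edge [simp]: "multigraph G \<Longrightarrow> multigraph (delete_edge G e)"
  unfolding multigraph_def by auto

lemma edge_boundary_subset: "edge_boundary G W \<subseteq> edges G"
  by (auto simp: edge_boundary_def)

lemma finite_edge_boundary [simp]: "multigraph G \<Longrightarrow> finite (edge_boundary G W)"
  by (rule finite_subset[OF edge_boundary_subset]) simp

lemma edge_boundary_spanning:
  "F \<subseteq> edges G \<Longrightarrow> edge_boundary (spanning G F) W = edge_boundary G W \<inter> F"
  by (auto simp: edge_boundary_def)

lemma edge_boundary_delete_edge [simp]:
  "edge_boundary (delete_edge G e) W = edge_boundary G W - {e}"
  by (auto simp: edge_boundary_def)

lemma in_edge_boundary_iff:
  assumes "e \<in> edges G" "ends G e = {u, v}" "u \<noteq> v"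
  shows "e \<in> edge_boundary G W \<longleftrightarrow> (u \<in> W) \<noteq> (v \<in> W)"
  using assms by (auto simp: edge_boundary_def Int_insert_left)

lemma edge_boundary_eqI:
  assumes "multigraph G"
    and "\<And>e u v. \<lbrakk>e \<in> edges G; ends G e = {u, v}; u \<noteq> v\<rbrakk> \<Longrightarrow>
      e \<in> S \<longleftrightarrow> ((u \<in> W) \<noteq> (v \<in> W))"
    and "S \<subseteq> edges G"
  shows "edge_boundary G W = S"
proof (intro set_eqI)
  fix e
  show "e \<in> edge_boundary G W \<longleftrightarrow> e \<in> S"
  proof (cases "e \<in> edges G")
    case True
    obtain u v where "ends G e = {u, v}" "u \<noteq> v"
      using multigraph_ends[OF assms(1) True] .
    then show ?thesis
      using True assms(2) in_edge_boundary_iff by metis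
  next
    case False
    then show ?thesis
      using assms(3) edge_boundary_subset[of G W] by auto
  qed
qed

text \<open>An edge is cut by a set iff the set contains an odd number of its two ends; so taking
  boundaries is linear over the field with two elements.\<close>

lemma edge_boundary_sym_diff:
  assumes "multigraph G"
  shows "edge_boundary G (sym_diff W U) = sym_diff (edge_boundary G W) (edge_boundary G U)"
proof (rule edge_boundary_eqI[OF assms])
  fix e u v
  assume e: "e \<in> edges G" "ends G e = {u, v}" "u \<noteq> v"
  show "e \<in> sym_diff (edge_boundary G W) (edge_boundary G U) \<longleftrightarrow>
      ((u \<in> sym_diff W U) \<noteq> (v \<in> sym_diff W U))"
    using in_edge_boundary_iff[OF e] by auto
qed (use edge_boundary_subset[of G] in auto)

lemma edge_boundary_empty [simp]: "edge_boundary G {} = {}"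
  by (simp add: edge_boundary_def)

lemma edge_boundary_verts [simp]:
  assumes "multigraph G"
  shows "edge_boundary G (verts G) = {}"
  by (rule edge_boundary_eqI[OF assms]) (use assms in \<open>force simp: multigraph_def simp del: multigraph_finite\<close>)+

lemma edge_boundary_compl:
  assumes "multigraph G" "W \<subseteq> verts G"
  shows "edge_boundary G (verts G - W) = edge_boundary G W"
  by (rule edge_boundary_eqI[OF assms(1)])
    (use assms(1) edge_boundary_subset[of G W] in
      \<open>auto simp: in_edge_boundary_iff multigraph_def simp del: multigraph_finite\<close>)

text \<open>The kernel of the boundary map, whose members are the unions of components, and the fibre over
  the set of all edges, whose members are the sides of bipartitions.\<close>

definition closed_sets :: "('v, 'e) mgraph \<Rightarrow> 'v set set" where
  "closed_sets G = {W. W \<subseteq> verts G \<and> edge_boundary G W = {}}"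

definition cuts :: "('v, 'e) mgraph \<Rightarrow> 'v set set" where
  "cuts G = {W. W \<subseteq> verts G \<and> edge_boundary G W = edges G}"

lemma finite_closed_sets [simp]: "multigraph G \<Longrightarrow> finite (closed_sets G)"
  by (rule finite_subset[of _ "Pow (verts G)"]) (auto simp: closed_sets_def)

lemma finite_cuts [simp]: "multigraph G \<Longrightarrow> finite (cuts G)"
  by (rule finite_subset[of _ "Pow (verts G)"]) (auto simp: cuts_def)

lemma empty_closed [simp]: "{} \<in> closed_sets G"
  by (simp add: closed_sets_def)

lemma verts_closed [simp]: "multigraph G \<Longrightarrow> verts G \<in> closed_sets G"
  by (simp add: closed_sets_def)

lemma closed_sets_iff:
  assumes "multigraph G"
  shows "W \<in> closed_sets G \<longleftrightarrow>
    W \<subseteq> verts G \<and> (\<forall>e\<in>edges G. ends G e \<subseteq> W \<or> ends G e \<inter> W = {})"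
proof -
  have "e \<notin> edge_boundary G W \<longleftrightarrow> ends G e \<subseteq> W \<or> ends G e \<inter> W = {}" if "e \<in> edges G" for e
    by (rule multigraph_ends[OF assms that]) (use that in \<open>auto simp: in_edge_boundary_iff\<close>)
  then show ?thesis
    using edge_boundary_subset[of G W] by (auto simp: closed_sets_def)
qed

lemma card_closed_sets_pos: "multigraph G \<Longrightarrow> card (closed_sets G) > 0"
  using card_gt_0_iff empty_closed finite_closed_sets by blast

lemma closed_sets_delete_edge:
  "closed_sets (delete_edge G e) = {W. W \<subseteq> verts G \<and> edge_boundary G W \<subseteq> {e}}"
  by (auto simp: closed_sets_def)

lemma card_boundary_fibre:
  assumes "multigraph G" "X \<subseteq> verts G"
  shows "card {W. W \<subseteq> verts G \<and> edge_boundary G W = edge_boundary G X} = card (closed_sets G)"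
proof -
  have inv: "sym_diff (sym_diff W X) X = W" for W
    by blast
  have boundary: "edge_boundary G (sym_diff W X) = sym_diff (edge_boundary G W) (edge_boundary G X)" for W
    by (rule edge_boundary_sym_diff[OF assms(1)])
  have "bij_betw (\<lambda>W. sym_diff W X) (closed_sets G)
      {W. W \<subseteq> verts G \<and> edge_boundary G W = edge_boundary G X}"
  proof (rule bij_betw_byWitness[where f' = "\<lambda>W. sym_diff W X"])
    show "(\<lambda>W. sym_diff W X) ` closed_sets G
        \<subseteq> {W. W \<subseteq> verts G \<and> edge_boundary G W = edge_boundary G X}"
      using assms(2) unfolding closed_sets_def image_subset_iff mem_Collect_eq boundary by blast
    show "(\<lambda>W. sym_diff W X) ` {W. W \<subseteq> verts G \<and> edge_boundary G W = edge_boundary G X}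
        \<subseteq> closed_sets G"
      using assms(2) unfolding closed_sets_def image_subset_iff mem_Collect_eq boundary by blast
  qed (use inv in blast)+
  then show ?thesis
    by (rule bij_betw_same_card[symmetric])
qed

lemma card_cuts:
  assumes "multigraph G" "cuts G \<noteq> {}"
  shows "card (cuts G) = card (closed_sets G)"
proof -
  obtain A where "A \<subseteq> verts G" "edge_boundary G A = edges G"
    using assms(2) by (auto simp: cuts_def)
  then show ?thesis
    using card_boundary_fibre[OF assms(1), of A] by (simp add: cuts_def)
qed

section \<open>Bridges and forests\<close>

text \<open>An edge is a bridge iff it alone separates some vertex set from the rest; in this form a
  bridge is a unit vector in the image of the boundary map.\<close>

definition bridge :: "('v, 'e) mgraph \<Rightarrow> 'e \<Rightarrow> bool" where
  "bridge G e \<longleftrightarrow> (\<exists>U\<subseteq>verts G. edge_boundary G U = {e})"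

definition forest :: "('v, 'e) mgraph \<Rightarrow> bool" where
  "forest G \<longleftrightarrow> (\<forall>e\<in>edges G. bridge G e)"

text \<open>The kernel for \<open>G - e\<close> consists of the fibres over \<open>{}\<close> and \<open>{e}\<close>; the second one is
  nonempty iff \<open>e\<close> is a bridge.\<close>

lemma card_closed_sets_delete_edge:
  assumes "multigraph G"
  shows "card (closed_sets (delete_edge G e)) =
    (if bridge G e then 2 * card (closed_sets G) else card (closed_sets G))"
proof (cases "bridge G e")
  case True
  then obtain U where U: "U \<subseteq> verts G" "edge_boundary G U = {e}"
    by (auto simp: bridge_def)
  have eq: "closed_sets (delete_edge G e) =
      closed_sets G \<union> {W. W \<subseteq> verts G \<and> edge_boundary G W = edge_boundary G U}"
    unfolding closed_sets_delete_edge using U(2) by (auto simp: closed_sets_def)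
  have "finite {W. W \<subseteq> verts G \<and> edge_boundary G W = edge_boundary G U}"
    using assms by simp
  moreover have "closed_sets G \<inter> {W. W \<subseteq> verts G \<and> edge_boundary G W = edge_boundary G U} = {}"
    using U(2) by (auto simp: closed_sets_def)
  ultimately have "card (closed_sets (delete_edge G e)) = card (closed_sets G) + card (closed_sets G)"
    unfolding eq using assms by (simp add: card_Un_disjoint card_boundary_fibre[OF assms U(1)])
  then show ?thesis
    using True by simp
next
  case False
  then have "closed_sets (delete_edge G e) = closed_sets G"
    unfolding closed_sets_delete_edge by (auto simp: closed_sets_def bridge_def)
  then show ?thesis
    using False by simp
qed

lemma forest_boundary_surj:
  assumes "multigraph G" "forest G" "S \<subseteq> edges G"
  obtains X where "X \<subseteq> verts G" "edge_boundary G X = S"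
proof -
  have "finite S"
    using assms by (meson finite_subset multigraph_finite(2))
  then have "\<exists>X\<subseteq>verts G. edge_boundary G X = S"
    using assms(3)
  proof (induction S rule: finite_induct)
    case empty
    then show ?case
      by (intro exI[of _ "{}"]) simp
  next
    case (insert e S)
    then obtain X where X: "X \<subseteq> verts G" "edge_boundary G X = S"
      by auto
    obtain U where U: "U \<subseteq> verts G" "edge_boundary G U = {e}"
      using insert.prems assms(2) by (auto simp: forest_def bridge_def)
    have "edge_boundary G (sym_diff X U) = insert e S"
      using edge_boundary_sym_diff[OF assms(1), of X U] X U insert.hyps by auto
    then show ?case
      using X U by (intro exI[of _ "sym_diff X U"]) auto
  qed
  then show thesis
    using that by blast
qed

text \<open>In a forest every edge set is a boundary, and all fibres of the boundary map have the
  same size.\<close>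

lemma forest_card_closed_sets:
  assumes "multigraph G" "forest G"
  shows "card (closed_sets G) * 2 ^ card (edges G) = 2 ^ card (verts G)"
proof -
  have fin: "finite (Pow (edges G))" "finite (Pow (verts G))"
    using assms by simp_all
  have "Pow (verts G) = (\<Union>S\<in>Pow (edges G). {W \<in> Pow (verts G). edge_boundary G W = S})"
    using edge_boundary_subset[of G] by blast
  then have "card (Pow (verts G)) =
      card (\<Union>S\<in>Pow (edges G). {W \<in> Pow (verts G). edge_boundary G W = S})"
    by (rule arg_cong)
  also have "\<dots> = (\<Sum>S\<in>Pow (edges G). card {W \<in> Pow (verts G). edge_boundary G W = S})"
    by (rule card_UN_disjoint[OF fin(1)]) (use fin(2) in \<open>auto intro: finite_subset[OF _ fin(2)]\<close>)
  also have "\<dots> = (\<Sum>S\<in>Pow (edges G). card (closed_sets G))"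
  proof (rule sum.cong[OF refl])
    fix S assume "S \<in> Pow (edges G)"
    then obtain X where "X \<subseteq> verts G" "edge_boundary G X = S"
      using forest_boundary_surj[OF assms, of S] by auto
    then show "card {W \<in> Pow (verts G). edge_boundary G W = S} = card (closed_sets G)"
      using card_boundary_fibre[OF assms(1), of X] by simp
  qed
  finally show ?thesis
    using assms by (simp add: card_Pow mult.commute)
qed

lemma forest_cuts_nonempty:
  assumes "multigraph G" "forest G"
  shows "cuts G \<noteq> {}"
proof -
  obtain X where "X \<subseteq> verts G" "edge_boundary G X = edges G"
    using forest_boundary_surj[OF assms subset_refl] .
  then show ?thesis
    by (auto simp: cuts_def)
qed

lemma cuts_subset_delete_edge: "cuts G \<subseteq> cuts (delete_edge G e)"
  by (auto simp: cuts_def)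

section \<open>Coefficients of the bipartition polynomial\<close>

definition indet_x :: "int poly poly" where "indet_x = [:[:0, 1:]:]"
definition indet_y :: "int poly poly" where "indet_y = [:0, 1:]"

lemma coeff_bipartition_poly:
  assumes "multigraph G"
  shows "coeff (bipartition_poly G) k = (\<Sum>W\<in>Pow (verts G). indet_x ^ card W *
    (\<Sum>F\<in>{F \<in> Pow (edge_boundary G W). card F = k}.
       indet_y ^ card (neighbours (spanning G F) W)))"
proof -
  have x: "varx ^ n = [:indet_x ^ n:]" and y: "vary ^ n = [:indet_y ^ n:]" for n
    by (simp_all add: varx_def indet_x_def vary_def indet_y_def poly_const_pow)
  have z: "varz ^ n = monom 1 n" for n
    by (simp add: varz_def monom_altdef)
  have "coeff (bipartition_poly G) k = (\<Sum>W\<in>Pow (verts G). indet_x ^ card W *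
    (\<Sum>F\<in>Pow (edge_boundary G W).
       if card F = k then indet_y ^ card (neighbours (spanning G F) W) else 0))"
    by (simp add: bipartition_poly_def coeff_sum x y z if_distrib cong: if_cong)
  also have "\<dots> = (\<Sum>W\<in>Pow (verts G). indet_x ^ card W *
    (\<Sum>F\<in>{F \<in> Pow (edge_boundary G W). card F = k}.
       indet_y ^ card (neighbours (spanning G F) W)))"
    by (intro sum.cong refl arg_cong2[where f = "(*)"] sum.inter_filter[symmetric])
      (use assms in simp)
  finally show ?thesis .
qed

lemma coeff_bipartition_poly_eq_0:
  assumes "multigraph G" "card (edges G) < k"
  shows "coeff (bipartition_poly G) k = 0"
proof -
  have "card F \<noteq> k" if "F \<subseteq> edge_boundary G W" for F W
    using card_mono[OF multigraph_finite(2)[OF assms(1)], of F] that edge_boundary_subset[of G W] assms(2)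
    by fastforce
  then have "{F \<in> Pow (edge_boundary G W). card F = k} = {}" for W
    by auto
  then show ?thesis
    unfolding coeff_bipartition_poly[OF assms(1)] by (simp only: sum.empty mult_zero_right sum.neutral_const)
qed

text \<open>A set \<open>F\<close> of \<open>k\<close> edges survives the deletion of \<open>e\<close> for exactly \<open>m - k\<close> of the \<open>m\<close>
  edges \<open>e\<close>, so the deck determines every coefficient except the one at \<open>z\<^sup>m\<close>.\<close>

lemma kelly_bipartition_poly:
  assumes "multigraph G"
  shows "(\<Sum>e\<in>edges G. coeff (bipartition_poly (delete_edge G e)) k) =
    of_nat (card (edges G) - k) * coeff (bipartition_poly G) k"
proof -
  let ?h = "\<lambda>W F. indet_y ^ card (neighbours (spanning G F) W)"
  have inner: "(\<Sum>e\<in>edges G. \<Sum>F\<in>{F \<in> Pow (edge_boundary G W - {e}). card F = k}. ?h W F) =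
      of_nat (card (edges G) - k) * (\<Sum>F\<in>{F \<in> Pow (edge_boundary G W). card F = k}. ?h W F)"
    (is "?lhs = ?rhs") for W
  proof -
    let ?P = "{F \<in> Pow (edge_boundary G W). card F = k}"
    have fin: "finite ?P"
      using assms by simp
    have "?lhs = (\<Sum>e\<in>edges G. \<Sum>F\<in>{F \<in> ?P. e \<notin> F}. ?h W F)"
      by (intro sum.cong refl) auto
    also have "\<dots> = (\<Sum>F\<in>?P. \<Sum>e\<in>{e \<in> edges G. e \<notin> F}. ?h W F)"
      by (rule sum.swap_restrict) (use assms fin in simp_all)
    also have "\<dots> = (\<Sum>F\<in>?P. of_nat (card (edges G) - k) * ?h W F)"
    proof (rule sum.cong[OF refl])
      fix F assume F: "F \<in> ?P"
      then have sub: "F \<subseteq> edges G" "card F = k"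
        using edge_boundary_subset[of G W] by auto
      have "{e \<in> edges G. e \<notin> F} = edges G - F"
        by auto
      moreover have "card (edges G - F) = card (edges G) - k"
        using sub card_Diff_subset[of F "edges G"] assms finite_subset[OF sub(1)] by simp
      ultimately show "(\<Sum>e\<in>{e \<in> edges G. e \<notin> F}. ?h W F) = of_nat (card (edges G) - k) * ?h W F"
        by simp
    qed
    finally show ?thesis
      by (simp add: sum_distrib_left)
  qed
  have "(\<Sum>e\<in>edges G. coeff (bipartition_poly (delete_edge G e)) k) =
      (\<Sum>W\<in>Pow (verts G). indet_x ^ card W *
        (\<Sum>e\<in>edges G. \<Sum>F\<in>{F \<in> Pow (edge_boundary G W - {e}). card F = k}. ?h W F))"
    using assms by (simp add: coeff_bipartition_poly sum.swap[of _ "edges G"] sum_distrib_left)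
  then show ?thesis
    unfolding inner coeff_bipartition_poly[OF assms] by (simp add: sum_distrib_left mult.left_commute)
qed

definition degree_in :: "('v, 'e) mgraph \<Rightarrow> 'v \<Rightarrow> nat" where
  "degree_in G v = card {e \<in> edges G. v \<in> ends G e}"

lemma edge_boundary_singleton: "edge_boundary G {v} = {e \<in> edges G. v \<in> ends G e}"
  by (auto simp: edge_boundary_def Int_insert_right)

lemma card_edge_boundary_singleton: "card (edge_boundary G {v}) = degree_in G v"
  by (simp add: edge_boundary_singleton degree_in_def)

lemma degree_in_eq_0_iff:
  assumes "multigraph G"
  shows "degree_in G v = 0 \<longleftrightarrow> (\<forall>e\<in>edges G. v \<notin> ends G e)"
  using assms by (auto simp: degree_in_def)

lemma degree_in_le: "multigraph G \<Longrightarrow> degree_in G v \<le> card (edges G)"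
  unfolding degree_in_def by (rule card_mono) auto

text \<open>At \<open>y = 1\<close> only the sizes of \<open>W\<close> and of its boundary remain visible.\<close>

lemma coeff_bipartition_poly_at_1:
  assumes "multigraph G"
  shows "poly (coeff (bipartition_poly G) k) 1 =
    (\<Sum>W\<in>Pow (verts G). monom (of_nat (card (edge_boundary G W) choose k)) (card W))"
proof -
  have x: "poly (indet_x ^ n) 1 = monom 1 n" for n
    by (simp add: indet_x_def monom_altdef)
  have y: "poly (indet_y ^ n) 1 = 1" for n
    by (simp add: indet_y_def)
  have "card {F. F \<subseteq> edge_boundary G W \<and> card F = k} = card (edge_boundary G W) choose k" for W
    using n_subsets[of "edge_boundary G W" k] assms by simp
  then show ?thesis
    unfolding coeff_bipartition_poly[OF assms] poly_sum poly_mult x y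
    by (simp add: of_nat_poly mult_monom flip: monom_0)
qed

lemma sum_choose_degree:
  assumes "multigraph G"
  shows "coeff (poly (coeff (bipartition_poly G) k) 1) 1 =
    int (\<Sum>v\<in>verts G. degree_in G v choose k)"
proof -
  have fin: "finite (Pow (verts G))"
    using assms by simp
  have "coeff (poly (coeff (bipartition_poly G) k) 1) 1 =
      (\<Sum>W\<in>Pow (verts G). if card W = 1 then int (card (edge_boundary G W) choose k) else 0)"
    by (simp add: coeff_bipartition_poly_at_1[OF assms] coeff_sum)
  also have "\<dots> = (\<Sum>W\<in>{W \<in> Pow (verts G). card W = 1}. int (card (edge_boundary G W) choose k))"
    by (rule sum.inter_filter[OF fin, symmetric])
  also have "{W \<in> Pow (verts G). card W = 1} = (\<lambda>v. {v}) ` verts G"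
    by (auto simp: card_1_singleton_iff)
  also have "(\<Sum>W\<in>(\<lambda>v. {v}) ` verts G. int (card (edge_boundary G W) choose k)) =
      (\<Sum>v\<in>verts G. int (degree_in G v choose k))"
    by (subst sum.reindex) (auto simp: card_edge_boundary_singleton)
  finally show ?thesis
    by simp
qed

text \<open>This is the principle of inclusion and exclusion: the number of sets with empty boundary is
  the alternating sum over \<open>k\<close> of the numbers of pairs of a set and \<open>k\<close> edges of its boundary.\<close>

lemma alternating_sum_coeffs:
  assumes "multigraph G"
  shows "(\<Sum>k\<le>card (edges G). (-1) ^ k * poly (poly (coeff (bipartition_poly G) k) 1) 1) =
    int (card (closed_sets G))"
proof -
  let ?m = "card (edges G)" and ?b = "\<lambda>W. card (edge_boundary G W)"
  have alt: "(\<Sum>k\<le>?m. (-1) ^ k * int (?b W choose k)) = (if edge_boundary G W = {} then 1 else 0)" for W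
  proof -
    have "?b W \<le> ?m"
      by (rule card_mono) (use assms edge_boundary_subset[of G W] in auto)
    then have "(\<Sum>k\<le>?m. (-1) ^ k * int (?b W choose k)) = (\<Sum>k\<le>?b W. (-1) ^ k * int (?b W choose k))"
      by (intro sum.mono_neutral_right) auto
    also have "\<dots> = (if edge_boundary G W = {} then 1 else 0)"
      using choose_alternating_sum[of "?b W", where 'a = int] assms by (auto simp: card_gt_0_iff)
    finally show ?thesis .
  qed
  have "(\<Sum>k\<le>?m. (-1) ^ k * poly (poly (coeff (bipartition_poly G) k) 1) 1) =
      (\<Sum>W\<in>Pow (verts G). \<Sum>k\<le>?m. (-1) ^ k * int (?b W choose k))"
    by (simp add: coeff_bipartition_poly_at_1[OF assms] poly_sum poly_monom sum_distrib_left
        sum.swap[of _ "{..?m}"])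
  also have "\<dots> = int (card {W \<in> Pow (verts G). edge_boundary G W = {}})"
    unfolding alt using assms by (simp flip: sum.inter_filter)
  finally show ?thesis
    by (simp add: closed_sets_def)
qed

text \<open>The one coefficient that the deck does not determine directly.\<close>

definition top_coeff :: "('v, 'e) mgraph \<Rightarrow> int poly poly" where
  "top_coeff G = coeff (bipartition_poly G) (card (edges G))"

lemma subsets_of_edges_eq_edges:
  assumes "multigraph G"
  shows "{F \<in> Pow (edge_boundary G W). card F = card (edges G)} =
    (if edge_boundary G W = edges G then {edges G} else {})"
proof -
  have "F = edges G" if "F \<subseteq> edges G" "card F = card (edges G)" for F
    using that assms by (simp add: card_subset_eq)
  then show ?thesis
    using edge_boundary_subset[of G W] by auto
qed

lemma neighbours_of_cut:
  assumes "multigraph G" "W \<in> cuts G"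
  shows "neighbours G W = {v \<in> verts G - W. degree_in G v \<noteq> 0}"
proof (intro set_eqI iffI)
  fix v assume v: "v \<in> {v \<in> verts G - W. degree_in G v \<noteq> 0}"
  then obtain e where e: "e \<in> edges G" "v \<in> ends G e"
    using degree_in_eq_0_iff[OF assms(1)] by auto
  obtain a b where ab: "ends G e = {a, b}" "a \<noteq> b"
    by (rule multigraph_ends[OF assms(1) e(1)])
  have "(a \<in> W) \<noteq> (b \<in> W)"
    using in_edge_boundary_iff[OF e(1) ab] assms(2) e(1) by (auto simp: cuts_def)
  then have "\<exists>w\<in>W. ends G e = {v, w}"
    using v e(2) ab by (auto simp: insert_commute)
  then show "v \<in> neighbours G W"
    using v e(1) unfolding neighbours_def by auto
qed (use degree_in_eq_0_iff[OF assms(1)] in \<open>auto simp: neighbours_def\<close>)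

lemma top_coeff_cuts:
  assumes "multigraph G"
  shows "top_coeff G =
    (\<Sum>W\<in>cuts G. indet_x ^ card W * indet_y ^ card {v \<in> verts G - W. degree_in G v \<noteq> 0})"
proof -
  have "top_coeff G = (\<Sum>W\<in>Pow (verts G). if edge_boundary G W = edges G
      then indet_x ^ card W * indet_y ^ card (neighbours G W) else 0)"
    unfolding top_coeff_def coeff_bipartition_poly[OF assms] subsets_of_edges_eq_edges[OF assms]
    by (intro sum.cong) auto
  also have "\<dots> = (\<Sum>W\<in>{W \<in> Pow (verts G). edge_boundary G W = edges G}.
      indet_x ^ card W * indet_y ^ card (neighbours G W))"
    by (rule sum.inter_filter[symmetric]) (use assms in simp)
  also have "{W \<in> Pow (verts G). edge_boundary G W = edges G} = cuts G"
    by (auto simp: cuts_def)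
  finally show ?thesis
    by (simp add: neighbours_of_cut[OF assms])
qed

lemma top_coeff_at_1_1:
  assumes "multigraph G"
  shows "poly (poly (top_coeff G) 1) 1 = int (card (cuts G))"
  by (simp add: top_coeff_cuts[OF assms] poly_sum indet_x_def indet_y_def)

lemma top_coeff_eq_0_iff:
  assumes "multigraph G"
  shows "top_coeff G = 0 \<longleftrightarrow> cuts G = {}"
proof
  assume "top_coeff G = 0"
  then have "card (cuts G) = 0"
    using top_coeff_at_1_1[OF assms] by simp
  then show "cuts G = {}"
    using finite_cuts[OF assms] by simp
qed (simp add: top_coeff_cuts[OF assms])

lemma top_coeff_delete_nonbridge:
  assumes "multigraph G" "cuts G \<noteq> {}" "e \<in> edges G" "\<not> bridge G e"
  shows "top_coeff (delete_edge G e) = top_coeff G"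
proof -
  have "cuts (delete_edge G e) \<noteq> {}"
    using assms(2) cuts_subset_delete_edge[of G e] by auto
  then have "card (cuts (delete_edge G e)) = card (cuts G)"
    using assms by (simp add: card_cuts card_closed_sets_delete_edge)
  then have cuts: "cuts (delete_edge G e) = cuts G"
    using card_subset_eq[OF finite_cuts cuts_subset_delete_edge, of G e] assms(1) by simp
  have deg: "degree_in (delete_edge G e) v = 0 \<longleftrightarrow> degree_in G v = 0" if "v \<in> verts G" for v
  proof
    assume "degree_in (delete_edge G e) v = 0"
    then have "edge_boundary G {v} \<subseteq> {e}"
      using degree_in_eq_0_iff[of "delete_edge G e" v] assms(1) by (auto simp: edge_boundary_singleton)
    moreover have "edge_boundary G {v} \<noteq> {e}"
      using assms(4) that unfolding bridge_def by auto
    ultimately have "edge_boundary G {v} = {}"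
      by blast
    then show "degree_in G v = 0"
      using card_edge_boundary_singleton[of G v] by simp
  next
    assume "degree_in G v = 0"
    then show "degree_in (delete_edge G e) v = 0"
      using degree_in_eq_0_iff[of "delete_edge G e" v] degree_in_eq_0_iff[of G v] assms(1) by simp
  qed
  have "{v \<in> verts G - W. degree_in (delete_edge G e) v \<noteq> 0} =
      {v \<in> verts G - W. degree_in G v \<noteq> 0}" for W
    using deg by (metis (no_types, lifting) DiffD1)
  then show ?thesis
    using assms(1) by (simp add: top_coeff_cuts cuts)
qed

text \<open>The binomial moments determine a distribution on the natural numbers: they are the
  coefficients of its generating polynomial around \<open>1\<close> instead of \<open>0\<close>.\<close>

lemma binomial_moments_determine_distribution:
  fixes d :: "'a \<Rightarrow> nat" and d' :: "'b \<Rightarrow> nat"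
  assumes "finite A" "finite B"
    and moments: "\<And>k. (\<Sum>a\<in>A. d a choose k) = (\<Sum>b\<in>B. d' b choose k)"
  shows "card {a \<in> A. d a = j} = card {b \<in> B. d' b = j}"
proof -
  have lin: "coeff ([:1, 1:] ^ n :: int poly) k = int (n choose k)" for n k
  proof (cases "k \<le> n")
    case False
    moreover have "degree ([:1, 1:] ^ n :: int poly) = n"
      by (simp add: degree_power_eq)
    ultimately show ?thesis
      by (simp add: coeff_eq_0 binomial_eq_0)
  qed (simp add: coeff_linear_poly_power)
  have count: "coeff (pcompose (\<Sum>a\<in>S. [:1, 1:] ^ h a) [:-1, 1:]) j = int (card {a \<in> S. h a = j})"
    if "finite S" for S :: "'c set" and h
  proof -
    have pow: "pcompose (p ^ n) q = pcompose p q ^ n" for p q :: "int poly" and n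
      by (induction n) (simp_all add: pcompose_mult pcompose_1)
    have "pcompose (\<Sum>a\<in>S. [:1, 1:] ^ h a) [:-1, 1:] = (\<Sum>a\<in>S. monom 1 (h a) :: int poly)"
      by (simp add: pcompose_sum pow pcompose_pCons monom_altdef)
    then show ?thesis
      using that by (simp add: coeff_sum flip: sum.inter_filter)
  qed
  have "(\<Sum>a\<in>A. [:1, 1:] ^ d a) = (\<Sum>b\<in>B. [:1, 1:] ^ d' b :: int poly)"
    by (rule poly_eqI) (use moments in \<open>simp add: coeff_sum lin flip: of_nat_sum\<close>)
  then show ?thesis
    using count[OF assms(1), of d] count[OF assms(2), of d'] by simp
qed

section \<open>Components\<close>

text \<open>Components are the atoms of the Boolean algebra of sets with empty boundary.  In this form they
  fit the description of bridges by boundaries, and their behaviour under the deletion of an edge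
  follows from that of the kernel.\<close>

definition components :: "('v, 'e) mgraph \<Rightarrow> 'v set set" where
  "components G =
    {C \<in> closed_sets G. C \<noteq> {} \<and> (\<forall>X\<in>closed_sets G. X \<subseteq> C \<longrightarrow> X = {} \<or> X = C)}"

lemma closed_sets_subset: "X \<in> closed_sets G \<Longrightarrow> X \<subseteq> verts G"
  by (simp add: closed_sets_def)

lemma closed_sets_Int: "multigraph G \<Longrightarrow> X \<in> closed_sets G \<Longrightarrow> Y \<in> closed_sets G \<Longrightarrow> X \<inter> Y \<in> closed_sets G"
  unfolding closed_sets_iff by blast

lemma closed_sets_Diff: "multigraph G \<Longrightarrow> X \<in> closed_sets G \<Longrightarrow> Y \<in> closed_sets G \<Longrightarrow> X - Y \<in> closed_sets G"
  unfolding closed_sets_iff by blast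

lemma closed_sets_Union: "multigraph G \<Longrightarrow> Q \<subseteq> closed_sets G \<Longrightarrow> \<Union>Q \<in> closed_sets G"
  unfolding subset_iff closed_sets_iff by blast

lemma component_closed: "C \<in> components G \<Longrightarrow> C \<in> closed_sets G"
  by (simp add: components_def)

lemma component_subset: "C \<in> components G \<Longrightarrow> C \<subseteq> verts G"
  by (simp add: components_def closed_sets_def)

lemma component_nonempty: "C \<in> components G \<Longrightarrow> C \<noteq> {}"
  by (simp add: components_def)

lemma component_minimal: "C \<in> components G \<Longrightarrow> X \<in> closed_sets G \<Longrightarrow> X \<subseteq> C \<Longrightarrow> X = {} \<or> X = C"
  by (simp add: components_def)

lemma finite_components [simp]: "multigraph G \<Longrightarrow> finite (components G)"
  by (simp add: components_def)

lemma finite_component: "multigraph G \<Longrightarrow> C \<in> components G \<Longrightarrow> finite C"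
  by (rule finite_subset[OF component_subset multigraph_finite(1)])

lemma component_closed_cases:
  assumes "multigraph G" "C \<in> components G" "X \<in> closed_sets G"
  shows "C \<subseteq> X \<or> C \<inter> X = {}"
  using component_minimal[OF assms(2) closed_sets_Int[OF assms(1) component_closed[OF assms(2)] assms(3)]]
  by blast

lemma components_disjoint:
  assumes "multigraph G" "C \<in> components G" "C' \<in> components G" "C \<noteq> C'"
  shows "C \<inter> C' = {}"
  using component_closed_cases[OF assms(1,2) component_closed[OF assms(3)]]
    component_closed_cases[OF assms(1,3) component_closed[OF assms(2)]] assms(4) by blast

lemma component_exists:
  assumes "multigraph G" "v \<in> verts G"
  obtains C where "C \<in> components G" "v \<in> C"
proof -
  let ?C = "\<Inter>{X \<in> closed_sets G. v \<in> X}"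
  have "verts G \<in> {X \<in> closed_sets G. v \<in> X}"
    using assms by simp
  then have sub: "?C \<subseteq> verts G"
    by blast
  have closed: "?C \<in> closed_sets G"
  proof (rule iffD2[OF closed_sets_iff[OF assms(1)]], intro conjI ballI sub)
    fix e assume e: "e \<in> edges G"
    have "ends G e \<subseteq> X \<or> ends G e \<inter> X = {}" if "X \<in> closed_sets G" for X
      using that e unfolding closed_sets_iff[OF assms(1)] by blast
    then show "ends G e \<subseteq> ?C \<or> ends G e \<inter> ?C = {}"
      by blast
  qed
  have "X = {} \<or> X = ?C" if X: "X \<in> closed_sets G" "X \<subseteq> ?C" for X
  proof (cases "v \<in> X")
    case False
    then have "?C - X \<in> {X \<in> closed_sets G. v \<in> X}"
      using closed_sets_Diff[OF assms(1) closed X(1)] by simp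
    then show ?thesis
      using X(2) by blast
  qed (use X in blast)
  then have "?C \<in> components G"
    unfolding components_def using closed by blast
  then show thesis
    using that by blast
qed

lemma closed_set_eq_Union:
  assumes "multigraph G" "X \<in> closed_sets G"
  shows "X = \<Union>{C \<in> components G. C \<subseteq> X}"
proof
  show "X \<subseteq> \<Union>{C \<in> components G. C \<subseteq> X}"
  proof
    fix v assume v: "v \<in> X"
    then obtain C where "C \<in> components G" "v \<in> C"
      using component_exists[OF assms(1)] closed_sets_subset[OF assms(2)] by blast
    then show "v \<in> \<Union>{C \<in> components G. C \<subseteq> X}"
      using component_closed_cases[OF assms(1) _ assms(2)] v by blast
  qed
qed blast

lemma bij_betw_components_closed_sets:
  assumes "multigraph G"
  shows "bij_betw Union (Pow (components G)) (closed_sets G)"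
proof (rule bij_betw_byWitness[where f' = "\<lambda>X. {C \<in> components G. C \<subseteq> X}"])
  show "\<forall>Q\<in>Pow (components G). {C \<in> components G. C \<subseteq> \<Union>Q} = Q"
  proof
    fix Q assume Q: "Q \<in> Pow (components G)"
    have "C \<in> Q" if C: "C \<in> components G" "C \<subseteq> \<Union>Q" for C
    proof -
      obtain v where "v \<in> C"
        using component_nonempty[OF C(1)] by blast
      then obtain C' where "C' \<in> Q" "v \<in> C'" "v \<in> C"
        using C(2) by blast
      then show ?thesis
        using components_disjoint[OF assms C(1), of C'] Q by blast
    qed
    then show "{C \<in> components G. C \<subseteq> \<Union>Q} = Q"
      using Q by blast
  qed
  show "\<forall>X\<in>closed_sets G. \<Union>{C \<in> components G. C \<subseteq> X} = X"
    using closed_set_eq_Union[OF assms] by simp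
  show "Union ` Pow (components G) \<subseteq> closed_sets G"
    using closed_sets_Union[OF assms] component_closed by blast
qed blast

lemma card_closed_sets_components:
  assumes "multigraph G"
  shows "card (closed_sets G) = 2 ^ card (components G)"
  using bij_betw_same_card[OF bij_betw_components_closed_sets[OF assms]] assms by (simp add: card_Pow)

lemma card_sum_components:
  assumes "multigraph G" "W \<subseteq> verts G"
  shows "card W = (\<Sum>C\<in>components G. card (W \<inter> C))"
proof -
  have "W = (\<Union>C\<in>components G. W \<inter> C)"
    using component_exists[OF assms(1)] assms(2) by blast
  then have "card W = card (\<Union>C\<in>components G. W \<inter> C)"
    by (rule arg_cong)
  also have "\<dots> = (\<Sum>C\<in>components G. card (W \<inter> C))"
  proof (rule card_UN_disjoint)
    show "\<forall>C\<in>components G. finite (W \<inter> C)"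
      using finite_component[OF assms(1)] by blast
    show "\<forall>C\<in>components G. \<forall>C'\<in>components G. C \<noteq> C' \<longrightarrow> W \<inter> C \<inter> (W \<inter> C') = {}"
      using components_disjoint[OF assms(1)] by blast
  qed (use assms in simp)
  finally show ?thesis .
qed

lemma component_ends:
  assumes "multigraph G" "C \<in> components G" "e \<in> edges G" "v \<in> ends G e" "v \<in> C"
  shows "ends G e \<subseteq> C"
  using component_closed[OF assms(2)] assms unfolding closed_sets_iff[OF assms(1)] by blast

lemma edge_component:
  assumes "multigraph G" "e \<in> edges G"
  obtains C where "C \<in> components G" "ends G e \<subseteq> C"
proof -
  obtain u v where uv: "ends G e = {u, v}" "u \<in> verts G"
    by (rule multigraph_ends[OF assms])
  obtain C where "C \<in> components G" "u \<in> C"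
    by (rule component_exists[OF assms(1) uv(2)])
  then show thesis
    using that component_ends[OF assms(1) _ assms(2), of C u] uv(1) by blast
qed

lemma isolated_closed:
  assumes "multigraph G" "v \<in> verts G"
  shows "{v} \<in> closed_sets G \<longleftrightarrow> degree_in G v = 0"
proof -
  have "edge_boundary G {v} = {} \<longleftrightarrow> card (edge_boundary G {v}) = 0"
    using assms(1) by simp
  then show ?thesis
    using assms(2) by (simp add: closed_sets_def card_edge_boundary_singleton)
qed

lemma component_card_1_iff:
  assumes "multigraph G" "C \<in> components G" "v \<in> C"
  shows "card C = 1 \<longleftrightarrow> degree_in G v = 0"
proof -
  have v: "v \<in> verts G"
    using assms component_subset by blast
  show ?thesis
  proof
    assume "card C = 1"
    then have "C = {v}"
      using assms(3) by (auto simp: card_1_singleton_iff)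
    then show "degree_in G v = 0"
      using component_closed[OF assms(2)] isolated_closed[OF assms(1) v] by simp
  next
    assume "degree_in G v = 0"
    then have "{v} \<in> closed_sets G"
      using isolated_closed[OF assms(1) v] by simp
    then have "C = {v}"
      using component_minimal[OF assms(2), of "{v}"] assms(3) by blast
    then show "card C = 1"
      by simp
  qed
qed

definition isolated_count :: "('v, 'e) mgraph \<Rightarrow> nat" where
  "isolated_count G = card {v \<in> verts G. degree_in G v = 0}"

lemma isolated_count_components:
  assumes "multigraph G"
  shows "isolated_count G = card {C \<in> components G. card C = 1}"
proof -
  have "bij_betw (\<lambda>v. {v}) {v \<in> verts G. degree_in G v = 0} {C \<in> components G. card C = 1}"
  proof (rule bij_betw_imageI)
    show "(\<lambda>v. {v}) ` {v \<in> verts G. degree_in G v = 0} = {C \<in> components G. card C = 1}"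
    proof (intro equalityI subsetI)
      fix C assume "C \<in> (\<lambda>v. {v}) ` {v \<in> verts G. degree_in G v = 0}"
      then obtain v where v: "v \<in> verts G" "degree_in G v = 0" "C = {v}"
        by blast
      then have "{v} \<in> components G"
        using isolated_closed[OF assms v(1)] by (auto simp: components_def)
      then show "C \<in> {C \<in> components G. card C = 1}"
        using v by simp
    next
      fix C assume C: "C \<in> {C \<in> components G. card C = 1}"
      then obtain v where v: "C = {v}"
        by (auto simp: card_1_singleton_iff)
      then have "v \<in> verts G" "degree_in G v = 0"
        using C component_subset[of C G] component_card_1_iff[OF assms, of C v] by auto
      then show "C \<in> (\<lambda>v. {v}) ` {v \<in> verts G. degree_in G v = 0}"
        using v by blast
    qed
  qed simp
  then show ?thesis
    unfolding isolated_count_def by (rule bij_betw_same_card)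
qed

definition surplus :: "'v set \<Rightarrow> 'v set \<Rightarrow> int" where
  "surplus A C = int (card (C \<inter> A)) - int (card (C - A))"

definition imbalance :: "'v set \<Rightarrow> 'v set \<Rightarrow> nat" where
  "imbalance A C = nat \<bar>surplus A C\<bar>"

lemma card_split: "finite C \<Longrightarrow> card C = card (C \<inter> A) + card (C - A)"
  by (metis card_Diff_subset_Int card_mono finite_Int inf_le1 le_add_diff_inverse)

lemma surplus_Un:
  assumes "finite C" "finite C'" "C \<inter> C' = {}"
  shows "surplus A (C \<union> C') = surplus A C + surplus A C'"
proof -
  have "card ((C \<union> C') \<inter> A) = card (C \<inter> A) + card (C' \<inter> A)"
    unfolding Int_Un_distrib2 by (rule card_Un_disjoint) (use assms in auto)
  moreover have "card (C \<union> C' - A) = card (C - A) + card (C' - A)"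
    unfolding Un_Diff by (rule card_Un_disjoint) (use assms in auto)
  ultimately show ?thesis
    by (simp add: surplus_def)
qed

lemma even_imbalance:
  assumes "finite C"
  shows "even (imbalance A C) \<longleftrightarrow> even (card C)"
proof -
  have "even (imbalance A C) \<longleftrightarrow> even (int (card (C \<inter> A)) - int (card (C - A)))"
    unfolding imbalance_def surplus_def by (simp add: even_nat_iff)
  then show ?thesis
    using card_split[OF assms, of A] by auto
qed

text \<open>Over a fixed cut \<open>A\<close>, the cuts are obtained by exchanging the two sides of \<open>A\<close> inside an
  arbitrary set of components, which turns the sum over all cuts into a product.\<close>

lemma top_coeff_prod:
  assumes G: "multigraph G" and A: "A \<in> cuts G"
  shows "top_coeff G = (\<Prod>C\<in>components G. if card C = 1 then 1 + indet_x
    else indet_x ^ card (C \<inter> A) * indet_y ^ card (C - A) +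
      indet_x ^ card (C - A) * indet_y ^ card (C \<inter> A))"
proof -
  define w where "w S C = indet_x ^ card S * indet_y ^ card {v \<in> C - S. degree_in G v \<noteq> 0}" for S C
  let ?t = "\<lambda>W. indet_x ^ card W * indet_y ^ card {v \<in> verts G - W. degree_in G v \<noteq> 0}"
  have A': "A \<subseteq> verts G" "edge_boundary G A = edges G"
    using A by (auto simp: cuts_def)
  have flip_cut: "edge_boundary G (sym_diff A X) = sym_diff (edges G) (edge_boundary G X)" for X
    using edge_boundary_sym_diff[OF G, of A X] A'(2) by simp
  have inv: "sym_diff A (sym_diff A X) = X" for X
    by blast
  have bij1: "bij_betw (sym_diff A) (closed_sets G) (cuts G)"
  proof (rule bij_betw_byWitness[where f' = "sym_diff A"])
    show "sym_diff A ` closed_sets G \<subseteq> cuts G"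
      using A'(1) unfolding closed_sets_def cuts_def image_subset_iff mem_Collect_eq flip_cut by blast
    show "sym_diff A ` cuts G \<subseteq> closed_sets G"
      using A'(1) unfolding closed_sets_def cuts_def image_subset_iff mem_Collect_eq flip_cut by blast
  qed (use inv in blast)+
  have bij: "bij_betw (sym_diff A \<circ> Union) (Pow (components G)) (cuts G)"
    by (rule bij_betw_trans[OF bij_betw_components_closed_sets[OF G] bij1])
  have t_prod: "?t (sym_diff A (\<Union>Q)) = (\<Prod>C\<in>Q. w (C - A) C) * (\<Prod>C\<in>components G - Q. w (C \<inter> A) C)"
    if Q: "Q \<subseteq> components G" for Q
  proof -
    let ?W = "sym_diff A (\<Union>Q)"
    have W: "?W \<subseteq> verts G"
      using A'(1) Q component_subset by blast
    have W1: "?W \<inter> C = C - A" if "C \<in> Q" for C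
      using that by blast
    have W2: "?W \<inter> C = C \<inter> A" if "C \<in> components G - Q" for C
      using that components_disjoint[OF G, of C] Q by blast
    have "{v \<in> verts G - ?W. degree_in G v \<noteq> 0} \<inter> C = {v \<in> C - ?W \<inter> C. degree_in G v \<noteq> 0}"
      if "C \<in> components G" for C
      using component_subset[OF that] by blast
    then have "?t ?W = (\<Prod>C\<in>components G. w (?W \<inter> C) C)"
      using card_sum_components[OF G W]
        card_sum_components[OF G, of "{v \<in> verts G - ?W. degree_in G v \<noteq> 0}"]
      by (simp add: power_sum prod.distrib w_def)
    also have "\<dots> = (\<Prod>C\<in>Q. w (?W \<inter> C) C) * (\<Prod>C\<in>components G - Q. w (?W \<inter> C) C)"
      using prod.subset_diff[OF Q] G by (simp add: mult.commute)
    finally show ?thesis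
      using W1 W2 by simp
  qed
  have "top_coeff G = (\<Sum>Q\<in>Pow (components G). ?t (sym_diff A (\<Union>Q)))"
    unfolding top_coeff_cuts[OF G] using sum.reindex_bij_betw[OF bij, of ?t] by simp
  also have "\<dots> = (\<Sum>Q\<in>Pow (components G). (\<Prod>C\<in>Q. w (C - A) C) * (\<Prod>C\<in>components G - Q. w (C \<inter> A) C))"
    using t_prod by (intro sum.cong) auto
  also have "\<dots> = (\<Prod>C\<in>components G. w (C - A) C + w (C \<inter> A) C)"
    by (rule prod_add[symmetric]) (use G in simp)
  also have "\<dots> = (\<Prod>C\<in>components G. if card C = 1 then 1 + indet_x
    else indet_x ^ card (C \<inter> A) * indet_y ^ card (C - A) +
      indet_x ^ card (C - A) * indet_y ^ card (C \<inter> A))"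
  proof (rule prod.cong[OF refl])
    fix C assume C: "C \<in> components G"
    show "w (C - A) C + w (C \<inter> A) C = (if card C = 1 then 1 + indet_x
      else indet_x ^ card (C \<inter> A) * indet_y ^ card (C - A) +
        indet_x ^ card (C - A) * indet_y ^ card (C \<inter> A))"
    proof (cases "card C = 1")
      case True
      then obtain v where v: "C = {v}"
        by (auto simp: card_1_singleton_iff)
      then have "degree_in G v = 0"
        using component_card_1_iff[OF G C, of v] True by simp
      then have "{v \<in> C - S. degree_in G v \<noteq> 0} = {}" for S
        using v by auto
      then have "w S C = indet_x ^ card S" for S
        unfolding w_def by (simp only: card.empty power_0 mult_1_right)
      then show ?thesis
        using v True by (cases "v \<in> A") (simp_all add: insert_Diff_if add.commute)
    next
      case False
      then have "{v \<in> C - S. degree_in G v \<noteq> 0} = C - S" for S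
        using component_card_1_iff[OF G C] by auto
      then have "w S C = indet_x ^ card S * indet_y ^ card (C - S)" for S
        unfolding w_def by (simp only:)
      moreover have "C - (C - A) = C \<inter> A" "C - C \<inter> A = C - A"
        by blast+
      ultimately show ?thesis
        using False by simp
    qed
  qed
  finally show ?thesis .
qed

text \<open>Components of size one are left out: they enter the coefficient with the different factor
  \<open>1 + x\<close> and are counted by \<open>isolated_count\<close>.\<close>

definition imbalances :: "'v set \<Rightarrow> ('v, 'e) mgraph \<Rightarrow> nat multiset" where
  "imbalances A G = image_mset (imbalance A) (mset_set {C \<in> components G. card C \<noteq> 1})"

lemma in_imbalances:
  assumes "multigraph G"
  shows "d \<in># imbalances A G \<longleftrightarrow> (\<exists>C\<in>components G. card C \<noteq> 1 \<and> d = imbalance A C)"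
  using assms by (auto simp: imbalances_def)

lemma size_imbalances:
  assumes "multigraph G"
  shows "size (imbalances A G) + isolated_count G = card (components G)"
proof -
  have "{C \<in> components G. card C \<noteq> 1} \<inter> {C \<in> components G. card C = 1} = {}"
    by blast
  then have "card {C \<in> components G. card C \<noteq> 1} + card {C \<in> components G. card C = 1} =
      card ({C \<in> components G. card C \<noteq> 1} \<union> {C \<in> components G. card C = 1})"
    using assms by (intro card_Un_disjoint[symmetric]) auto
  also have "{C \<in> components G. card C \<noteq> 1} \<union> {C \<in> components G. card C = 1} = components G"
    by blast
  finally show ?thesis
    by (simp add: imbalances_def isolated_count_components[OF assms])
qed

text \<open>The smaller exponent of \<open>x\<^sup>a y\<^sup>b + x\<^sup>b y\<^sup>a\<close> is factored out of each component; the sum \<open>s\<close>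
  of these exponents is determined by the other data and the number of vertices.\<close>

lemma top_coeff_imbalances:
  assumes G: "multigraph G" and A: "A \<in> cuts G"
  obtains s where "2 * s + sum_mset (imbalances A G) + isolated_count G = card (verts G)"
    "top_coeff G = (1 + indet_x) ^ isolated_count G * ((indet_x * indet_y) ^ s *
       (\<Prod>d\<in>#imbalances A G. indet_x ^ d + indet_y ^ d))"
proof
  let ?N = "{C \<in> components G. card C \<noteq> 1}" and ?I = "{C \<in> components G. card C = 1}"
  let ?a = "\<lambda>C. card (C \<inter> A)" and ?b = "\<lambda>C. card (C - A)"
  let ?s = "\<Sum>C\<in>?N. min (?a C) (?b C)"
  have fin: "finite ?N" "finite ?I" "finite (components G)"
    using G by simp_all
  have I: "components G - ?N = ?I" and sub: "?N \<subseteq> components G"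
    by blast+
  have card: "card C = 2 * min (?a C) (?b C) + imbalance A C" if "C \<in> components G" for C
    using card_split[OF finite_component[OF G that], of A] by (auto simp: imbalance_def surplus_def min_def)
  have "card (verts G) = (\<Sum>C\<in>components G. card (verts G \<inter> C))"
    by (rule card_sum_components[OF G subset_refl])
  also have "\<dots> = (\<Sum>C\<in>components G. card C)"
    using component_subset[of _ G] by (intro sum.cong refl arg_cong[where f = card]) blast
  also have "\<dots> = (\<Sum>C\<in>?I. card C) + (\<Sum>C\<in>?N. card C)"
    using sum.subset_diff[OF sub fin(3), of card] unfolding I .
  also have "(\<Sum>C\<in>?I. card C) = isolated_count G"
    by (simp add: isolated_count_components[OF G])
  also have "(\<Sum>C\<in>?N. card C) = (\<Sum>C\<in>?N. 2 * min (?a C) (?b C) + imbalance A C)"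
    using card by (intro sum.cong) auto
  also have "\<dots> = 2 * ?s + sum_mset (imbalances A G)"
    unfolding sum.distrib sum_distrib_left by (simp add: imbalances_def sum_unfold_sum_mset)
  finally show "2 * ?s + sum_mset (imbalances A G) + isolated_count G = card (verts G)"
    by simp
  let ?f = "\<lambda>C. if card C = 1 then 1 + indet_x
    else indet_x ^ ?a C * indet_y ^ ?b C + indet_x ^ ?b C * indet_y ^ ?a C"
  have factor: "?f C = (indet_x * indet_y) ^ min (?a C) (?b C) *
      (indet_x ^ imbalance A C + indet_y ^ imbalance A C)" if C: "C \<in> ?N" for C
  proof (cases "?a C \<le> ?b C")
    case True
    then have "?b C = ?a C + imbalance A C" "min (?a C) (?b C) = ?a C"
      by (auto simp: imbalance_def surplus_def)
    then show ?thesis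
      using C by (simp add: power_add power_mult_distrib algebra_simps)
  next
    case False
    then have "?a C = ?b C + imbalance A C" "min (?a C) (?b C) = ?b C"
      by (auto simp: imbalance_def surplus_def)
    then show ?thesis
      using C by (simp add: power_add power_mult_distrib algebra_simps)
  qed
  have "top_coeff G = (\<Prod>C\<in>?I. ?f C) * (\<Prod>C\<in>?N. ?f C)"
    unfolding top_coeff_prod[OF G A] using prod.subset_diff[OF sub fin(3), of ?f] unfolding I .
  also have "(\<Prod>C\<in>?I. ?f C) = (1 + indet_x) ^ isolated_count G"
    by (simp add: isolated_count_components[OF G])
  also have "(\<Prod>C\<in>?N. ?f C) = (\<Prod>C\<in>?N. (indet_x * indet_y) ^ min (?a C) (?b C) *
      (indet_x ^ imbalance A C + indet_y ^ imbalance A C))"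
    by (rule prod.cong[OF refl factor])
  also have "\<dots> = (indet_x * indet_y) ^ ?s * (\<Prod>d\<in>#imbalances A G. indet_x ^ d + indet_y ^ d)"
    by (simp add: prod.distrib power_sum imbalances_def prod_unfold_prod_mset image_mset.compositionality comp_def)
  finally show "top_coeff G = (1 + indet_x) ^ isolated_count G * ((indet_x * indet_y) ^ ?s *
       (\<Prod>d\<in>#imbalances A G. indet_x ^ d + indet_y ^ d))" .
qed

text \<open>A product of factors \<open>1 + x\<^sup>d\<close> determines its exponents: its lowest terms show the
  multiplicity of the least exponent, and once these factors are cancelled, the next exponent is the
  least one.\<close>

lemma prod_one_plus_monom_low:
  fixes M :: "nat multiset"
  assumes "\<And>d. d \<in># M \<Longrightarrow> j \<le> d" "j > 0"
  shows "\<exists>q. (\<Prod>d\<in>#M. 1 + monom 1 d :: int poly) = 1 + monom (int (count M j)) j + monom 1 (Suc j) * q"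
  using assms(1)
proof (induction M)
  case empty
  show ?case
    by (intro exI[of _ 0]) simp
next
  case (add d M)
  then obtain q where q: "(\<Prod>d\<in>#M. 1 + monom 1 d :: int poly) =
      1 + monom (int (count M j)) j + monom 1 (Suc j) * q"
    by auto
  obtain i where i: "d = j + i"
    using add.prems[of d] le_iff_add by auto
  let ?p = "(\<Prod>d\<in>#M. 1 + monom 1 d :: int poly)"
  show ?case
  proof (cases "d = j")
    case True
    have jj: "monom (1::int) j * monom c j = monom 1 (Suc j) * monom c (j - 1)" for c
      using assms(2) by (simp add: mult_monom)
    have "(\<Prod>d\<in>#add_mset d M. 1 + monom 1 d) = ?p + monom 1 j * ?p"
      by (simp add: True distrib_right)
    also have "\<dots> = 1 + (monom (int (count M j)) j + monom 1 j) + monom 1 (Suc j) *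
        (q + monom 1 j * q + monom (int (count M j)) (j - 1))"
      unfolding q by (simp add: algebra_simps jj)
    also have "monom (int (count M j)) j + monom 1 j = monom (int (count (add_mset d M) j)) j"
      by (simp add: True add_monom add.commute)
    finally show ?thesis
      by blast
  next
    case False
    then obtain i where i: "d = Suc j + i"
      using add.prems[of d] by (auto dest!: le_neq_implies_less simp: less_iff_Suc_add)
    have "monom (1::int) d = monom 1 (Suc j) * monom 1 i"
      by (simp add: i mult_monom)
    then have "(\<Prod>d\<in>#add_mset d M. 1 + monom 1 d) =
        1 + monom (int (count M j)) j + monom 1 (Suc j) * (q + monom 1 i * ?p)"
      unfolding q[symmetric] using q by (simp add: algebra_simps)
    then show ?thesis
      using False by auto
  qed
qed

lemma prod_one_plus_monom_neq_0: "(\<Prod>d\<in>#M. 1 + monom 1 d :: int poly) \<noteq> 0"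
proof -
  have "poly (\<Prod>d\<in>#M. 1 + monom 1 d :: int poly) 1 \<noteq> 0" for M :: "nat multiset"
    by (induction M) (auto simp: poly_monom)
  from this[of M] show ?thesis
    by (metis poly_0)
qed

lemma count_eq_if_prod_eq:
  fixes M M' :: "nat multiset"
  assumes "(\<Prod>d\<in>#M. 1 + monom 1 d :: int poly) = (\<Prod>d\<in>#M'. 1 + monom 1 d)"
    and "\<And>d. d \<in># M \<Longrightarrow> j \<le> d" "\<And>d. d \<in># M' \<Longrightarrow> j \<le> d"
  shows "count M j = count M' j"
proof (cases "j = 0")
  case True
  have at_0: "poly (\<Prod>d\<in>#M. 1 + monom 1 d :: int poly) 0 = 2 ^ count M 0" for M :: "nat multiset"
    by (induction M) (auto simp: poly_monom)
  have "(2::int) ^ count M 0 = 2 ^ count M' 0"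
    using assms(1) by (simp flip: at_0)
  then show ?thesis
    using True by simp
next
  case False
  then obtain q q' where
    "(\<Prod>d\<in>#M. 1 + monom 1 d :: int poly) = 1 + monom (int (count M j)) j + monom 1 (Suc j) * q"
    "(\<Prod>d\<in>#M'. 1 + monom 1 d :: int poly) = 1 + monom (int (count M' j)) j + monom 1 (Suc j) * q'"
    using prod_one_plus_monom_low[of M j] prod_one_plus_monom_low[of M' j] assms(2,3) by blast
  then have "1 + monom (int (count M j)) j + monom 1 (Suc j) * q =
      1 + monom (int (count M' j)) j + monom 1 (Suc j) * q'"
    using assms(1) by (simp only:)
  then have "coeff (1 + monom (int (count M j)) j + monom 1 (Suc j) * q) j =
      coeff (1 + monom (int (count M' j)) j + monom 1 (Suc j) * q') j"
    by (rule arg_cong)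
  moreover have "coeff (monom 1 (Suc j) * r) j = 0" for r :: "int poly"
    by (simp add: coeff_monom_mult)
  ultimately show ?thesis
    by simp
qed

lemma multiset_eq_if_prod_eq:
  fixes M M' :: "nat multiset"
  assumes "(\<Prod>d\<in>#M. 1 + monom 1 d :: int poly) = (\<Prod>d\<in>#M'. 1 + monom 1 d)"
  shows "M = M'"
proof -
  have "{#d \<in># M. d < j#} = {#d \<in># M'. d < j#}" for j
  proof (induction j)
    case (Suc j)
    let ?p = "\<lambda>M. (\<Prod>d\<in>#M. 1 + monom 1 d :: int poly)"
    have split: "?p M = ?p {#d \<in># M. d < j#} * ?p {#d \<in># M. \<not> d < j#}" for M
      by (metis image_mset_union multiset_partition prod_mset.union)
    have "?p {#d \<in># M. \<not> d < j#} = ?p {#d \<in># M'. \<not> d < j#}"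
      using assms split[of M] split[of M'] Suc prod_one_plus_monom_neq_0[of "{#d \<in># M'. d < j#}"] by simp
    then have "count {#d \<in># M. \<not> d < j#} j = count {#d \<in># M'. \<not> d < j#} j"
      by (rule count_eq_if_prod_eq) auto
    then have "count M j = count M' j"
      by simp
    moreover have "a < j \<Longrightarrow> count M a = count M' a" for a
      using arg_cong[OF Suc, of "\<lambda>M. count M a"] by simp
    ultimately show ?case
      by (intro multiset_eqI) (auto simp: less_Suc_eq)
  qed simp
  then have "count {#d \<in># M. d < Suc j#} j = count {#d \<in># M'. d < Suc j#} j" for j
    by simp
  then show ?thesis
    by (simp add: multiset_eq_iff)
qed

text \<open>Setting \<open>y = 1\<close> loses nothing once the factors \<open>1 + x\<close> of the isolated vertices, which look like
  components of imbalance one, have been cancelled.\<close>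

lemma imbalances_eq_if_top_coeff_eq:
  assumes G: "multigraph G" "A \<in> cuts G" and H: "multigraph H" "A' \<in> cuts H"
    and eq: "top_coeff G = top_coeff H" "isolated_count G = isolated_count H"
  shows "imbalances A G = imbalances A' H"
proof -
  let ?P = "\<lambda>M. (\<Prod>d\<in>#M. 1 + monom 1 d :: int poly)"
  have at_1: "poly (\<Prod>d\<in>#M. indet_x ^ d + indet_y ^ d) 1 = ?P M" for M
    by (induction M) (simp_all add: indet_x_def indet_y_def monom_altdef add.commute)
  have xy: "poly indet_x 1 * poly indet_y 1 = [:0, 1:]" and x: "poly (1 + indet_x) 1 = [:1, 1:]"
    by (simp_all add: indet_x_def indet_y_def one_pCons)
  obtain s where s: "top_coeff G = (1 + indet_x) ^ isolated_count G * ((indet_x * indet_y) ^ s *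
       (\<Prod>d\<in>#imbalances A G. indet_x ^ d + indet_y ^ d))"
    by (rule top_coeff_imbalances[OF G])
  obtain s' where s': "top_coeff H = (1 + indet_x) ^ isolated_count H * ((indet_x * indet_y) ^ s' *
       (\<Prod>d\<in>#imbalances A' H. indet_x ^ d + indet_y ^ d))"
    by (rule top_coeff_imbalances[OF H])
  have "poly (top_coeff G) 1 = poly (top_coeff H) 1"
    using eq(1) by simp
  then have "[:1, 1:] ^ isolated_count G * ([:0, 1:] ^ s * ?P (imbalances A G)) =
      [:1, 1:] ^ isolated_count G * ([:0, 1:] ^ s' * ?P (imbalances A' H))"
    unfolding s s' poly_mult poly_power xy x at_1 eq(2) .
  then have main: "[:0, 1:] ^ s * ?P (imbalances A G) = [:0, 1:] ^ s' * ?P (imbalances A' H)"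
    by simp
  have not_dvd: "\<not> [:0, 1:] dvd ?P M" for M
  proof -
    have "poly (?P M) 0 > 0"
      by (induction M) (auto simp: poly_monom intro!: mult_pos_pos add_pos_nonneg)
    then show ?thesis
      using poly_eq_0_iff_dvd[of "?P M" 0] by simp
  qed
  have less: False if "k < l" "[:0, 1:] ^ k * ?P M = [:0, 1:] ^ l * ?P M'" for k l M M'
  proof -
    obtain i where "l = k + Suc i"
      using \<open>k < l\<close> by (auto simp: less_iff_Suc_add)
    then have "[:0, 1:] ^ k * ?P M = [:0, 1:] ^ k * ([:0, 1:] * ([:0, 1:] ^ i * ?P M'))"
      using that(2) by (simp only: power_add power_Suc mult.assoc)
    then have "?P M = [:0, 1:] * ([:0, 1:] ^ i * ?P M')"
      by (subst (asm) mult_cancel_left) simp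
    then show False
      using not_dvd[of M] by (metis dvd_triv_left)
  qed
  have "s = s'"
    using less[OF _ main] less[OF _ main[symmetric]] by (meson linorder_less_linear)
  then have "?P (imbalances A G) = ?P (imbalances A' H)"
    using main by simp
  then show ?thesis
    by (rule multiset_eq_if_prod_eq)
qed

lemma top_coeff_eq_if_imbalances_eq:
  assumes G: "multigraph G" "A \<in> cuts G" and H: "multigraph H" "A' \<in> cuts H"
    and "imbalances A G = imbalances A' H" "isolated_count G = isolated_count H"
    and "card (verts G) = card (verts H)"
  shows "top_coeff G = top_coeff H"
proof -
  obtain s where s: "2 * s + sum_mset (imbalances A G) + isolated_count G = card (verts G)"
    "top_coeff G = (1 + indet_x) ^ isolated_count G * ((indet_x * indet_y) ^ s *
       (\<Prod>d\<in>#imbalances A G. indet_x ^ d + indet_y ^ d))"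
    by (rule top_coeff_imbalances[OF G])
  obtain s' where s': "2 * s' + sum_mset (imbalances A' H) + isolated_count H = card (verts H)"
    "top_coeff H = (1 + indet_x) ^ isolated_count H * ((indet_x * indet_y) ^ s' *
       (\<Prod>d\<in>#imbalances A' H. indet_x ^ d + indet_y ^ d))"
    by (rule top_coeff_imbalances[OF H])
  have "s = s'"
    using s(1) s'(1) assms(5-7) by simp
  then show ?thesis
    unfolding s(2) s'(2) assms(5,6) by simp
qed

section \<open>Trees\<close>

definition component_edges :: "('v, 'e) mgraph \<Rightarrow> 'v set \<Rightarrow> 'e set" where
  "component_edges G C = {e \<in> edges G. ends G e \<subseteq> C}"

lemma sum_degree_over_cut:
  assumes G: "multigraph G" and A: "A \<in> cuts G" and C: "C \<in> components G"
  shows "(\<Sum>v\<in>C \<inter> A. degree_in G v) = card (component_edges G C)"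
proof -
  have one: "card (ends G e \<inter> A) = 1" if "e \<in> edges G" for e
    using A that by (auto simp: cuts_def edge_boundary_def)
  have "component_edges G C = (\<Union>v\<in>C \<inter> A. {e \<in> edges G. v \<in> ends G e})"
  proof (intro equalityI subsetI)
    fix e assume e: "e \<in> component_edges G C"
    then have "ends G e \<inter> A \<noteq> {}"
      using one[of e] by (auto simp: component_edges_def)
    then show "e \<in> (\<Union>v\<in>C \<inter> A. {e \<in> edges G. v \<in> ends G e})"
      using e by (auto simp: component_edges_def)
  next
    fix e assume "e \<in> (\<Union>v\<in>C \<inter> A. {e \<in> edges G. v \<in> ends G e})"
    then show "e \<in> component_edges G C"
      using component_ends[OF G C, of e] by (auto simp: component_edges_def)
  qed
  then have "card (component_edges G C) = card (\<Union>v\<in>C \<inter> A. {e \<in> edges G. v \<in> ends G e})"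
    by (rule arg_cong)
  also have "\<dots> = (\<Sum>v\<in>C \<inter> A. card {e \<in> edges G. v \<in> ends G e})"
  proof (rule card_UN_disjoint)
    show "\<forall>v\<in>C \<inter> A. \<forall>w\<in>C \<inter> A. v \<noteq> w \<longrightarrow>
        {e \<in> edges G. v \<in> ends G e} \<inter> {e \<in> edges G. w \<in> ends G e} = {}"
    proof (intro ballI impI)
      fix v w assume vw: "v \<in> C \<inter> A" "w \<in> C \<inter> A" "v \<noteq> w"
      have "\<not> (v \<in> ends G e \<and> w \<in> ends G e)" if e: "e \<in> edges G" for e
      proof
        assume "v \<in> ends G e \<and> w \<in> ends G e"
        then have "{v, w} \<subseteq> ends G e \<inter> A"
          using vw by blast
        moreover obtain a where "ends G e \<inter> A = {a}"
          using one[OF e] by (auto simp: card_1_singleton_iff)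
        ultimately show False
          using vw(3) by simp
      qed
      then show "{e \<in> edges G. v \<in> ends G e} \<inter> {e \<in> edges G. w \<in> ends G e} = {}"
        by blast
    qed
    show "finite (C \<inter> A)"
      using finite_component[OF G C] by simp
  qed (use G in simp)
  finally show ?thesis
    by (simp add: degree_in_def)
qed

lemma cuts_compl: "multigraph G \<Longrightarrow> A \<in> cuts G \<Longrightarrow> verts G - A \<in> cuts G"
  by (auto simp: cuts_def edge_boundary_compl)

lemma component_Diff_cut: "C \<in> components G \<Longrightarrow> C \<inter> (verts G - A) = C - A"
  using component_subset[of C G] by blast

lemma component_Diff_compl: "C \<in> components G \<Longrightarrow> C - (verts G - A) = C \<inter> A"
  using component_subset[of C G] by blast

text \<open>Each edge has one end on either side of the cut, so the degrees on each side add up to the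
  number of edges.\<close>

lemma handshake_component:
  assumes "multigraph G" "A \<in> cuts G" "C \<in> components G"
  shows "(\<Sum>v\<in>C. degree_in G v) = 2 * card (component_edges G C)"
proof -
  have "(\<Sum>v\<in>C. degree_in G v) = (\<Sum>v\<in>C \<inter> A. degree_in G v) + (\<Sum>v\<in>C - A. degree_in G v)"
    by (rule sum.Int_Diff) (rule finite_component[OF assms(1,3)])
  then show ?thesis
    using sum_degree_over_cut[OF assms] component_Diff_cut[OF assms(3), of A]
      sum_degree_over_cut[OF assms(1) cuts_compl[OF assms(1,2)] assms(3)] by simp
qed

lemma even_component_if_odd_degrees:
  assumes "multigraph G" "A \<in> cuts G" "C \<in> components G" "\<And>v. v \<in> C \<Longrightarrow> odd (degree_in G v)"
  shows "even (card C)"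
proof -
  have "even (\<Sum>v\<in>C. degree_in G v)"
    using handshake_component[OF assms(1-3)] by simp
  moreover have "{v \<in> C. odd (degree_in G v)} = C"
    using assms(4) by blast
  ultimately show ?thesis
    using even_sum_iff[OF finite_component[OF assms(1,3)], of "degree_in G"] by simp
qed

text \<open>Discard the edges outside \<open>C\<close>: the remaining forest has only \<open>C\<close> and singletons as
  components, and the number of its closed sets gives the number of its edges.\<close>

lemma forest_card_component_edges:
  assumes G: "multigraph G" "forest G" and C: "C \<in> components G"
  shows "card (component_edges G C) + 1 = card C"
proof -
  let ?F = "component_edges G C" and ?V = "verts G"
  let ?H = "spanning G ?F"
  have sub: "?F \<subseteq> edges G"
    by (auto simp: component_edges_def)
  note H = multigraph_spanning[OF G(1) sub]
  have boundary: "edge_boundary ?H W = edge_boundary G W \<inter> ?F" for W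
    by (rule edge_boundary_spanning[OF sub])
  have "forest ?H"
    unfolding forest_def
  proof
    fix e assume e: "e \<in> edges ?H"
    then have "bridge G e"
      using G(2) sub by (auto simp: forest_def)
    then obtain U where "U \<subseteq> ?V" "edge_boundary G U = {e}"
      unfolding bridge_def by blast
    then show "bridge ?H e"
      using e boundary[of U] unfolding bridge_def by (intro exI[of _ U]) auto
  qed
  then have count: "card (closed_sets ?H) * 2 ^ card ?F = 2 ^ card ?V"
    using forest_card_closed_sets[OF H] by simp
  have CV: "C \<subseteq> ?V" and finC: "finite C" and finV: "finite ?V"
    using component_subset[OF C] finite_component[OF G(1) C] G(1) by simp_all
  have "closed_sets ?H = Pow (?V - C) \<union> (\<lambda>X. C \<union> X) ` Pow (?V - C)"
  proof (intro equalityI subsetI)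
    fix X assume X: "X \<in> closed_sets ?H"
    have "X \<inter> C \<in> closed_sets G"
      unfolding closed_sets_iff[OF G(1)]
    proof (intro conjI ballI)
      show "X \<inter> C \<subseteq> ?V"
        using CV by blast
      fix e assume e: "e \<in> edges G"
      show "ends G e \<subseteq> X \<inter> C \<or> ends G e \<inter> (X \<inter> C) = {}"
      proof (cases "ends G e \<subseteq> C")
        case True
        then have "ends ?H e \<subseteq> X \<or> ends ?H e \<inter> X = {}"
          using X e unfolding closed_sets_iff[OF H] by (simp add: component_edges_def)
        then show ?thesis
          using True by auto
      next
        case False
        then show ?thesis
          using component_ends[OF G(1) C e] by blast
      qed
    qed
    then have "X \<inter> C = {} \<or> X \<inter> C = C"
      by (rule component_minimal[OF C]) blast
    moreover have "X \<subseteq> ?V"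
      using closed_sets_subset[OF X] by simp
    moreover have "X = C \<union> (X - C)" if "X \<inter> C = C"
      using that by blast
    ultimately show "X \<in> Pow (?V - C) \<union> (\<lambda>X. C \<union> X) ` Pow (?V - C)"
      by blast
  next
    fix X assume "X \<in> Pow (?V - C) \<union> (\<lambda>X. C \<union> X) ` Pow (?V - C)"
    then have "X \<subseteq> ?V" "C \<subseteq> X \<or> C \<inter> X = {}"
      using CV by blast+
    then show "X \<in> closed_sets ?H"
      unfolding closed_sets_iff[OF H] by (auto simp: component_edges_def)
  qed
  moreover have "Pow (?V - C) \<inter> (\<lambda>X. C \<union> X) ` Pow (?V - C) = {}"
    using component_nonempty[OF C] by blast
  moreover have "inj_on (\<lambda>X. C \<union> X) (Pow (?V - C))"
    by (rule inj_onI) blast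
  ultimately have "card (closed_sets ?H) = 2 * 2 ^ card (?V - C)"
    using finV by (simp add: card_Un_disjoint card_image card_Pow)
  then have "(2::nat) ^ (card ?F + 1 + card (?V - C)) = 2 ^ card ?V"
    using count by (simp add: power_add mult_ac)
  then have "card ?F + 1 + card (?V - C) = card ?V"
    by (rule power_inject_exp[THEN iffD1, rotated]) simp
  moreover have "card (?V - C) + card C = card ?V"
    using card_Diff_subset[OF finC CV] card_mono[OF finV CV] by simp
  ultimately show ?thesis
    by linarith
qed

lemma forest_card_components:
  assumes "multigraph G" "forest G"
  shows "card (components G) + card (edges G) = card (verts G)"
proof -
  have "(2::nat) ^ (card (components G) + card (edges G)) = 2 ^ card (verts G)"
    using forest_card_closed_sets[OF assms] card_closed_sets_components[OF assms(1)]
    by (simp add: power_add)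
  then show ?thesis
    by simp
qed

text \<open>If all vertices on one side of a bipartite tree had degree at least two, the tree would have
  at least twice as many edges as vertices on this side, so the side is the smaller one.\<close>

lemma larger_side_has_leaf:
  assumes G: "multigraph G" "forest G" and A: "A \<in> cuts G"
    and C: "C \<in> components G" "card C \<noteq> 1" and larger: "card (C - A) \<le> card (C \<inter> A)"
  obtains v where "v \<in> C \<inter> A" "degree_in G v = 1"
proof (rule ccontr)
  note found = that
  assume none: "\<not> thesis"
  have "degree_in G v \<ge> 2" if "v \<in> C \<inter> A" for v
  proof -
    have "degree_in G v \<noteq> 0"
      using component_card_1_iff[OF G(1) C(1), of v] C(2) that by blast
    moreover have "degree_in G v \<noteq> 1"
      using none found[OF that] by blast
    ultimately show ?thesis
      by simp
  qed
  then have "card (C \<inter> A) * 2 \<le> card (component_edges G C)"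
    using sum_bounded_below[of "C \<inter> A" 2 "degree_in G"] sum_degree_over_cut[OF G(1) A C(1)] by simp
  then show False
    using forest_card_component_edges[OF G C(1)] card_split[OF finite_component[OF G(1) C(1)], of A] larger
    by linarith
qed

section \<open>Deleting an edge of a forest\<close>

lemma edge_boundary_Int_closed:
  assumes G: "multigraph G" and C: "C \<in> closed_sets G"
    and U: "edge_boundary G U = {e}" and e: "ends G e \<subseteq> C"
  shows "edge_boundary G (C \<inter> U) = {e}"
proof (rule edge_boundary_eqI[OF G])
  fix f u v assume f: "f \<in> edges G" "ends G f = {u, v}" "u \<noteq> v"
  have "ends G f \<subseteq> C \<or> ends G f \<inter> C = {}"
    using C f(1) unfolding closed_sets_iff[OF G] by blast
  moreover have "f = e \<longleftrightarrow> (u \<in> U) \<noteq> (v \<in> U)"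
    using in_edge_boundary_iff[OF f, of U] U by simp
  ultimately show "f \<in> {e} \<longleftrightarrow> ((u \<in> C \<inter> U) \<noteq> (v \<in> C \<inter> U))"
    using f(2) e by auto
qed (use U edge_boundary_subset[of G U] in simp)

text \<open>If \<open>U\<close> has boundary \<open>{e}\<close>, then so has \<open>C \<inter> U\<close>, and the kernel for \<open>G - e\<close> consists of the
  sets \<open>X\<close> and \<open>sym_diff (C \<inter> U) X\<close> with \<open>X\<close> in the kernel for \<open>G\<close>.  This shows that the two parts
  of \<open>C\<close> are minimal.\<close>

lemma components_delete_edge:
  assumes G: "multigraph G" and e: "e \<in> edges G" and U: "U \<subseteq> verts G" "edge_boundary G U = {e}"
  obtains C where "C \<in> components G" "ends G e \<subseteq> C" "C \<inter> U \<noteq> {}" "C - U \<noteq> {}"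
    "components (delete_edge G e) = {C \<inter> U, C - U} \<union> (components G - {C})"
proof -
  let ?H = "delete_edge G e"
  have H: "multigraph ?H"
    using G by simp
  obtain C where C: "C \<in> components G" "ends G e \<subseteq> C"
    by (rule edge_component[OF G e])
  obtain a b where ab: "ends G e = {a, b}" "a \<noteq> b"
    by (rule multigraph_ends[OF G e])
  have "(a \<in> U) \<noteq> (b \<in> U)"
    using in_edge_boundary_iff[OF e ab, of U] U(2) by simp
  then have ne: "C \<inter> U \<noteq> {}" "C - U \<noteq> {}"
    using C(2) ab(1) by blast+
  have boundary_C: "edge_boundary G C = {}"
    using component_closed[OF C(1)] by (simp add: closed_sets_def)
  have part: "C \<inter> Z \<in> components ?H"
    if Z: "Z \<subseteq> verts G" "edge_boundary G Z = {e}" and "C \<inter> Z \<noteq> {}" "C - Z \<noteq> {}" for Z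
  proof -
    have boundary: "edge_boundary G (C \<inter> Z) = {e}"
      by (rule edge_boundary_Int_closed[OF G component_closed[OF C(1)] Z(2) C(2)])
    then have closed: "C \<inter> Z \<in> closed_sets ?H"
      using Z(1) by (auto simp: closed_sets_def)
    have "X = {} \<or> X = C \<inter> Z" if X: "X \<in> closed_sets ?H" "X \<subseteq> C \<inter> Z" for X
    proof -
      have XV: "X \<subseteq> verts G" and "edge_boundary G X = {} \<or> edge_boundary G X = {e}"
        using X(1) unfolding closed_sets_delete_edge by blast+
      then consider "X \<in> closed_sets G" | "edge_boundary G X = {e}"
        by (auto simp: closed_sets_def)
      then show ?thesis
      proof cases
        case 1
        then show ?thesis
          using component_minimal[OF C(1), of X] X(2) \<open>C - Z \<noteq> {}\<close> by blast
      next
        \<comment> \<open>then \<open>X\<close> and \<open>C \<inter> Z\<close> have the same boundary\<close>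
        case 2
        then have "edge_boundary G (sym_diff (C \<inter> Z) X) = {}"
          using edge_boundary_sym_diff[OF G, of "C \<inter> Z" X] boundary by simp
        then have "sym_diff (C \<inter> Z) X \<in> closed_sets G"
          using XV Z(1) by (auto simp: closed_sets_def)
        then have "sym_diff (C \<inter> Z) X = {} \<or> sym_diff (C \<inter> Z) X = C"
          by (rule component_minimal[OF C(1)]) (use X(2) in blast)
        then show ?thesis
          using X(2) \<open>C - Z \<noteq> {}\<close> by blast
      qed
    qed
    then show ?thesis
      using closed \<open>C \<inter> Z \<noteq> {}\<close> unfolding components_def by blast
  qed
  have part1: "C \<inter> U \<in> components ?H"
    by (rule part[OF U ne])
  have "C \<inter> (verts G - U) \<in> components ?H"
    by (rule part) (use ne edge_boundary_compl[OF G U(1)] U component_subset[OF C(1)] in auto)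
  then have part2: "C - U \<in> components ?H"
    using component_Diff_cut[OF C(1), of U] by simp
  have other: "C' \<in> components ?H" if C': "C' \<in> components G" "C' \<noteq> C" for C'
  proof -
    have disj: "C' \<inter> C = {}"
      by (rule components_disjoint[OF G C'(1) C(1) C'(2)])
    have "X = {} \<or> X = C'" if X: "X \<in> closed_sets ?H" "X \<subseteq> C'" for X
    proof -
      have "ends G e \<inter> X = {}"
        using X(2) disj C(2) by blast
      then have "e \<notin> edge_boundary G X"
        by (simp add: edge_boundary_def)
      then have "X \<in> closed_sets G"
        using X(1) unfolding closed_sets_delete_edge by (auto simp: closed_sets_def)
      then show ?thesis
        using component_minimal[OF C'(1)] X(2) by blast
    qed
    moreover have "C' \<in> closed_sets ?H"
      using component_closed[OF C'(1)] by (auto simp: closed_sets_def)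
    ultimately show ?thesis
      using component_nonempty[OF C'(1)] unfolding components_def by blast
  qed
  have "components ?H = {C \<inter> U, C - U} \<union> (components G - {C})"
  proof (intro equalityI subsetI)
    fix D assume D: "D \<in> components ?H"
    then obtain v where v: "v \<in> D" "v \<in> verts G"
      using component_nonempty[OF D] component_subset[OF D] by auto
    obtain C' where C': "C' \<in> components G" "v \<in> C'"
      by (rule component_exists[OF G v(2)])
    obtain D' where D': "D' \<in> {C \<inter> U, C - U} \<union> (components G - {C})" "v \<in> D'"
      using C' by (cases "C' = C") auto
    then have "D' \<in> components ?H"
      using part1 part2 other by blast
    then have "D = D'"
      using components_disjoint[OF H D, of D'] v(1) D'(2) by blast
    then show "D \<in> {C \<inter> U, C - U} \<union> (components G - {C})"
      using D'(1) by simp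
  qed (use part1 part2 other in blast)
  then show thesis
    using that C ne by blast
qed

lemma imbalances_delete_edge:
  assumes G: "multigraph G" and e: "e \<in> edges G" and U: "U \<subseteq> verts G" "edge_boundary G U = {e}"
  obtains C where "C \<in> components G" "ends G e \<subseteq> C" "C \<inter> U \<noteq> {}" "C - U \<noteq> {}" "card C \<noteq> 1"
    "isolated_count (delete_edge G e) =
       isolated_count G + of_bool (card (C \<inter> U) = 1) + of_bool (card (C - U) = 1)"
    "imbalances A (delete_edge G e) = imbalances A G - {#imbalance A C#} +
       (if card (C \<inter> U) = 1 then {#} else {#imbalance A (C \<inter> U)#}) +
       (if card (C - U) = 1 then {#} else {#imbalance A (C - U)#})"
proof -
  let ?H = "delete_edge G e"
  have H: "multigraph ?H"
    using G by simp
  obtain C where C: "C \<in> components G" "ends G e \<subseteq> C" "C \<inter> U \<noteq> {}" "C - U \<noteq> {}"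
    and comps: "components ?H = {C \<inter> U, C - U} \<union> (components G - {C})"
    by (rule components_delete_edge[OF G e U])
  let ?X = "C \<inter> U" and ?Y = "C - U"
  have "card (ends G e) = 2"
    using G e unfolding multigraph_def by blast
  then have "card C \<noteq> 1"
    using card_mono[OF finite_component[OF G C(1)] C(2)] by simp
  have XY: "?X \<noteq> ?Y"
    using C(3) by blast
  have "?X \<notin> components G" "?Y \<notin> components G"
    using components_disjoint[OF G _ C(1), of ?X] components_disjoint[OF G _ C(1), of ?Y] C(3,4) by blast+
  note new = this
  define S where "S P = {Z \<in> {?X, ?Y}. P (card Z)}" for P
  have split: "{D \<in> components ?H. P (card D)} = {D \<in> components G. P (card D)} - {C} \<union> S P"
    and disj: "({D \<in> components G. P (card D)} - {C}) \<inter> S P = {}"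
    and fin: "finite {D \<in> components G. P (card D)}" "finite (S P)" for P
    unfolding comps S_def using new G by auto
  have C_not_1: "C \<notin> {D \<in> components G. card D = 1}"
    using \<open>card C \<noteq> 1\<close> by simp
  have "isolated_count ?H = card {D \<in> components G. card D = 1} + card (S (\<lambda>n. n = 1))"
    unfolding isolated_count_components[OF H] split[of "\<lambda>n. n = 1"]
    using card_Un_disjoint[OF _ fin(2) disj, of "\<lambda>n. n = 1"] fin(1)[of "\<lambda>n. n = 1"] C_not_1 by simp
  also have "card (S (\<lambda>n. n = 1)) = of_bool (card ?X = 1) + of_bool (card ?Y = 1)"
  proof -
    have "S (\<lambda>n. n = 1) = (if card ?X = 1 then {?X} else {}) \<union> (if card ?Y = 1 then {?Y} else {})"
      by (auto simp: S_def)
    then show ?thesis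
      using XY by simp
  qed
  finally have iso: "isolated_count ?H =
      isolated_count G + of_bool (card ?X = 1) + of_bool (card ?Y = 1)"
    unfolding isolated_count_components[OF G] by simp
  have "mset_set {D \<in> components ?H. card D \<noteq> 1} =
      mset_set ({D \<in> components G. card D \<noteq> 1} - {C}) + mset_set (S (\<lambda>n. n \<noteq> 1))"
    unfolding split[of "\<lambda>n. n \<noteq> 1"]
    by (rule mset_set_Union[OF _ fin(2) disj]) (use fin(1)[of "\<lambda>n. n \<noteq> 1"] in simp)
  also have "mset_set ({D \<in> components G. card D \<noteq> 1} - {C}) =
      mset_set {D \<in> components G. card D \<noteq> 1} - {#C#}"
    using C(1) \<open>card C \<noteq> 1\<close> fin(1)[of "\<lambda>n. n \<noteq> 1"] by (subst mset_set_Diff) auto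
  also have "mset_set (S (\<lambda>n. n \<noteq> 1)) =
      (if card ?X = 1 then {#} else {#?X#}) + (if card ?Y = 1 then {#} else {#?Y#})"
  proof -
    have "S (\<lambda>n. n \<noteq> 1) = (if card ?X = 1 then {} else {?X}) \<union> (if card ?Y = 1 then {} else {?Y})"
      by (auto simp: S_def)
    then show ?thesis
      using XY by simp
  qed
  finally have "imbalances A ?H = image_mset (imbalance A) (mset_set {D \<in> components G. card D \<noteq> 1} - {#C#}) +
      ((if card ?X = 1 then {#} else {#imbalance A ?X#}) + (if card ?Y = 1 then {#} else {#imbalance A ?Y#}))"
    unfolding imbalances_def by simp
  moreover have "image_mset (imbalance A) (mset_set {D \<in> components G. card D \<noteq> 1} - {#C#}) =
      imbalances A G - {#imbalance A C#}"
    unfolding imbalances_def using C(1) \<open>card C \<noteq> 1\<close> fin(1)[of "\<lambda>n. n \<noteq> 1"]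
    by (subst image_mset_Diff) auto
  ultimately have "imbalances A ?H = imbalances A G - {#imbalance A C#} +
       (if card ?X = 1 then {#} else {#imbalance A ?X#}) +
       (if card ?Y = 1 then {#} else {#imbalance A ?Y#})"
    by (simp only: add.assoc)
  then show thesis
    using that C \<open>card C \<noteq> 1\<close> iso by blast
qed

lemma forest_obtain_side:
  assumes "forest G" "e \<in> edges G"
  obtains U where "U \<subseteq> verts G" "edge_boundary G U = {e}"
proof -
  have "bridge G e"
    using assms by (simp add: forest_def)
  then show thesis
    unfolding bridge_def using that by blast
qed

lemma surplus_split:
  assumes "multigraph G" "C \<in> components G"
  shows "surplus A C = surplus A (C \<inter> U) + surplus A (C - U)"
proof -
  have "finite C"
    by (rule finite_component[OF assms])
  then show ?thesis
    using surplus_Un[of "C \<inter> U" "C - U" A] by (simp add: Int_Diff_Un Int_Diff_disjoint)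
qed

lemma surplus_singleton: "surplus A {v} = (if v \<in> A then 1 else - 1)"
  by (simp add: surplus_def insert_Diff_if)

text \<open>The two ways in which the absolute value of a surplus can change when one vertex leaves: to
  \<open>Suc d\<close>, or to the following value.  A balanced bipartition always becomes unbalanced.\<close>

definition step_down :: "nat \<Rightarrow> nat" where
  "step_down d = (if d = 0 then 1 else d - 1)"

lemma isolate_leaf:
  assumes G: "multigraph G" and C: "C \<in> components G" "v \<in> C" and v: "degree_in G v = 1"
  obtains e where "e \<in> edges G"
    "isolated_count (delete_edge G e) = isolated_count G + 1 + of_bool (card (C - {v}) = 1)"
    "card (C - {v}) \<noteq> 1 \<longrightarrow> imbalances A (delete_edge G e) =
       imbalances A G - {#imbalance A C#} + {#nat \<bar>surplus A C - (if v \<in> A then 1 else - 1)\<bar>#}"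
proof -
  obtain e where e: "edge_boundary G {v} = {e}"
    using v card_edge_boundary_singleton[of G v] by (auto simp: card_1_singleton_iff)
  have eE: "e \<in> edges G"
    using e edge_boundary_subset[of G "{v}"] by auto
  have "v \<in> verts G"
    using C component_subset by blast
  then obtain C' where C': "C' \<in> components G" "C' \<inter> {v} \<noteq> {}"
    and iso: "isolated_count (delete_edge G e) =
       isolated_count G + of_bool (card (C' \<inter> {v}) = 1) + of_bool (card (C' - {v}) = 1)"
    and imb: "imbalances A (delete_edge G e) = imbalances A G - {#imbalance A C'#} +
       (if card (C' \<inter> {v}) = 1 then {#} else {#imbalance A (C' \<inter> {v})#}) +
       (if card (C' - {v}) = 1 then {#} else {#imbalance A (C' - {v})#})"
    using imbalances_delete_edge[OF G eE _ e, of A] by auto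
  have "C' = C"
    using components_disjoint[OF G C'(1) C(1)] C'(2) C(2) by blast
  have single: "C \<inter> {v} = {v}"
    using C(2) by blast
  have "imbalance A (C - {v}) = nat \<bar>surplus A C - (if v \<in> A then 1 else - 1)\<bar>"
    using surplus_split[OF G C(1), of A "{v}"] unfolding single surplus_singleton
    by (simp add: imbalance_def)
  then show thesis
    using that[OF eE] iso imb unfolding \<open>C' = C\<close> single by simp
qed

lemma leaf_in_larger_side:
  assumes G: "multigraph G" "forest G" and A: "A \<in> cuts G" and C: "C \<in> components G" "card C \<noteq> 1"
  obtains v where "v \<in> C" "degree_in G v = 1" "if v \<in> A then surplus A C \<ge> 0 else surplus A C \<le> 0"
proof (cases "card (C - A) \<le> card (C \<inter> A)")
  case True
  obtain v where "v \<in> C \<inter> A" "degree_in G v = 1"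
    by (rule larger_side_has_leaf[OF G A C True])
  then show thesis
    using True by (intro that[of v]) (auto simp: surplus_def)
next
  case False
  then have le: "card (C - (verts G - A)) \<le> card (C \<inter> (verts G - A))"
    using component_Diff_cut[OF C(1), of A] component_Diff_compl[OF C(1), of A] by simp
  obtain v where "v \<in> C \<inter> (verts G - A)" "degree_in G v = 1"
    by (rule larger_side_has_leaf[OF G cuts_compl[OF G(1) A] C le])
  then show thesis
    using False by (intro that[of v]) (auto simp: surplus_def)
qed

text \<open>The larger side of a component contains a leaf, and isolating it decrements the difference of
  the sides; if the sides are equal, the difference becomes one.\<close>

lemma balancing_leaf_card:
  assumes G: "multigraph G" "forest G" and A: "A \<in> cuts G"
    and no_K2: "\<And>e. e \<in> edges G \<Longrightarrow> isolated_count (delete_edge G e) \<noteq> isolated_count G + 2"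
    and d: "d \<in># imbalances A G"
  obtains e where "e \<in> edges G" "isolated_count (delete_edge G e) = isolated_count G + 1"
    "imbalances A (delete_edge G e) = imbalances A G - {#d#} + {#step_down d#}"
proof -
  obtain C where C: "C \<in> components G" "card C \<noteq> 1" and dC: "d = imbalance A C"
    using d in_imbalances[OF G(1)] by blast
  obtain v where v: "v \<in> C" "degree_in G v = 1"
    and side: "if v \<in> A then surplus A C \<ge> 0 else surplus A C \<le> 0"
    by (rule leaf_in_larger_side[OF G A C])
  obtain e where e: "e \<in> edges G"
    "isolated_count (delete_edge G e) = isolated_count G + 1 + of_bool (card (C - {v}) = 1)"
    "card (C - {v}) \<noteq> 1 \<longrightarrow> imbalances A (delete_edge G e) =
       imbalances A G - {#imbalance A C#} + {#nat \<bar>surplus A C - (if v \<in> A then 1 else - 1)\<bar>#}"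
    by (rule isolate_leaf[OF G(1) C(1) v, of A])
  have ne: "card (C - {v}) \<noteq> 1"
    using no_K2[OF e(1)] e(2) by auto
  have "nat \<bar>surplus A C - (if v \<in> A then 1 else - 1)\<bar> = step_down d"
    using side unfolding dC imbalance_def step_down_def by (auto split: if_splits)
  then show thesis
    using that[OF e(1)] e(2,3) ne dC by simp
qed

lemma leaf_edge_card:
  assumes G: "multigraph G" "forest G" and e: "e \<in> edges G"
    and iso: "isolated_count (delete_edge G e) = isolated_count G + 1"
  shows "\<exists>d\<in>#imbalances A G.
    imbalances A (delete_edge G e) = imbalances A G - {#d#} + {#step_down d#} \<or>
    imbalances A (delete_edge G e) = imbalances A G - {#d#} + {#Suc d#}"
proof -
  obtain U where U: "U \<subseteq> verts G" "edge_boundary G U = {e}"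
    by (rule forest_obtain_side[OF G(2) e])
  obtain C where C: "C \<in> components G" "card C \<noteq> 1"
    and iso': "isolated_count (delete_edge G e) =
       isolated_count G + of_bool (card (C \<inter> U) = 1) + of_bool (card (C - U) = 1)"
    and imb: "imbalances A (delete_edge G e) = imbalances A G - {#imbalance A C#} +
       (if card (C \<inter> U) = 1 then {#} else {#imbalance A (C \<inter> U)#}) +
       (if card (C - U) = 1 then {#} else {#imbalance A (C - U)#})"
    by (rule imbalances_delete_edge[OF G(1) e U, of A])
  have one: "surplus A X = 1 \<or> surplus A X = - 1" if "card X = 1" for X
    using that by (auto simp: card_1_singleton_iff surplus_singleton split: if_splits)
  have change: "imbalance A Y = step_down (imbalance A C) \<or> imbalance A Y = Suc (imbalance A C)"
    if "card X = 1" "surplus A C = surplus A X + surplus A Y" for X Y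
  proof (cases "surplus A C = 0")
    case True
    then have "\<bar>surplus A Y\<bar> = 1"
      using one[OF that(1)] that(2) by linarith
    then show ?thesis
      using True by (simp add: imbalance_def)
  next
    case False
    then have "step_down (imbalance A C) = nat \<bar>surplus A C\<bar> - 1"
      by (simp add: imbalance_def step_down_def)
    then show ?thesis
      using one[OF that(1)] that(2) unfolding imbalance_def by linarith
  qed
  have "imbalance A C \<in># imbalances A G"
    using in_imbalances[OF G(1)] C by blast
  moreover consider "card (C \<inter> U) = 1" "card (C - U) \<noteq> 1" | "card (C \<inter> U) \<noteq> 1" "card (C - U) = 1"
    using iso iso' by (cases "card (C \<inter> U) = 1"; cases "card (C - U) = 1") simp_all
  then have "imbalances A (delete_edge G e) = imbalances A G - {#imbalance A C#} + {#step_down (imbalance A C)#} \<or>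
    imbalances A (delete_edge G e) = imbalances A G - {#imbalance A C#} + {#Suc (imbalance A C)#}"
  proof cases
    case 1
    then show ?thesis
      using imb change[OF 1(1), of "C - U"] surplus_split[OF G(1) C(1), of A U] by auto
  next
    case 2
    then show ?thesis
      using imb change[OF 2(2), of "C \<inter> U"] surplus_split[OF G(1) C(1), of A U] by auto
  qed
  ultimately show ?thesis
    by blast
qed

lemma K2_edge_card:
  assumes G: "multigraph G" "forest G" and A: "A \<in> cuts G" and e: "e \<in> edges G"
    and iso: "isolated_count (delete_edge G e) = isolated_count G + 2"
  shows "0 \<in># imbalances A G" "imbalances A (delete_edge G e) = imbalances A G - {#0#}"
proof -
  obtain U where U: "U \<subseteq> verts G" "edge_boundary G U = {e}"
    by (rule forest_obtain_side[OF G(2) e])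
  obtain C where C: "C \<in> components G" "ends G e \<subseteq> C" "card C \<noteq> 1"
    and iso': "isolated_count (delete_edge G e) =
       isolated_count G + of_bool (card (C \<inter> U) = 1) + of_bool (card (C - U) = 1)"
    and imb: "imbalances A (delete_edge G e) = imbalances A G - {#imbalance A C#} +
       (if card (C \<inter> U) = 1 then {#} else {#imbalance A (C \<inter> U)#}) +
       (if card (C - U) = 1 then {#} else {#imbalance A (C - U)#})"
    by (rule imbalances_delete_edge[OF G(1) e U, of A])
  have parts: "card (C \<inter> U) = 1" "card (C - U) = 1"
    using iso iso' by (cases "card (C \<inter> U) = 1"; cases "card (C - U) = 1"; simp)+
  have finC: "finite C"
    by (rule finite_component[OF G(1) C(1)])
  have "card (ends G e) = 2"
    using G(1) e unfolding multigraph_def by blast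
  moreover have "card C = 2"
    using parts card_split[OF finC, of U] by simp
  ultimately have "ends G e = C"
    using C(2) finC by (simp add: card_subset_eq)
  moreover have "card (ends G e \<inter> A) = 1"
    using A e by (auto simp: cuts_def edge_boundary_def)
  ultimately have "card (C \<inter> A) = 1" "card (C - A) = 1"
    using \<open>card C = 2\<close> card_split[OF finC, of A] by simp_all
  then have zero: "imbalance A C = 0"
    by (simp add: imbalance_def surplus_def)
  show "0 \<in># imbalances A G"
    using in_imbalances[OF G(1)] C zero by metis
  show "imbalances A (delete_edge G e) = imbalances A G - {#0#}"
    using imb parts zero by simp
qed

lemma internal_edge_card:
  assumes G: "multigraph G" "forest G" and e: "e \<in> edges G"
    and iso: "isolated_count (delete_edge G e) = isolated_count G"
  obtains d d\<^sub>1 d\<^sub>2 where "d \<in># imbalances A G"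
    "imbalances A (delete_edge G e) = imbalances A G - {#d#} + {#d\<^sub>1, d\<^sub>2#}"
    "d = d\<^sub>1 + d\<^sub>2 \<or> d\<^sub>1 = d + d\<^sub>2 \<or> d\<^sub>2 = d + d\<^sub>1"
proof -
  obtain U where U: "U \<subseteq> verts G" "edge_boundary G U = {e}"
    by (rule forest_obtain_side[OF G(2) e])
  obtain C where C: "C \<in> components G" "card C \<noteq> 1"
    and iso': "isolated_count (delete_edge G e) =
       isolated_count G + of_bool (card (C \<inter> U) = 1) + of_bool (card (C - U) = 1)"
    and imb: "imbalances A (delete_edge G e) = imbalances A G - {#imbalance A C#} +
       (if card (C \<inter> U) = 1 then {#} else {#imbalance A (C \<inter> U)#}) +
       (if card (C - U) = 1 then {#} else {#imbalance A (C - U)#})"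
    by (rule imbalances_delete_edge[OF G(1) e U, of A])
  have "card (C \<inter> U) \<noteq> 1" "card (C - U) \<noteq> 1"
    using iso iso' by auto
  then have "imbalances A (delete_edge G e) =
      imbalances A G - {#imbalance A C#} + {#imbalance A (C \<inter> U), imbalance A (C - U)#}"
    using imb by simp
  moreover have "imbalance A C \<in># imbalances A G"
    using in_imbalances[OF G(1)] C by blast
  moreover have "imbalance A C = imbalance A (C \<inter> U) + imbalance A (C - U) \<or>
      imbalance A (C \<inter> U) = imbalance A C + imbalance A (C - U) \<or>
      imbalance A (C - U) = imbalance A C + imbalance A (C \<inter> U)"
    using surplus_split[OF G(1) C(1), of A U] unfolding imbalance_def by linarith
  ultimately show thesis
    using that by blast
qed

lemma even_card_sym_diff:
  assumes "finite X" "finite Y"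
  shows "even (card (sym_diff X Y)) \<longleftrightarrow> (even (card X) \<longleftrightarrow> even (card Y))"
proof -
  have "card (sym_diff X Y) = card (X - Y) + card (Y - X)"
    by (rule card_Un_disjoint) (use assms in auto)
  moreover have "card X = card (X \<inter> Y) + card (X - Y)" "card Y = card (X \<inter> Y) + card (Y - X)"
    using card_split[OF assms(1), of Y] card_split[OF assms(2), of X] by (simp_all add: Int_commute)
  ultimately show ?thesis
    by presburger
qed

text \<open>Modulo two, the sizes of the sides add up like their boundaries: if every edge of \<open>C\<close> has an odd
  side, a subset of \<open>C\<close> is odd iff its boundary is.  Applied to a single vertex, this says
  that its degree is odd.\<close>

lemma odd_degree_if_odd_sides:
  assumes G: "multigraph G" and C: "C \<in> components G" "even (card C)" and v: "v \<in> C"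
    and sides: "\<And>e. e \<in> component_edges G C \<Longrightarrow> \<exists>U\<subseteq>C. edge_boundary G U = {e} \<and> odd (card U)"
  shows "odd (degree_in G v)"
proof -
  have finC: "finite C"
    by (rule finite_component[OF G C(1)])
  have ex: "\<exists>X\<subseteq>C. edge_boundary G X = S \<and> (even (card X) \<longleftrightarrow> even (card S))"
    if "finite S" "S \<subseteq> component_edges G C" for S
    using that
  proof (induction S rule: finite_induct)
    case empty
    show ?case
      by (intro exI[of _ "{}"]) simp
  next
    case (insert e S)
    then obtain X where X: "X \<subseteq> C" "edge_boundary G X = S" "even (card X) \<longleftrightarrow> even (card S)"
      by auto
    obtain U where U: "U \<subseteq> C" "edge_boundary G U = {e}" "odd (card U)"
      using sides[of e] insert.prems by auto
    have "edge_boundary G (sym_diff X U) = insert e S"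
      using edge_boundary_sym_diff[OF G, of X U] X(2) U(2) insert.hyps by auto
    moreover have "even (card (sym_diff X U)) \<longleftrightarrow> even (card (insert e S))"
      using even_card_sym_diff[of X U] X U insert.hyps finite_subset[OF X(1) finC] finite_subset[OF U(1) finC]
      by simp
    ultimately show ?case
      using X(1) U(1) by (intro exI[of _ "sym_diff X U"]) auto
  qed
  have "edge_boundary G {v} \<subseteq> component_edges G C"
    using component_ends[OF G C(1) _ _ v] by (auto simp: edge_boundary_singleton component_edges_def)
  then obtain X where X: "X \<subseteq> C" "edge_boundary G X = edge_boundary G {v}"
    "even (card X) \<longleftrightarrow> even (card (edge_boundary G {v}))"
    using ex[of "edge_boundary G {v}"] G by auto
  have "edge_boundary G (sym_diff X {v}) = {}"
    using edge_boundary_sym_diff[OF G, of X "{v}"] X(2) by simp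
  then have "sym_diff X {v} \<in> closed_sets G"
    using X(1) v component_subset[OF C(1)] by (auto simp: closed_sets_def)
  then have "sym_diff X {v} = {} \<or> sym_diff X {v} = C"
    by (rule component_minimal[OF C(1)]) (use X(1) v in blast)
  then have "even (card (sym_diff X {v}))"
    using C(2) by (metis card.empty even_zero)
  then have "odd (card X)"
    using even_card_sym_diff[of X "{v}"] finite_subset[OF X(1) finC] by simp
  then show ?thesis
    using X(3) by (simp add: card_edge_boundary_singleton)
qed

text \<open>An odd element of a card of even imbalances must come from the component that was split; this
  has even order, so both parts are odd.\<close>

lemma odd_degrees_if_odd_cards:
  assumes G: "multigraph G" "forest G"
    and even_imb: "\<And>d. d \<in># imbalances A G \<Longrightarrow> even d"
    and odd_imb: "\<And>e. e \<in> edges G \<Longrightarrow> isolated_count (delete_edge G e) = isolated_count G \<Longrightarrow>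
      \<exists>d\<in>#imbalances A (delete_edge G e). odd d"
    and v: "v \<in> verts G" "degree_in G v \<noteq> 0"
  shows "odd (degree_in G v)"
proof -
  obtain C where C: "C \<in> components G" "v \<in> C"
    by (rule component_exists[OF G(1) v(1)])
  have "card C \<noteq> 1"
    using component_card_1_iff[OF G(1) C] v(2) by simp
  then have evenC: "even (card C)"
    using even_imb in_imbalances[OF G(1)] C(1) even_imbalance[OF finite_component[OF G(1) C(1)]] by blast
  show ?thesis
  proof (rule odd_degree_if_odd_sides[OF G(1) C(1) evenC C(2)])
    fix e assume "e \<in> component_edges G C"
    then have e: "e \<in> edges G" "ends G e \<subseteq> C"
      by (auto simp: component_edges_def)
    obtain U where U: "U \<subseteq> verts G" "edge_boundary G U = {e}"
      by (rule forest_obtain_side[OF G(2) e(1)])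
    obtain C' where C': "C' \<in> components G" "ends G e \<subseteq> C'"
      and iso: "isolated_count (delete_edge G e) =
         isolated_count G + of_bool (card (C' \<inter> U) = 1) + of_bool (card (C' - U) = 1)"
      and imb: "imbalances A (delete_edge G e) = imbalances A G - {#imbalance A C'#} +
         (if card (C' \<inter> U) = 1 then {#} else {#imbalance A (C' \<inter> U)#}) +
         (if card (C' - U) = 1 then {#} else {#imbalance A (C' - U)#})"
      by (rule imbalances_delete_edge[OF G(1) e(1) U, of A])
    obtain a b where "ends G e = {a, b}"
      by (rule multigraph_ends[OF G(1) e(1)])
    then have "C' = C"
      using components_disjoint[OF G(1) C'(1) C(1)] C'(2) e(2) by blast
    note iso = iso[unfolded \<open>C' = C\<close>] and imb = imb[unfolded \<open>C' = C\<close>]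
    have finC: "finite C"
      by (rule finite_component[OF G(1) C(1)])
    have sum: "even (card (C \<inter> U) + card (C - U))"
      using evenC card_split[OF finC, of U] by simp
    have "odd (card (C \<inter> U))"
    proof (cases "card (C \<inter> U) = 1 \<or> card (C - U) = 1")
      case True
      then show ?thesis
        using sum by auto
    next
      case False
      then obtain d where d: "d \<in># imbalances A (delete_edge G e)" "odd d"
        using odd_imb[OF e(1)] iso by auto
      then have "d = imbalance A (C \<inter> U) \<or> d = imbalance A (C - U)"
        using imb False even_imb by (auto dest: in_diffD)
      then show ?thesis
        using d(2) sum finC even_imbalance[of "C \<inter> U" A] even_imbalance[of "C - U" A] by auto
    qed
    moreover have "edge_boundary G (C \<inter> U) = {e}"
      by (rule edge_boundary_Int_closed[OF G(1) component_closed[OF C(1)] U(2) e(2)])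
    ultimately show "\<exists>U\<subseteq>C. edge_boundary G U = {e} \<and> odd (card U)"
      by (intro exI[of _ "C \<inter> U"]) auto
  qed
qed

lemma sum_degree:
  assumes "multigraph G"
  shows "(\<Sum>v\<in>verts G. degree_in G v) = 2 * card (edges G)"
proof -
  have "(\<Sum>v\<in>verts G. degree_in G v) = (\<Sum>v\<in>verts G. \<Sum>e\<in>{e \<in> edges G. v \<in> ends G e}. 1)"
    by (simp add: degree_in_def)
  also have "\<dots> = (\<Sum>e\<in>edges G. \<Sum>v\<in>{v \<in> verts G. v \<in> ends G e}. 1)"
    by (rule sum.swap_restrict) (use assms in simp_all)
  also have "\<dots> = (\<Sum>e\<in>edges G. 2)"
  proof (rule sum.cong[OF refl])
    fix e assume "e \<in> edges G"
    then have "ends G e \<subseteq> verts G" "card (ends G e) = 2"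
      using assms unfolding multigraph_def by blast+
    then have "{v \<in> verts G. v \<in> ends G e} = ends G e"
      by blast
    then show "(\<Sum>v\<in>{v \<in> verts G. v \<in> ends G e}. 1) = (2::nat)"
      using \<open>card (ends G e) = 2\<close> by simp
  qed
  finally show ?thesis
    by simp
qed

lemma edge_in_nontrivial_component:
  assumes "multigraph G" "e \<in> edges G"
  obtains C where "C \<in> components G" "ends G e \<subseteq> C" "card C \<noteq> 1"
proof -
  obtain C where C: "C \<in> components G" "ends G e \<subseteq> C"
    by (rule edge_component[OF assms])
  have "card (ends G e) = 2"
    using assms unfolding multigraph_def by blast
  then have "card C \<noteq> 1"
    using card_mono[OF finite_component[OF assms(1) C(1)] C(2)] by simp
  then show thesis
    using that C by blast
qed

lemma forest_has_leaf:
  assumes G: "multigraph G" "forest G" "edges G \<noteq> {}"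
  obtains v where "v \<in> verts G" "degree_in G v = 1"
proof -
  obtain e where "e \<in> edges G"
    using G(3) by blast
  then obtain C where C: "C \<in> components G" "card C \<noteq> 1"
    by (rule edge_in_nontrivial_component[OF G(1)])
  obtain A where A: "A \<in> cuts G"
    using forest_cuts_nonempty[OF G(1,2)] by blast
  obtain v where "v \<in> C" "degree_in G v = 1"
    by (rule leaf_in_larger_side[OF G(1,2) A C])
  then show thesis
    using that component_subset[OF C(1)] by blast
qed

section \<open>Reconstructing a multiset from its decrements\<close>

text \<open>What is known about the imbalances of the cards of a forest in which a single leaf has been
  isolated:
  all decrements occur, while increments may or may not occur.\<close>

definition step_family :: "nat multiset \<Rightarrow> nat multiset set \<Rightarrow> bool" where
  "step_family D L \<longleftrightarrow>
     (\<forall>X\<in>L. \<exists>d\<in>#D. X = D - {#d#} + {#step_down d#} \<or> X = D - {#d#} + {#Suc d#}) \<and>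
     (\<forall>d\<in>#D. D - {#d#} + {#step_down d#} \<in> L)"

text \<open>The pairs of multisets of the same size that do have a family in common, for example the one
  of \<open>P\<^sub>4 + P\<^sub>4\<close> and \<open>P\<^sub>3 + P\<^sub>5\<close>.\<close>

definition exceptional_pair :: "nat multiset \<Rightarrow> nat multiset \<Rightarrow> bool" where
  "exceptional_pair D D' \<longleftrightarrow>
     D = {#0#} \<and> D' = {#2#} \<or> D = {#0, 0#} \<and> D' = {#1, 1#} \<or> D = {#0, 2#} \<and> D' = {#1, 1#}"

lemma step_familyD:
  assumes "step_family D L" "X \<in> L"
  obtains d where "d \<in># D" "X = D - {#d#} + {#step_down d#} \<or> X = D - {#d#} + {#Suc d#}"
  using assms unfolding step_family_def by blast

lemma step_familyI:
  assumes "step_family D L" "d \<in># D"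
  shows "D - {#d#} + {#step_down d#} \<in> L"
  using assms unfolding step_family_def by blast

lemma sum_mset_replace:
  fixes D :: "nat multiset"
  assumes "d \<in># D"
  shows "sum_mset (D - {#d#} + {#x#}) + d = sum_mset D + x"
proof -
  have "sum_mset (add_mset d (D - {#d#})) = sum_mset D"
    using assms by simp
  then show ?thesis
    by simp
qed

lemma step_family_sum:
  assumes "step_family D L" "X \<in> L"
  shows "sum_mset X = sum_mset D + 1 \<or> sum_mset X + 1 = sum_mset D"
proof -
  obtain d where d: "d \<in># D" "X = D - {#d#} + {#step_down d#} \<or> X = D - {#d#} + {#Suc d#}"
    by (rule step_familyD[OF assms])
  then show ?thesis
    using sum_mset_replace[OF d(1), of "step_down d"] sum_mset_replace[OF d(1), of "Suc d"]
    by (auto simp: step_down_def split: if_splits)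
qed

lemma mset_zeros: "(\<And>d. d \<in># M \<Longrightarrow> d = 0) \<Longrightarrow> M = replicate_mset (size M) (0::nat)"
proof (induction M)
  case (add d M)
  have "d = 0"
    using add.prems by simp
  moreover have "M = replicate_mset (size M) 0"
    by (rule add.IH) (use add.prems in simp)
  ultimately show ?case
    by simp
qed simp

lemma mset_two_values:
  assumes "\<And>x. x \<in># M \<Longrightarrow> x = 0 \<or> x = d" "d \<noteq> (0::nat)"
  shows "M = replicate_mset (count M 0) 0 + replicate_mset (count M d) d"
  by (rule multiset_eqI) (use assms in \<open>auto simp: count_eq_zero_iff\<close>)

text \<open>Every positive element can be decremented, so two multisets with the same family have sums
  differing by at most two, and they differ by two only if the smaller
  one consists of zeros.\<close>

lemma step_family_less:
  assumes D: "step_family D L" and D': "step_family D' L" and size: "size D = size D'"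
    and less: "sum_mset D < sum_mset D'"
  shows "exceptional_pair D D'"
proof -
  have "\<exists>d\<in>#D'. d > 0"
    using less by (metis bot_nat_0.not_eq_extremum not_less0 sum_mset_0_iff)
  then obtain d where d: "d \<in># D'" "d > 0"
    by blast
  have "sum_mset (D' - {#d#} + {#step_down d#}) + 1 = sum_mset D'"
    using sum_mset_replace[OF d(1), of "step_down d"] d(2) by (simp add: step_down_def)
  then have two: "sum_mset D' = sum_mset D + 2"
    using step_family_sum[OF D step_familyI[OF D' d(1)]] less by linarith
  have zero: "d = 0" if d: "d \<in># D" for d
  proof (rule ccontr)
    assume "d \<noteq> 0"
    then have "sum_mset (D - {#d#} + {#step_down d#}) + 1 = sum_mset D"
      using sum_mset_replace[OF d, of "step_down d"] by (simp add: step_down_def)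
    then show False
      using step_family_sum[OF D' step_familyI[OF D d]] two by linarith
  qed
  then have Dz: "D = replicate_mset (size D) 0"
    by (rule mset_zeros)
  then have "sum_mset D = 0"
    using zero by simp
  then have sum: "sum_mset D' = 2"
    using two by simp
  have pos: "d > 0" if d: "d \<in># D'" for d
  proof (rule ccontr)
    assume "\<not> d > 0"
    then have "sum_mset (D' - {#d#} + {#step_down d#}) = 3"
      using sum_mset_replace[OF d, of "step_down d"] sum by (simp add: step_down_def)
    then show False
      using step_family_sum[OF D step_familyI[OF D' d]] \<open>sum_mset D = 0\<close> by linarith
  qed
  obtain E where E: "D' = add_mset d E"
    using d(1) by (metis insert_DiffM)
  show ?thesis
  proof (cases "E = {#}")
    case True
    then have "D' = {#2#}"
      using E sum by simp
    then show ?thesis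
      using Dz size by (simp add: exceptional_pair_def)
  next
    case False
    then obtain d' F where F: "E = add_mset d' F"
      by (metis multiset_cases)
    then have "d + (d' + sum_mset F) = 2" "d > 0" "d' > 0"
      using pos[of d] pos[of d'] sum E by simp_all
    then have "d = 1" "d' = 1" "sum_mset F = 0"
      by linarith+
    moreover have "F = {#}"
      using pos \<open>sum_mset F = 0\<close> E F by (metis add_mset_remove_trivial_eq insert_iff
          less_irrefl multiset_nonemptyE set_mset_add_mset_insert sum_mset_0_iff)
    ultimately have "D' = {#1, 1#}"
      using E F by simp
    then show ?thesis
      using Dz size by (simp add: exceptional_pair_def numeral_2_eq_2)
  qed
qed

text \<open>For equal sums, think of the positive elements as the rows of a Young diagram; decrementing an
  element removes a corner.  A diagram is determined by the diagrams with one corner removed,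
  unless it has only two cells.  The proof compares the columns: the number of elements
  \<open>\<ge> j\<close>.\<close>

definition column :: "nat \<Rightarrow> nat multiset \<Rightarrow> nat" where
  "column j D = size {#x \<in># D. j \<le> x#}"

lemma column_add [simp]: "column j (add_mset x D) = column j D + of_bool (j \<le> x)"
  by (simp add: column_def)

lemma step_family_same_sum_partner:
  assumes D: "step_family D L" and D': "step_family D' L" and sum: "sum_mset D = sum_mset D'"
    and d: "d \<in># D" "d > 0"
  obtains d' where "d' \<in># D'" "d' > 0" "add_mset (d - 1) (add_mset d' D) = add_mset (d' - 1) (add_mset d D')"
    "\<forall>j>0. column j D + of_bool (j = d') = column j D' + of_bool (j = d)"
proof -
  let ?X = "D - {#d#} + {#step_down d#}"
  have X: "?X \<in> L" and sumX: "sum_mset ?X + 1 = sum_mset D"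
    using step_familyI[OF D d(1)] sum_mset_replace[OF d(1), of "step_down d"] d(2)
    by (simp_all add: step_down_def)
  obtain d' where d': "d' \<in># D'" "?X = D' - {#d'#} + {#step_down d'#} \<or> ?X = D' - {#d'#} + {#Suc d'#}"
    by (rule step_familyD[OF D' X])
  have "?X \<noteq> D' - {#d'#} + {#Suc d'#}"
  proof
    assume "?X = D' - {#d'#} + {#Suc d'#}"
    then have "sum_mset ?X + d' = sum_mset D' + Suc d'"
      using sum_mset_replace[OF d'(1), of "Suc d'"] by (simp only:)
    then show False
      using sumX sum by linarith
  qed
  then have X': "?X = D' - {#d'#} + {#step_down d'#}"
    using d'(2) by blast
  then have "sum_mset ?X + d' = sum_mset D' + step_down d'"
    using sum_mset_replace[OF d'(1), of "step_down d'"] by (simp only:)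
  then have pos: "d' > 0"
    using sumX sum by (cases "d' = 0") (simp_all add: step_down_def)
  have eq: "add_mset (d - 1) (add_mset d' D) = add_mset (d' - 1) (add_mset d D')"
  proof -
    obtain E E' where E: "D = add_mset d E" "D' = add_mset d' E'"
      using d(1) d'(1) by (metis insert_DiffM)
    then have "add_mset (d - 1) E = add_mset (d' - 1) E'"
      using X' d(2) pos by (simp add: step_down_def)
    then show ?thesis
      unfolding E by (metis add_mset_commute)
  qed
  have "column j D + of_bool (j = d') = column j D' + of_bool (j = d)" if "j > 0" for j
  proof -
    have less: "of_bool (j \<le> x) = of_bool (j \<le> x - 1) + (of_bool (j = x) :: nat)" if "x > 0" for x
      using that \<open>j > 0\<close> by auto
    show ?thesis
      using arg_cong[OF eq, of "column j"] less[OF d(2)] less[OF pos] by simp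
  qed
  then show thesis
    using that d'(1) pos eq by blast
qed

lemma column_single_value:
  assumes "\<And>x. x \<in># D \<Longrightarrow> x > 0 \<Longrightarrow> x = d" "j > 0"
  shows "column j D = (if j \<le> d then count D d else 0)"
proof -
  have zero: "count D x = 0" if "x \<noteq> d" "x > 0" for x
    using assms(1)[of x] that by (metis count_eq_zero_iff)
  have "count {#x \<in># D. j \<le> x#} x = count (if j \<le> d then replicate_mset (count D d) d else {#}) x" for x
    using zero[of x] assms(2) by (cases "x = d"; cases "j \<le> x") auto
  then have "{#x \<in># D. j \<le> x#} = (if j \<le> d then replicate_mset (count D d) d else {#})"
    by (rule multiset_eqI)
  then show ?thesis
    by (simp add: column_def)
qed

lemma step_family_exceptional:
  assumes D: "step_family D L" and D': "step_family D' L" and size: "size D = size D'"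
    and val: "\<And>x. x \<in># D \<Longrightarrow> x > 0 \<Longrightarrow> x = d" and val': "\<And>x. x \<in># D' \<Longrightarrow> x > 0 \<Longrightarrow> x = d'"
    and cols: "\<forall>j>0. column j D + of_bool (j = d') = column j D' + of_bool (j = d)"
    and less: "d' < d" "d' > 0"
  shows "exceptional_pair D D'"
proof -
  have cols: "(if j \<le> d then count D d else 0) + of_bool (j = d') =
      (if j \<le> d' then count D' d' else 0) + of_bool (j = d)" if "j > 0" for j
  proof -
    have "column j D = (if j \<le> d then count D d else 0)"
      by (rule column_single_value[OF val that])
    moreover have "column j D' = (if j \<le> d' then count D' d' else 0)"
      by (rule column_single_value[OF val' that])
    moreover have "column j D + of_bool (j = d') = column j D' + of_bool (j = d)"
      using cols that by blast
    ultimately show ?thesis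
      by (simp only:)
  qed
  have "count D d = 1"
    using cols[of d] less by simp
  moreover from this have "count D' d' = 2"
    using cols[of d'] less by simp
  moreover from calculation have "d' = 1"
    using cols[of 1] less by (cases "d' = 1") auto
  moreover from calculation have "d = 2"
    using cols[of 2] less by (cases "d = 2") auto
  ultimately have vals: "count D 2 = 1" "count D' 1 = 2" "d = 2" "d' = 1"
    by simp_all
  have Deq: "D = replicate_mset (count D 0) 0 + {#2#}"
    using mset_two_values[of D 2] val vals by (metis bot_nat_0.not_eq_extremum replicate_mset_Suc
        replicate_mset_0 One_nat_def zero_neq_numeral)
  have D'eq: "D' = replicate_mset (count D' 0) 0 + {#1, 1#}"
    using mset_two_values[of D' 1] val' vals by (metis bot_nat_0.not_eq_extremum replicate_mset_Suc
        replicate_mset_0 numeral_2_eq_2 One_nat_def zero_neq_one)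
  have "0 \<notin># D'"
  proof
    assume zero: "0 \<in># D'"
    let ?X = "D' - {#0#} + {#step_down 0#}"
    obtain x where x: "x \<in># D" "?X = D - {#x#} + {#step_down x#} \<or> ?X = D - {#x#} + {#Suc x#}"
      by (rule step_familyD[OF D step_familyI[OF D' zero]])
    have "count D 1 = 0"
      using val[of 1] vals(3) by (auto simp: count_eq_zero_iff)
    then have "count (D - {#x#} + {#y#}) 1 \<le> 1" for y
      by simp
    then have "count ?X 1 \<le> 1"
      using x(2) by metis
    moreover have "count ?X 1 = 3"
      using vals(2) by (simp add: step_down_def)
    ultimately show False
      by simp
  qed
  then have "D' = {#1, 1#}"
    using D'eq by (simp add: not_in_iff)
  moreover have "size D = count D 0 + 1"
    using arg_cong[OF Deq, of size] by simp
  ultimately have "count D 0 = 1"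
    using size by simp
  then have "D = {#0, 2#}"
    using Deq by simp
  then show ?thesis
    using \<open>D' = {#1, 1#}\<close> by (simp add: exceptional_pair_def)
qed

lemma step_family_determines:
  assumes D: "step_family D L" and D': "step_family D' L" and size: "size D = size D'"
  shows "D = D' \<or> exceptional_pair D D' \<or> exceptional_pair D' D"
proof (cases "sum_mset D = sum_mset D'")
  case sum: True
  show ?thesis
  proof (cases "\<exists>d\<in>#D. d > 0")
    case False
    then have "D = replicate_mset (size D) 0"
      by (intro mset_zeros) auto
    moreover have "sum_mset D = 0"
      using False by simp
    then have "sum_mset D' = 0"
      using sum by (simp only:)
    then have "D' = replicate_mset (size D') 0"
      by (intro mset_zeros) simp
    ultimately show ?thesis
      using size by simp
  next
    case True
    then obtain d where d: "d \<in># D" "d > 0"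
      by blast
    obtain d' where d': "d' \<in># D'" "d' > 0"
      and eq: "add_mset (d - 1) (add_mset d' D) = add_mset (d' - 1) (add_mset d D')"
      and cols: "\<forall>j>0. column j D + of_bool (j = d') = column j D' + of_bool (j = d)"
      by (rule step_family_same_sum_partner[OF D D' sum d])
    show ?thesis
    proof (cases "d = d'")
      case True
      then show ?thesis
        using eq by simp
    next
      case False
      have val: "x = d" if x: "x \<in># D" "x > 0" for x
      proof -
        obtain x' where x': "\<forall>j>0. column j D + of_bool (j = x') = column j D' + of_bool (j = x)"
          by (rule step_family_same_sum_partner[OF D D' sum x])
        show ?thesis
          using spec[OF x', of d] spec[OF cols, of d] d(2) False by (cases "d = x'"; cases "d = x") auto
      qed
      have val': "x = d'" if x: "x \<in># D'" "x > 0" for x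
      proof -
        obtain x' where x': "\<forall>j>0. column j D' + of_bool (j = x') = column j D + of_bool (j = x)"
          by (rule step_family_same_sum_partner[OF D' D sum[symmetric] x])
        show ?thesis
          using spec[OF x', of d'] spec[OF cols, of d'] d'(2) False by (cases "d' = x'"; cases "d' = x") auto
      qed
      show ?thesis
      proof (cases "d' < d")
        case True
        then show ?thesis
          using step_family_exceptional[OF D D' size val val' cols] d'(2) by blast
      next
        case False
        then have "d < d'"
          using \<open>d \<noteq> d'\<close> by simp
        then show ?thesis
          using step_family_exceptional[OF D' D size[symmetric] val' val] cols d(2) by metis
      qed
    qed
  qed
next
  case False
  then show ?thesis
    using step_family_less[OF D D' size] step_family_less[OF D' D size[symmetric]] by linarith
qed

section \<open>Graphs with the same deck\<close>

definition deck_bij :: "('e \<Rightarrow> 'f) \<Rightarrow> ('v, 'e) mgraph \<Rightarrow> ('w, 'f) mgraph \<Rightarrow> bool" where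
  "deck_bij \<phi> G H \<longleftrightarrow> bij_betw \<phi> (edges G) (edges H) \<and>
     (\<forall>e\<in>edges G. bipartition_poly (delete_edge H (\<phi> e)) = bipartition_poly (delete_edge G e))"

lemma bij_betw_if_image_mset_eq:
  assumes "finite A" "finite B" "image_mset f (mset_set A) = image_mset g (mset_set B)"
  shows "\<exists>\<phi>. bij_betw \<phi> A B \<and> (\<forall>a\<in>A. g (\<phi> a) = f a)"
  using assms
proof (induction A arbitrary: B rule: finite_induct)
  case empty
  then have "B = {}"
    by (simp add: mset_set_empty_iff)
  then show ?case
    by (simp add: bij_betw_def)
next
  case (insert a A)
  then have "f a \<in># image_mset g (mset_set B)"
    by (metis finite_insert image_eqI insertI1 elem_mset_set finite_set_mset_mset_set set_image_mset)
  then obtain b where b: "b \<in> B" "g b = f a"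
    using insert.prems by auto
  have "mset_set B = add_mset b (mset_set (B - {b}))"
    using b(1) insert.prems(1) by (metis finite_insert insert_Diff mset_set.insert Diff_iff singletonI)
  then have "image_mset f (mset_set A) = image_mset g (mset_set (B - {b}))"
    using insert b(2) by simp
  then obtain \<phi> where \<phi>: "bij_betw \<phi> A (B - {b})" "\<forall>a\<in>A. g (\<phi> a) = f a"
    using insert.IH[of "B - {b}"] insert.prems(1) by auto
  have "bij_betw (\<phi>(a := b)) A (B - {b})"
    using \<phi>(1) insert.hyps by (subst bij_betw_cong[of _ _ \<phi>]) auto
  then have "bij_betw (\<phi>(a := b)) (A \<union> {a}) ((B - {b}) \<union> {(\<phi>(a := b)) a})"
    using insert.hyps by (intro notIn_Un_bij_betw) simp_all
  then have "bij_betw (\<phi>(a := b)) (insert a A) B"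
    using b(1) by (simp add: insert_absorb)
  moreover have "\<forall>x\<in>insert a A. g ((\<phi>(a := b)) x) = f x"
    using \<phi>(2) b(2) insert.hyps by auto
  ultimately show ?case
    by blast
qed

lemma deck_bij_if_poly_deck_eq:
  assumes "multigraph G" "multigraph H" "poly_deck H = poly_deck G"
  obtains \<phi> where "deck_bij \<phi> G H"
proof -
  have "\<exists>\<phi>. bij_betw \<phi> (edges G) (edges H) \<and>
      (\<forall>e\<in>edges G. bipartition_poly (delete_edge H (\<phi> e)) = bipartition_poly (delete_edge G e))"
    by (rule bij_betw_if_image_mset_eq) (use assms in \<open>simp_all add: poly_deck_def\<close>)
  then show thesis
    using that unfolding deck_bij_def by blast
qed

lemma deck_bij_sym:
  assumes "deck_bij \<phi> G H"
  shows "deck_bij (inv_into (edges G) \<phi>) H G"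
proof -
  have \<phi>: "bij_betw \<phi> (edges G) (edges H)"
    using assms by (simp add: deck_bij_def)
  have "bipartition_poly (delete_edge G (inv_into (edges G) \<phi> f)) = bipartition_poly (delete_edge H f)"
    if f: "f \<in> edges H" for f
  proof -
    have "inv_into (edges G) \<phi> f \<in> edges G" "\<phi> (inv_into (edges G) \<phi> f) = f"
      using \<phi> f by (simp_all add: bij_betw_def inv_into_into f_inv_into_f)
    then show ?thesis
      using assms unfolding deck_bij_def by metis
  qed
  then show ?thesis
    using bij_betw_inv_into[OF \<phi>] by (simp add: deck_bij_def)
qed

lemma deck_bij_card_edges: "deck_bij \<phi> G H \<Longrightarrow> card (edges H) = card (edges G)"
  unfolding deck_bij_def by (metis bij_betw_same_card)

lemma deck_bij_edge: "deck_bij \<phi> G H \<Longrightarrow> e \<in> edges G \<Longrightarrow> \<phi> e \<in> edges H"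
  unfolding deck_bij_def by (metis bij_betwE)

lemma deck_bij_card:
  "deck_bij \<phi> G H \<Longrightarrow> e \<in> edges G \<Longrightarrow>
    bipartition_poly (delete_edge H (\<phi> e)) = bipartition_poly (delete_edge G e)"
  by (simp add: deck_bij_def)

lemma coeff_eq_if_deck_bij:
  assumes G: "multigraph G" and H: "multigraph H" and \<phi>: "deck_bij \<phi> G H" and k: "k < card (edges G)"
  shows "coeff (bipartition_poly G) k = coeff (bipartition_poly H) k"
proof -
  have "(\<Sum>f\<in>edges H. coeff (bipartition_poly (delete_edge H f)) k) =
      (\<Sum>e\<in>edges G. coeff (bipartition_poly (delete_edge H (\<phi> e))) k)"
    using \<phi> unfolding deck_bij_def by (intro sum.reindex_bij_betw[symmetric]) blast
  also have "\<dots> = (\<Sum>e\<in>edges G. coeff (bipartition_poly (delete_edge G e)) k)"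
    by (rule sum.cong[OF refl]) (simp add: deck_bij_card[OF \<phi>])
  finally have "of_nat (card (edges G) - k) * coeff (bipartition_poly H) k =
      of_nat (card (edges G) - k) * coeff (bipartition_poly G) k"
    unfolding kelly_bipartition_poly[OF G] kelly_bipartition_poly[OF H] deck_bij_card_edges[OF \<phi>] .
  moreover have "(of_nat (card (edges G) - k) :: int poly poly) \<noteq> 0"
    using k by simp
  ultimately show ?thesis
    by simp
qed

lemma bipartition_poly_eq_if_top_coeff_eq:
  assumes G: "multigraph G" and H: "multigraph H" and \<phi>: "deck_bij \<phi> G H"
    and top: "top_coeff G = top_coeff H"
  shows "bipartition_poly G = bipartition_poly H"
proof (rule poly_eqI)
  fix k
  consider "k < card (edges G)" | "k = card (edges G)" | "card (edges G) < k"
    by linarith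
  then show "coeff (bipartition_poly G) k = coeff (bipartition_poly H) k"
  proof cases
    case 2
    then show ?thesis
      using top deck_bij_card_edges[OF \<phi>] by (simp add: top_coeff_def)
  next
    case 3
    then show ?thesis
      using coeff_bipartition_poly_eq_0[OF G] coeff_bipartition_poly_eq_0[OF H] deck_bij_card_edges[OF \<phi>]
      by simp
  qed (rule coeff_eq_if_deck_bij[OF G H \<phi>])
qed

lemma degree_moments_eq:
  assumes "multigraph G" "multigraph H" "coeff (bipartition_poly G) k = coeff (bipartition_poly H) k"
  shows "(\<Sum>v\<in>verts G. degree_in G v choose k) = (\<Sum>v\<in>verts H. degree_in H v choose k)"
proof -
  have "int (\<Sum>v\<in>verts G. degree_in G v choose k) = int (\<Sum>v\<in>verts H. degree_in H v choose k)"
    unfolding sum_choose_degree[OF assms(1), symmetric] sum_choose_degree[OF assms(2), symmetric]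
    by (simp only: assms(3))
  then show ?thesis
    by (simp only: of_nat_eq_iff)
qed

lemma deck_bij_moments:
  assumes "multigraph G" "multigraph H" "deck_bij \<phi> G H" "k < card (edges G)"
  shows "(\<Sum>v\<in>verts G. degree_in G v choose k) = (\<Sum>v\<in>verts H. degree_in H v choose k)"
  by (rule degree_moments_eq[OF assms(1,2) coeff_eq_if_deck_bij[OF assms]])

lemma deck_bij_card_verts:
  assumes "multigraph G" "multigraph H" "deck_bij \<phi> G H" "edges G \<noteq> {}"
  shows "card (verts G) = card (verts H)"
  using deck_bij_moments[OF assms(1-3), of 0] assms(1,4) by (simp add: card_gt_0_iff)

lemma degree_distribution_eq:
  assumes "multigraph G" "multigraph H" "bipartition_poly G = bipartition_poly H"
  shows "card {v \<in> verts G. degree_in G v = j} = card {v \<in> verts H. degree_in H v = j}"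
  by (rule binomial_moments_determine_distribution)
    (use assms degree_moments_eq[OF assms(1,2)] in simp_all)

lemma deck_bij_isolated_count:
  assumes "multigraph G" "multigraph H" "deck_bij \<phi> G H" "e \<in> edges G"
  shows "isolated_count (delete_edge H (\<phi> e)) = isolated_count (delete_edge G e)"
  unfolding isolated_count_def
  by (rule degree_distribution_eq) (use assms in \<open>simp_all add: deck_bij_card\<close>)

lemma deck_bij_top_coeff:
  assumes "multigraph G" "multigraph H" "deck_bij \<phi> G H" "e \<in> edges G"
  shows "top_coeff (delete_edge H (\<phi> e)) = top_coeff (delete_edge G e)"
proof -
  have "card (edges (delete_edge H (\<phi> e))) = card (edges (delete_edge G e))"
    using assms deck_bij_card_edges[OF assms(3)] deck_bij_edge[OF assms(3,4)] by simp
  then show ?thesis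
    unfolding top_coeff_def by (simp only: deck_bij_card[OF assms(3,4)])
qed

lemma deck_bij_card_cuts:
  assumes "multigraph G" "multigraph H" "deck_bij \<phi> G H" "e \<in> edges G"
  shows "card (cuts (delete_edge H (\<phi> e))) = card (cuts (delete_edge G e))"
proof -
  have "int (card (cuts (delete_edge H (\<phi> e)))) = int (card (cuts (delete_edge G e)))"
    using top_coeff_at_1_1[of "delete_edge G e"] top_coeff_at_1_1[of "delete_edge H (\<phi> e)"]
      deck_bij_top_coeff[OF assms] assms(1,2) by simp
  then show ?thesis
    by simp
qed

lemma card_cuts_delete_edge:
  assumes "multigraph G" "cuts G \<noteq> {}"
  shows "card (cuts (delete_edge G e)) =
    (if bridge G e then 2 * card (closed_sets G) else card (closed_sets G))"
proof -
  have "cuts (delete_edge G e) \<noteq> {}"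
    using assms(2) cuts_subset_delete_edge[of G e] by auto
  then show ?thesis
    using card_cuts[of "delete_edge G e"] assms(1) card_closed_sets_delete_edge[OF assms(1), of e] by simp
qed

lemma bridge_delete_edge_no_cuts:
  assumes "multigraph G" "e \<in> edges G" "bridge G e" "cuts (delete_edge G e) \<noteq> {}"
  shows "cuts G \<noteq> {}"
proof -
  obtain U where U: "U \<subseteq> verts G" "edge_boundary G U = {e}"
    using assms(3) unfolding bridge_def by blast
  obtain W where W: "W \<subseteq> verts G" "edge_boundary G W - {e} = edges G - {e}"
    using assms(4) by (auto simp: cuts_def)
  show ?thesis
  proof (cases "e \<in> edge_boundary G W")
    case True
    then have "edge_boundary G W = edges G"
      using W(2) assms(2) by blast
    then show ?thesis
      using W(1) by (auto simp: cuts_def)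
  next
    case False
    then have "edge_boundary G W = edges G - {e}"
      using W(2) by simp
    then have "edge_boundary G (sym_diff W U) = edges G"
      using edge_boundary_sym_diff[OF assms(1), of W U] U(2) assms(2) by auto
    then have "sym_diff W U \<in> cuts G"
      unfolding cuts_def using W(1) U(1) by blast
    then show ?thesis
      by blast
  qed
qed

section \<open>Graphs with cycles\<close>

text \<open>Being bipartite means having a cut.  If \<open>G\<close> is bipartite with a cycle, deleting an edge of a
  cycle does not change the top coefficient, and such cards are recognised by their number of cuts.
  A non-bipartite \<open>H\<close> with the same deck would have as many closed sets as \<open>G\<close>, so by inclusion
  and exclusion also as many cuts, that is some.\<close>

lemma top_coeff_eq_if_not_forests:
  assumes G: "multigraph G" and H: "multigraph H" and \<phi>: "deck_bij \<phi> G H"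
    and cyclic: "\<not> forest G" "\<not> forest H" and cuts: "cuts G \<noteq> {}"
  shows "top_coeff G = top_coeff H"
proof -
  let ?c = "\<lambda>G. card (closed_sets G)"
  obtain e where e: "e \<in> edges G" "\<not> bridge G e"
    using cyclic(1) by (auto simp: forest_def)
  obtain f where f: "f \<in> edges H" "\<not> bridge H f"
    using cyclic(2) by (auto simp: forest_def)
  obtain e' where e': "e' \<in> edges G" "f = \<phi> e'"
    using f(1) \<phi> by (auto simp: deck_bij_def bij_betw_def)
  have card_G: "card (cuts (delete_edge H (\<phi> e))) = ?c G"
    using deck_bij_card_cuts[OF G H \<phi> e(1)] card_cuts_delete_edge[OF G cuts, of e] e(2) by simp
  show ?thesis
  proof (cases "cuts H = {}")
    case False
    have "?c G \<le> ?c H"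
      using deck_bij_card_cuts[OF G H \<phi> e'(1)] card_cuts_delete_edge[OF G cuts, of e']
        card_cuts_delete_edge[OF H False, of f] f(2) e'(2) by (auto split: if_splits)
    moreover have "?c G = (if bridge H (\<phi> e) then 2 * ?c H else ?c H)"
      using card_cuts_delete_edge[OF H False, of "\<phi> e"] card_G by simp
    ultimately have "\<not> bridge H (\<phi> e)"
      using card_closed_sets_pos[OF H] by auto
    then show ?thesis
      using top_coeff_delete_nonbridge[OF G cuts e]
        top_coeff_delete_nonbridge[OF H False deck_bij_edge[OF \<phi> e(1)]]
        deck_bij_top_coeff[OF G H \<phi> e(1)] by simp
  next
    case True
    have "?c G > 0"
      by (rule card_closed_sets_pos[OF G])
    then have ne: "cuts (delete_edge H (\<phi> e)) \<noteq> {}"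
      using card_G by auto
    then have "\<not> bridge H (\<phi> e)"
      using bridge_delete_edge_no_cuts[OF H deck_bij_edge[OF \<phi> e(1)]] True by blast
    then have "?c H = ?c G"
      using card_G card_cuts[OF _ ne] card_closed_sets_delete_edge[OF H, of "\<phi> e"] H by simp
    moreover
    let ?m = "card (edges G)" and ?b = "\<lambda>p k. poly (poly (coeff p k) 1) 1"
    \<comment> \<open>the two alternating sums differ only in their last terms\<close>
    have "(\<Sum>k\<le>?m. (-1) ^ k * ?b (bipartition_poly G) k) - (\<Sum>k\<le>?m. (-1) ^ k * ?b (bipartition_poly H) k) =
        (-1) ^ ?m * (?b (bipartition_poly G) ?m - ?b (bipartition_poly H) ?m)"
      using coeff_eq_if_deck_bij[OF G H \<phi>]
      by (simp add: lessThan_Suc_atMost[symmetric] right_diff_distrib)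
    then have "int (?c G) - int (?c H) = (-1) ^ ?m * (int (card (cuts G)) - int (card (cuts H)))"
      using alternating_sum_coeffs[OF G] alternating_sum_coeffs[OF H] deck_bij_card_edges[OF \<phi>]
        top_coeff_at_1_1[OF G] top_coeff_at_1_1[OF H] by (simp add: top_coeff_def)
    ultimately have "card (cuts G) = card (cuts H)"
      by simp
    then show ?thesis
      using True card_cuts[OF G cuts] \<open>?c G > 0\<close> by simp
  qed
qed

text \<open>Here all cards have twice as many cuts as \<open>G\<close>, so \<open>H\<close> has no bridge and a single cycle, and
  is thus a cycle with isolated vertices.  A forest with as many pairs of adjacent edges as edges
  has a vertex of degree at least three, whereas \<open>H\<close> has none; with four or more edges the deck
  would show this.\<close>

lemma forest_not_forest_same_deck:
  assumes G: "multigraph G" and H: "multigraph H" and \<phi>: "deck_bij \<phi> G H"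
    and forest: "forest G" "\<not> forest H" and m: "card (edges G) \<ge> 3"
  shows "card (edges G) = 3" "\<exists>v\<in>verts G. degree_in G v = 3"
    "card {v \<in> verts H. degree_in H v = 2} = 3" "\<And>v. v \<in> verts H \<Longrightarrow> degree_in H v = 0 \<or> degree_in H v = 2"
    "card (verts H) \<ge> 4"
proof -
  let ?c = "\<lambda>G. card (closed_sets G)" and ?m = "card (edges G)"
  have mH: "card (edges H) = ?m"
    by (rule deck_bij_card_edges[OF \<phi>])
  have cuts: "cuts G \<noteq> {}"
    by (rule forest_cuts_nonempty[OF G forest(1)])
  have card_H: "?c (delete_edge H f) = 2 * ?c G" if f: "f \<in> edges H" for f
  proof -
    obtain e where e: "e \<in> edges G" "f = \<phi> e"
      using f \<phi> by (auto simp: deck_bij_def bij_betw_def)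
    have "card (cuts (delete_edge H f)) = 2 * ?c G"
      using deck_bij_card_cuts[OF G H \<phi> e(1)] card_cuts_delete_edge[OF G cuts, of e] e forest(1)
      by (simp add: forest_def)
    then show ?thesis
      using card_cuts[of "delete_edge H f"] H card_closed_sets_pos[OF G] by fastforce
  qed
  obtain f\<^sub>0 where f\<^sub>0: "f\<^sub>0 \<in> edges H" "\<not> bridge H f\<^sub>0"
    using forest(2) by (auto simp: forest_def)
  then have cH: "?c H = 2 * ?c G"
    using card_H[OF f\<^sub>0(1)] card_closed_sets_delete_edge[OF H, of f\<^sub>0] by simp
  then have no_bridge: "\<not> bridge H f" if "f \<in> edges H" for f
    using card_H[OF that] card_closed_sets_delete_edge[OF H, of f] card_closed_sets_pos[OF H] by auto
  have not_1: "degree_in H v \<noteq> 1" if v: "v \<in> verts H" for v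
  proof
    assume "degree_in H v = 1"
    then obtain f where "edge_boundary H {v} = {f}"
      using card_edge_boundary_singleton[of H v] by (auto simp: card_1_singleton_iff)
    then have "bridge H f" "f \<in> edges H"
      using v edge_boundary_subset[of H "{v}"] unfolding bridge_def by auto
    then show False
      using no_bridge by blast
  qed
  have E: "edges G \<noteq> {}" "edges H \<noteq> {}"
    using m f\<^sub>0(1) by auto
  note n = deck_bij_card_verts[OF G H \<phi> E(1)]
  let ?N = "{v \<in> verts H. degree_in H v \<noteq> 0}"
  \<comment> \<open>one component more than in a forest with the same number of edges\<close>
  have comps: "card (components H) + ?m = card (verts H) + 1"
  proof -
    have "(2::nat) ^ (card (components H) + ?m) = 2 ^ (card (verts H) + 1)"
      using forest_card_closed_sets[OF G forest(1)] cH card_closed_sets_components[OF H] n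
      by (simp add: power_add)
    then show ?thesis
      by (rule power_inject_exp[THEN iffD1, rotated]) simp
  qed
  have "card (components H) \<ge> isolated_count H + 1"
  proof -
    obtain C where "C \<in> components H" "card C \<noteq> 1"
      by (rule edge_in_nontrivial_component[OF H f\<^sub>0(1)])
    then have "imbalance {} C \<in># imbalances {} H"
      using in_imbalances[OF H] by blast
    then have "size (imbalances {} H) \<ge> 1"
      by (metis One_nat_def Suc_leI empty_not_add_mset multi_member_split nonempty_has_size)
    then show ?thesis
      using size_imbalances[OF H, of "{}"] by simp
  qed
  moreover have "card (verts H) = isolated_count H + card ?N"
  proof -
    have "verts H \<inter> {v. degree_in H v = 0} = {v \<in> verts H. degree_in H v = 0}"
      "verts H - {v. degree_in H v = 0} = ?N"
      by auto
    then show ?thesis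
      using card_split[of "verts H" "{v. degree_in H v = 0}"] H by (simp add: isolated_count_def)
  qed
  ultimately have le: "?m \<le> card ?N"
    using comps by linarith
  have finN: "finite ?N"
    using H by simp
  have "(\<Sum>v\<in>?N. degree_in H v) = (\<Sum>v\<in>verts H. degree_in H v)"
    by (rule sum.mono_neutral_left) (use H in auto)
  then have sum: "(\<Sum>v\<in>?N. degree_in H v) = 2 * ?m"
    using sum_degree[OF H] mH by simp
  have ge2: "degree_in H v \<ge> 2" if "v \<in> ?N" for v
    using not_1[of v] that by (cases "degree_in H v") auto
  have eq: "degree_in H v = 2" if v: "v \<in> ?N" for v
  proof (rule ccontr)
    assume "degree_in H v \<noteq> 2"
    then have "2 < degree_in H v"
      using ge2[OF v] by simp
    then have "(\<Sum>v\<in>?N. 2) < (\<Sum>v\<in>?N. degree_in H v)"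
      by (intro sum_strict_mono_ex1[OF finN]) (use ge2 v in auto)
    then show False
      using sum le by simp
  qed
  have "(\<Sum>v\<in>?N. degree_in H v) = (\<Sum>v\<in>?N. 2)"
    by (rule sum.cong[OF refl eq])
  then have "(\<Sum>v\<in>?N. degree_in H v) = 2 * card ?N"
    by simp
  then have cardN: "card ?N = ?m"
    using sum by simp
  have N2: "?N = {v \<in> verts H. degree_in H v = 2}"
    using eq by auto
  show deg: "degree_in H v = 0 \<or> degree_in H v = 2" if "v \<in> verts H" for v
    using eq[of v] that by auto
  have moment: "(\<Sum>v\<in>verts H. degree_in H v choose k) = (2 choose k) * ?m" if "k \<ge> 1" for k
  proof -
    have "(\<Sum>v\<in>verts H. degree_in H v choose k) = (\<Sum>v\<in>?N. degree_in H v choose k)"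
      by (rule sum.mono_neutral_right) (use H that in \<open>auto simp: binomial_eq_0\<close>)
    also have "\<dots> = (\<Sum>v\<in>?N. 2 choose k)"
      by (rule sum.cong[OF refl]) (simp only: eq)
    finally show ?thesis
      using cardN by simp
  qed
  have "\<exists>v\<in>verts G. degree_in G v \<ge> 3"
  proof (rule ccontr)
    assume "\<not> ?thesis"
    then have le2: "degree_in G v \<le> 2" if "v \<in> verts G" for v
      using that by force
    \<comment> \<open>a vertex of degree two is the middle of one pair of adjacent edges, so only leaves make a
      difference between the sum of the degrees and twice the number of these pairs\<close>
    have leaf_count: "degree_in G v = 2 * (degree_in G v choose 2) + of_bool (degree_in G v = 1)"
      if "v \<in> verts G" for v
    proof -
      have "degree_in G v = 0 \<or> degree_in G v = 1 \<or> degree_in G v = 2"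
        using le2[OF that] by linarith
      then show ?thesis
        by (elim disjE) (simp_all add: choose_two)
    qed
    have "2 * ?m = (\<Sum>v\<in>verts G. 2 * (degree_in G v choose 2) + of_bool (degree_in G v = 1))"
      unfolding sum_degree[OF G, symmetric] by (rule sum.cong[OF refl leaf_count])
    also have "\<dots> = 2 * (\<Sum>v\<in>verts G. degree_in G v choose 2) + (\<Sum>v\<in>verts G. of_bool (degree_in G v = 1))"
      by (simp add: sum.distrib sum_distrib_left)
    also have "(\<Sum>v\<in>verts G. degree_in G v choose 2) = ?m"
      using deck_bij_moments[OF G H \<phi>, of 2] moment[of 2] m by simp
    finally have "(\<Sum>v\<in>verts G. of_bool (degree_in G v = 1)) = (0::nat)"
      by simp
    then have "\<forall>v\<in>verts G. degree_in G v \<noteq> 1"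
      using G by auto
    then show False
      using forest_has_leaf[OF G forest(1) E(1)] by blast
  qed
  then obtain v where v: "v \<in> verts G" "degree_in G v \<ge> 3"
    by blast
  show m3: "?m = 3"
  proof (rule ccontr)
    assume "?m \<noteq> 3"
    then have "(\<Sum>v\<in>verts G. degree_in G v choose 3) = 0"
      using deck_bij_moments[OF G H \<phi>, of 3] moment[of 3] m by (simp add: binomial_eq_0)
    then have "degree_in G v choose 3 = 0"
      using v(1) G by simp
    then show False
      using v(2) by simp
  qed
  then show "\<exists>v\<in>verts G. degree_in G v = 3"
    using v degree_in_le[OF G, of v] by (intro bexI[of _ v]) auto
  show "card {v \<in> verts H. degree_in H v = 2} = 3"
    using cardN N2 m3 by simp
  have "components G \<noteq> {}"
    using component_exists[OF G v(1)] by blast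
  then have "card (components G) > 0"
    using G by (simp add: card_gt_0_iff)
  then show "card (verts H) \<ge> 4"
    using forest_card_components[OF G forest(1)] m3 n by linarith
qed

section \<open>Forests with the same deck\<close>

lemma forest_no_parallel_edges:
  assumes "multigraph G" "forest G" "e \<in> edges G" "f \<in> edges G" "e \<noteq> f"
  shows "ends G e \<noteq> ends G f"
proof
  assume eq: "ends G e = ends G f"
  obtain u v where uv: "ends G e = {u, v}" "u \<noteq> v"
    by (rule multigraph_ends[OF assms(1,3)])
  obtain U where "U \<subseteq> verts G" "edge_boundary G U = {e}"
    by (rule forest_obtain_side[OF assms(2,3)])
  then show False
    using in_edge_boundary_iff[OF assms(3) uv, of U]
      in_edge_boundary_iff[OF assms(4), of u v U] uv eq assms(5) by auto
qed

lemma full_degree_incident: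
  assumes "multigraph G" "degree_in G v = card (edges G)" "e \<in> edges G"
  shows "v \<in> ends G e"
proof -
  have "{e \<in> edges G. v \<in> ends G e} = edges G"
    by (rule card_subset_eq) (use assms in \<open>auto simp: degree_in_def\<close>)
  then show ?thesis
    using assms(3) by blast
qed

lemma forest_full_degree_le_1:
  assumes G: "multigraph G" "forest G" "card (edges G) \<ge> 2"
  shows "card {v \<in> verts G. degree_in G v = card (edges G)} \<le> 1"
proof (rule ccontr)
  assume "\<not> ?thesis"
  moreover have fin: "finite {v \<in> verts G. degree_in G v = card (edges G)}"
    using G(1) by simp
  ultimately have "\<exists>v w. v \<noteq> w \<and> degree_in G v = card (edges G) \<and> degree_in G w = card (edges G)"
    unfolding One_nat_def card_le_Suc0_iff_eq[OF fin] by blast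
  then obtain v w where vw: "v \<noteq> w" "degree_in G v = card (edges G)" "degree_in G w = card (edges G)"
    by blast
  have ends: "ends G e = {v, w}" if e: "e \<in> edges G" for e
  proof -
    have "card (ends G e) = 2"
      using G(1) e unfolding multigraph_def by blast
    moreover have "{v, w} \<subseteq> ends G e"
      using full_degree_incident[OF G(1) _ e] vw(2,3) by blast
    moreover have "finite (ends G e)"
      using calculation(1) card.infinite by fastforce
    ultimately show ?thesis
      using vw(1) by (metis card_2_iff card_subset_eq)
  qed
  obtain e f where ef: "e \<in> edges G" "f \<in> edges G" "e \<noteq> f"
    using G(3) by (metis card_le_Suc0_iff_eq multigraph_finite(2) G(1) not_less_eq_eq numeral_2_eq_2)
  then show False
    using forest_no_parallel_edges[OF G(1,2) ef] ends by metis
qed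

text \<open>The moments of order less than \<open>m\<close> are common to \<open>G\<close> and \<open>H\<close>, so the degrees can differ only
  through a vertex of degree \<open>m\<close>.  If only \<open>G\<close> had such a vertex, \<open>H\<close> would have at least \<open>m\<close>
  vertices of degree \<open>m - 1\<close>, and a leaf besides, which is too much for \<open>m\<close> edges.\<close>

lemma full_degree_transfer:
  assumes G: "multigraph G" "forest G" and H: "multigraph H" "forest H" and \<phi>: "deck_bij \<phi> G H"
    and m: "card (edges G) \<ge> 3" and v: "v \<in> verts G" "degree_in G v = card (edges G)"
  shows "\<exists>w\<in>verts H. degree_in H w = card (edges H)"
proof (rule ccontr)
  let ?m = "card (edges G)"
  have mH: "card (edges H) = ?m"
    by (rule deck_bij_card_edges[OF \<phi>])
  assume none: "\<not> ?thesis"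
  have less: "degree_in H w \<le> ?m - 1" if "w \<in> verts H" for w
  proof -
    have "degree_in H w \<noteq> ?m"
      using none that mH by auto
    then show ?thesis
      using degree_in_le[OF H(1), of w] mH by simp
  qed
  let ?N = "{w \<in> verts H. degree_in H w = ?m - 1}"
  have "?m choose (?m - 1) = ?m"
    using binomial_symmetric[of 1 ?m] m by simp
  then have "?m \<le> (\<Sum>w\<in>verts G. degree_in G w choose (?m - 1))"
    using member_le_sum[of v "verts G" "\<lambda>w. degree_in G w choose (?m - 1)"] v G(1) by simp
  also have "\<dots> = (\<Sum>w\<in>verts H. degree_in H w choose (?m - 1))"
    by (rule deck_bij_moments[OF G(1) H(1) \<phi>]) (use m in simp)
  also have "\<dots> = (\<Sum>w\<in>verts H. of_bool (degree_in H w = ?m - 1))"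
    by (rule sum.cong[OF refl]) (use less in \<open>fastforce simp: binomial_eq_0_iff\<close>)
  also have "\<dots> = card ?N"
    using H(1) by (simp add: Int_def)
  finally have N: "?m \<le> card ?N" .
  have "edges H \<noteq> {}"
    using m mH by auto
  then obtain w where w: "w \<in> verts H" "degree_in H w = 1"
    by (rule forest_has_leaf[OF H])
  have fin: "finite ?N" "finite (verts H)"
    using H(1) by simp_all
  have "card ?N * (?m - 1) + 1 = (\<Sum>x\<in>insert w ?N. degree_in H x)"
    using w m fin(1) by simp
  also have "\<dots> \<le> (\<Sum>x\<in>verts H. degree_in H x)"
    by (rule sum_mono2) (use fin w in auto)
  also have "\<dots> = 2 * ?m"
    using sum_degree[OF H(1)] mH by simp
  finally have "card ?N * (?m - 1) + 1 \<le> 2 * ?m" .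
  moreover have "?m * 2 \<le> card ?N * (?m - 1)"
    by (rule mult_le_mono[OF N]) (use m in simp)
  ultimately show False
    by simp
qed

lemma forests_degree_distribution:
  assumes G: "multigraph G" "forest G" and H: "multigraph H" "forest H" and \<phi>: "deck_bij \<phi> G H"
    and m: "card (edges G) \<ge> 3"
  shows "card {v \<in> verts G. degree_in G v = j} = card {v \<in> verts H. degree_in H v = j}"
proof (rule binomial_moments_determine_distribution)
  let ?m = "card (edges G)"
  have mH: "card (edges H) = ?m"
    by (rule deck_bij_card_edges[OF \<phi>])
  let ?F = "\<lambda>G. {v \<in> verts G. degree_in G v = ?m}"
  have le: "card (?F G) \<le> 1" "card (?F H) \<le> 1"
    using forest_full_degree_le_1[OF G] forest_full_degree_le_1[OF H] m mH by simp_all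
  have fin: "finite (?F G)" "finite (?F H)"
    using G(1) H(1) by simp_all
  have "?F G \<noteq> {} \<longleftrightarrow> ?F H \<noteq> {}"
    using full_degree_transfer[OF G H \<phi> m] full_degree_transfer[OF H G deck_bij_sym[OF \<phi>]] m mH by auto
  then have full: "card (?F G) = card (?F H)"
  proof (cases "?F G = {}")
    case False
    then have "card (?F G) > 0" "card (?F H) > 0"
      using fin \<open>?F G \<noteq> {} \<longleftrightarrow> ?F H \<noteq> {}\<close> by (auto simp only: card_gt_0_iff)
    then show ?thesis
      using le by linarith
  next
    case True
    then have "?F H = {}"
      using \<open>?F G \<noteq> {} \<longleftrightarrow> ?F H \<noteq> {}\<close> by blast
    then show ?thesis
      using True by (simp only: card.empty)
  qed
  fix k
  have big: "degree_in K v choose k = of_bool (k = ?m \<and> degree_in K v = ?m)"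
    if "multigraph K" "card (edges K) = ?m" "k \<ge> ?m" for K :: "('x, 'y) mgraph" and v
    using degree_in_le[OF that(1), of v] that(2,3) by (auto simp: binomial_eq_0_iff)
  show "(\<Sum>v\<in>verts G. degree_in G v choose k) = (\<Sum>v\<in>verts H. degree_in H v choose k)"
  proof (cases "k < ?m")
    case True
    then show ?thesis
      by (rule deck_bij_moments[OF G(1) H(1) \<phi>])
  next
    case False
    then have k: "k \<ge> ?m"
      by simp
    show ?thesis
      unfolding big[OF G(1) refl k] big[OF H(1) mH k] using full G(1) H(1)
      by (cases "k = ?m") (simp_all add: Int_def)
  qed
qed (use G H in simp_all)

lemma cuts_delete_edgeI: "A \<in> cuts G \<Longrightarrow> A \<in> cuts (delete_edge G e)"
  using cuts_subset_delete_edge[of G e] by (rule subsetD)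

lemma deck_bij_imbalances:
  assumes G: "multigraph G" "A \<in> cuts G" and H: "multigraph H" "A' \<in> cuts H"
    and \<phi>: "deck_bij \<phi> G H" "e \<in> edges G"
  shows "imbalances A' (delete_edge H (\<phi> e)) = imbalances A (delete_edge G e)"
  by (rule imbalances_eq_if_top_coeff_eq)
    (use G H cuts_delete_edgeI deck_bij_top_coeff[OF G(1) H(1) \<phi>] deck_bij_isolated_count[OF G(1) H(1) \<phi>]
      in auto)

lemma degree_in_transfer:
  assumes H: "multigraph H" and G: "multigraph G"
    and dist: "\<And>j. card {v \<in> verts G. degree_in G v = j} = card {v \<in> verts H. degree_in H v = j}"
    and w: "w \<in> verts H"
  shows "\<exists>v\<in>verts G. degree_in G v = degree_in H w"
proof -
  have "w \<in> {v \<in> verts H. degree_in H v = degree_in H w}" "finite {v \<in> verts H. degree_in H v = degree_in H w}"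
    using w H by simp_all
  then have "card {v \<in> verts H. degree_in H v = degree_in H w} > 0"
    by (metis card_gt_0_iff empty_iff)
  then have "{v \<in> verts G. degree_in G v = degree_in H w} \<noteq> {}"
    using dist[of "degree_in H w"] by (metis card.empty less_irrefl)
  then show ?thesis
    by blast
qed

lemma odd_degrees_transfer:
  assumes G: "multigraph G" "forest G" "A \<in> cuts G" and H: "multigraph H" "forest H" "A' \<in> cuts H"
    and \<phi>: "deck_bij \<phi> G H" and m: "card (edges G) \<ge> 3"
    and even_imb: "\<And>d. d \<in># imbalances A G \<Longrightarrow> even d"
    and odd_imb: "\<And>e. e \<in> edges G \<Longrightarrow> isolated_count (delete_edge G e) = isolated_count G \<Longrightarrow>
      \<exists>d\<in>#imbalances A (delete_edge G e). odd d"
    and w: "w \<in> verts H" "degree_in H w \<noteq> 0"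
  shows "odd (degree_in H w)"
proof -
  obtain v where "v \<in> verts G" "degree_in G v = degree_in H w"
    using degree_in_transfer[OF H(1) G(1) forests_degree_distribution[OF G(1,2) H(1,2) \<phi> m] w(1)] by blast
  then show ?thesis
    using odd_degrees_if_odd_cards[OF G(1,2) even_imb odd_imb, of v] w(2) by metis
qed

lemma odd_element_of_card:
  assumes G: "multigraph G" "forest G" and e: "e \<in> edges G"
    and iso: "isolated_count (delete_edge G e) = isolated_count G" and D: "imbalances A G = {#1, 1#}"
  shows "\<exists>d\<in>#imbalances A (delete_edge G e). odd d"
proof -
  obtain d d\<^sub>1 d\<^sub>2 where d: "d \<in># imbalances A G"
    "imbalances A (delete_edge G e) = imbalances A G - {#d#} + {#d\<^sub>1, d\<^sub>2#}"
    by (rule internal_edge_card[OF G e iso, of A])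
  then have "1 \<in># imbalances A (delete_edge G e)"
    unfolding D by auto
  then show ?thesis
    by (intro bexI[of _ 1]) simp
qed

text \<open>If all components of \<open>G\<close> apart from isolated vertices have even order, while \<open>H\<close> has two such
  components and both have odd order, the cards of \<open>H\<close> force all sides of edges of \<open>G\<close>, hence all
  nonzero degrees, to be odd; this contradicts the handshake lemma in a component of \<open>H\<close>.\<close>

lemma no_even_odd_pair:
  assumes G: "multigraph G" "forest G" "A \<in> cuts G" and H: "multigraph H" "forest H" "A' \<in> cuts H"
    and \<phi>: "deck_bij \<phi> G H" and m: "card (edges G) \<ge> 3" and iso: "isolated_count G = isolated_count H"
    and even_imb: "\<And>d. d \<in># imbalances A G \<Longrightarrow> even d" and D': "imbalances A' H = {#1, 1#}"
  shows False
proof -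
  have odd_imb: "\<exists>d\<in>#imbalances A (delete_edge G e). odd d"
    if e: "e \<in> edges G" "isolated_count (delete_edge G e) = isolated_count G" for e
    using odd_element_of_card[OF H(1,2) deck_bij_edge[OF \<phi> e(1)] _ D']
      deck_bij_isolated_count[OF G(1) H(1) \<phi> e(1)] e(2) iso
      deck_bij_imbalances[OF G(1,3) H(1,3) \<phi> e(1)] by simp
  have "1 \<in># imbalances A' H"
    unfolding D' by simp
  then obtain C where C: "C \<in> components H" "card C \<noteq> 1" "imbalance A' C = 1"
    unfolding in_imbalances[OF H(1)] by metis
  have "odd (degree_in H v)" if v: "v \<in> C" for v
  proof (rule odd_degrees_transfer[OF G H \<phi> m even_imb odd_imb])
    show "v \<in> verts H"
      using v component_subset[OF C(1)] by blast
    show "degree_in H v \<noteq> 0"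
      using component_card_1_iff[OF H(1) C(1) v] C(2) by simp
  qed
  then have "even (card C)"
    by (rule even_component_if_odd_degrees[OF H(1,3) C(1)])
  then show False
    using even_imbalance[OF finite_component[OF H(1) C(1)], of A'] C(3) by simp
qed

text \<open>Up to isolated vertices, \<open>H\<close> is a tree whose sides differ by two and \<open>G\<close> is a tree with equal
  sides.  Again all degrees are odd, and \<open>H\<close> has no leaf in its smaller side, as isolating it would
  give a card with a difference of three.  With all degrees in this side being at least three,
  there is room for only one vertex.\<close>

lemma balanced_tree_pair:
  assumes G: "multigraph G" "forest G" "A \<in> cuts G" and H: "multigraph H" "forest H" "A' \<in> cuts H"
    and \<phi>: "deck_bij \<phi> G H" and m: "card (edges G) \<ge> 3" and iso: "isolated_count G = isolated_count H"
    and D: "imbalances A G = {#0#}" and D': "imbalances A' H = {#2#}"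
  shows "card (edges G) = 3 \<and> (\<exists>v\<in>verts H. degree_in H v = 3)"
proof -
  let ?m = "card (edges G)"
  have mH: "card (edges H) = ?m"
    by (rule deck_bij_card_edges[OF \<phi>])
  have odd_imb: "\<exists>d\<in>#imbalances A (delete_edge G e). odd d"
    if e: "e \<in> edges G" "isolated_count (delete_edge G e) = isolated_count G" for e
  proof -
    obtain d d\<^sub>1 d\<^sub>2 where d: "d \<in># imbalances A G"
      "imbalances A (delete_edge G e) = imbalances A G - {#d#} + {#d\<^sub>1, d\<^sub>2#}"
      "d = d\<^sub>1 + d\<^sub>2 \<or> d\<^sub>1 = d + d\<^sub>2 \<or> d\<^sub>2 = d + d\<^sub>1"
      by (rule internal_edge_card[OF G(1,2) e, of A])
    have "isolated_count (delete_edge H (\<phi> e)) = isolated_count H"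
      using deck_bij_isolated_count[OF G(1) H(1) \<phi> e(1)] e(2) iso by simp
    then obtain d' c\<^sub>1 c\<^sub>2 where d': "d' \<in># imbalances A' H"
      "imbalances A' (delete_edge H (\<phi> e)) = imbalances A' H - {#d'#} + {#c\<^sub>1, c\<^sub>2#}"
      "d' = c\<^sub>1 + c\<^sub>2 \<or> c\<^sub>1 = d' + c\<^sub>2 \<or> c\<^sub>2 = d' + c\<^sub>1"
      by (rule internal_edge_card[OF H(1,2) deck_bij_edge[OF \<phi> e(1)], of A'])
    have "d = 0" "d' = 2"
      using d(1) d'(1) D D' by auto
    then have "imbalances A (delete_edge G e) = {#d\<^sub>1, d\<^sub>2#}" "d\<^sub>1 = d\<^sub>2"
      using d D by auto
    moreover have "imbalances A (delete_edge G e) = {#c\<^sub>1, c\<^sub>2#}"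
      using d'(2) D' \<open>d' = 2\<close> deck_bij_imbalances[OF G(1,3) H(1,3) \<phi> e(1)] by simp
    ultimately have "{#c\<^sub>1, c\<^sub>2#} = {#d\<^sub>1, d\<^sub>1#}"
      by simp
    then have "c\<^sub>1 = d\<^sub>1" "c\<^sub>2 = d\<^sub>1"
      by (auto simp: add_eq_conv_ex)
    then have "c\<^sub>1 = 1" "c\<^sub>2 = 1"
      using d'(3) \<open>d' = 2\<close> by linarith+
    then show ?thesis
      using \<open>imbalances A (delete_edge G e) = {#c\<^sub>1, c\<^sub>2#}\<close> by simp
  qed
  have "size (imbalances A' H) = 1"
    using D' by simp
  then have "card {C \<in> components H. card C \<noteq> 1} = 1"
    by (simp add: imbalances_def)
  then obtain C where C': "{C \<in> components H. card C \<noteq> 1} = {C}"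
    by (rule card_1_singletonE)
  then have C: "C \<in> components H" "card C \<noteq> 1"
    by blast+
  have "2 \<in># imbalances A' H"
    using D' by simp
  then have imbC: "imbalance A' C = 2"
    using C' unfolding in_imbalances[OF H(1)] by auto
  have edges: "component_edges H C = edges H"
  proof -
    have "ends H e \<subseteq> C" if e: "e \<in> edges H" for e
    proof -
      obtain C\<^sub>1 where C\<^sub>1: "C\<^sub>1 \<in> components H" "ends H e \<subseteq> C\<^sub>1" "card C\<^sub>1 \<noteq> 1"
        by (rule edge_in_nontrivial_component[OF H(1) e])
      then have "C\<^sub>1 \<in> {C \<in> components H. card C \<noteq> 1}"
        by simp
      then show ?thesis
        using C\<^sub>1(2) unfolding C' by simp
    qed
    then show ?thesis
      by (auto simp: component_edges_def)
  qed
  obtain S where S: "S \<in> cuts H" "surplus S C = - 2"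
  proof (cases "surplus A' C = - 2")
    case True
    then show thesis
      using that H(3) by blast
  next
    case False
    then have "surplus A' C = 2"
      using imbC by (auto simp: imbalance_def)
    then have "surplus (verts H - A') C = - 2"
      using component_Diff_cut[OF C(1), of A'] component_Diff_compl[OF C(1), of A']
      by (simp add: surplus_def)
    then show thesis
      using that cuts_compl[OF H(1,3)] by blast
  qed
  have DS: "imbalances S H = {#2#}"
    unfolding imbalances_def C' using S(2) by (simp add: imbalance_def)
  have finC: "finite C"
    by (rule finite_component[OF H(1) C(1)])
  have deg: "degree_in H v \<ge> 3" if v: "v \<in> C \<inter> S" for v
  proof -
    have vC: "v \<in> C" and vH: "v \<in> verts H"
      using v component_subset[OF C(1)] by auto
    have "odd (degree_in H v)"
    proof (rule odd_degrees_transfer[OF G H \<phi> m _ odd_imb vH])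
      show "degree_in H v \<noteq> 0"
        using component_card_1_iff[OF H(1) C(1) vC] C(2) by simp
    qed (use D in auto)
    moreover have "degree_in H v \<noteq> 1"
    proof
      assume "degree_in H v = 1"
      then obtain e where e: "e \<in> edges H"
        "isolated_count (delete_edge H e) = isolated_count H + 1 + of_bool (card (C - {v}) = 1)"
        "card (C - {v}) \<noteq> 1 \<longrightarrow> imbalances S (delete_edge H e) =
          imbalances S H - {#imbalance S C#} + {#nat \<bar>surplus S C - (if v \<in> S then 1 else - 1)\<bar>#}"
        by (rule isolate_leaf[OF H(1) C(1) vC, of S])
      have ne: "card (C - {v}) \<noteq> 1"
      proof
        assume "card (C - {v}) = 1"
        then have "0 \<in># imbalances S H"
          using K2_edge_card(1)[OF H(1,2) S(1) e(1)] e(2) by simp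
        then show False
          using DS by simp
      qed
      have "imbalances S (delete_edge H e) = {#3#}"
        using e(3) ne v S(2) DS by (simp add: imbalance_def)
      moreover obtain e' where e': "e' \<in> edges G" "e = \<phi> e'"
        using e(1) \<phi> by (auto simp: deck_bij_def bij_betw_def)
      ultimately have three: "imbalances A (delete_edge G e') = {#3#}"
        using deck_bij_imbalances[OF G(1,3) H(1) S(1) \<phi> e'(1)] by simp
      have "isolated_count (delete_edge G e') = isolated_count G + 1"
        using deck_bij_isolated_count[OF G(1) H(1) \<phi> e'(1)] e(2) e'(2) ne iso by simp
      from leaf_edge_card[OF G(1,2) e'(1) this, of A] show False
        using D three by (auto simp: step_down_def)
    qed
    ultimately show ?thesis
      by presburger
  qed
  have sum: "(\<Sum>v\<in>C \<inter> S. degree_in H v) = ?m"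
    using sum_degree_over_cut[OF H(1) S(1) C(1)] edges mH by simp
  then have "card (C \<inter> S) * 3 \<le> ?m"
    using sum_bounded_below[of "C \<inter> S" 3 "degree_in H"] deg by simp
  moreover have "?m + 1 = 2 * card (C \<inter> S) + 2"
    using forest_card_component_edges[OF H(1,2) C(1)] edges mH card_split[OF finC, of S] S(2)
    by (simp add: surplus_def)
  ultimately have "card (C \<inter> S) = 1" "?m = 3"
    using m by linarith+
  then obtain v where "C \<inter> S = {v}"
    by (auto simp: card_1_singleton_iff)
  then show ?thesis
    using sum \<open>?m = 3\<close> component_subset[OF C(1)] by auto
qed

lemma step_family_cards:
  assumes G: "multigraph G" "forest G" "A \<in> cuts G"
    and no_K2: "\<And>e. e \<in> edges G \<Longrightarrow> isolated_count (delete_edge G e) \<noteq> isolated_count G + 2"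
  shows "step_family (imbalances A G) {imbalances A (delete_edge G e) |e.
    e \<in> edges G \<and> isolated_count (delete_edge G e) = isolated_count G + 1}"
    (is "step_family ?D ?L")
  unfolding step_family_def
proof (intro conjI ballI)
  fix X assume "X \<in> ?L"
  then show "\<exists>d\<in>#?D. X = ?D - {#d#} + {#step_down d#} \<or> X = ?D - {#d#} + {#Suc d#}"
    using leaf_edge_card[OF G(1,2)] by blast
next
  fix d assume d: "d \<in># ?D"
  obtain e where "e \<in> edges G" "isolated_count (delete_edge G e) = isolated_count G + 1"
    "imbalances A (delete_edge G e) = ?D - {#d#} + {#step_down d#}"
    by (rule balancing_leaf_card[OF G _ d]) (use no_K2 in blast)+
  then show "?D - {#d#} + {#step_down d#} \<in> ?L"
    by (metis (mono_tags, lifting) mem_Collect_eq)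
qed

text \<open>If some card isolates both ends of its edge, it shows the other components unchanged.  Otherwise
  the cards that isolate a single leaf form a common step family of both multisets of imbalances.\<close>

lemma forests_same_deck:
  assumes G: "multigraph G" "forest G" and H: "multigraph H" "forest H" and \<phi>: "deck_bij \<phi> G H"
    and m: "card (edges G) \<ge> 3" and neq: "top_coeff G \<noteq> top_coeff H"
  shows "card (edges G) = 3 \<and> (\<exists>v\<in>verts G. degree_in G v = 3)"
proof -
  let ?\<psi> = "inv_into (edges G) \<phi>"
  have \<psi>: "deck_bij ?\<psi> H G"
    by (rule deck_bij_sym[OF \<phi>])
  have mH: "card (edges H) \<ge> 3"
    using deck_bij_card_edges[OF \<phi>] m by simp
  note dist = forests_degree_distribution[OF G H \<phi> m]
  have iso: "isolated_count G = isolated_count H"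
    unfolding isolated_count_def by (rule dist)
  have E: "edges G \<noteq> {}"
    using m by auto
  note n = deck_bij_card_verts[OF G(1) H(1) \<phi> E]
  obtain A A' where A: "A \<in> cuts G" and A': "A' \<in> cuts H"
    using forest_cuts_nonempty[OF G] forest_cuts_nonempty[OF H] by blast
  let ?D = "imbalances A G" and ?D' = "imbalances A' H"
  have neqD: "?D \<noteq> ?D'"
    using top_coeff_eq_if_imbalances_eq[OF G(1) A H(1) A' _ iso n] neq by blast
  have size: "size ?D = size ?D'"
    using size_imbalances[OF G(1), of A] size_imbalances[OF H(1), of A'] iso n
      forest_card_components[OF G] forest_card_components[OF H] deck_bij_card_edges[OF \<phi>] by simp
  have iso_card: "isolated_count (delete_edge H (\<phi> e)) = isolated_count (delete_edge G e)"
    "imbalances A' (delete_edge H (\<phi> e)) = imbalances A (delete_edge G e)" if "e \<in> edges G" for e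
    using deck_bij_isolated_count[OF G(1) H(1) \<phi> that] deck_bij_imbalances[OF G(1) A H(1) A' \<phi> that] by auto
  have edgesH: "\<exists>e\<in>edges G. f = \<phi> e" if "f \<in> edges H" for f
    using that \<phi> by (auto simp: deck_bij_def bij_betw_def)
  have no_K2: "isolated_count (delete_edge G e) \<noteq> isolated_count G + 2" if e: "e \<in> edges G" for e
  proof
    assume K2: "isolated_count (delete_edge G e) = isolated_count G + 2"
    then have "isolated_count (delete_edge H (\<phi> e)) = isolated_count H + 2"
      using iso_card(1)[OF e] iso by simp
    then have "0 \<in># ?D'" "?D' - {#0#} = ?D - {#0#}" "0 \<in># ?D"
      using K2_edge_card[OF G A e K2] K2_edge_card[OF H A' deck_bij_edge[OF \<phi> e]] iso_card(2)[OF e]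
      by simp_all
    then show False
      using neqD by (metis insert_DiffM)
  qed
  have no_K2': "isolated_count (delete_edge H f) \<noteq> isolated_count H + 2" if "f \<in> edges H" for f
    using edgesH[OF that] no_K2 iso_card(1) iso by auto
  let ?L = "{imbalances A (delete_edge G e) |e.
    e \<in> edges G \<and> isolated_count (delete_edge G e) = isolated_count G + 1}"
  let ?L' = "{imbalances A' (delete_edge H f) |f.
    f \<in> edges H \<and> isolated_count (delete_edge H f) = isolated_count H + 1}"
  have "?L' = ?L"
  proof (intro equalityI subsetI)
    fix X assume "X \<in> ?L'"
    then obtain f where f: "f \<in> edges H" "isolated_count (delete_edge H f) = isolated_count H + 1"
      "X = imbalances A' (delete_edge H f)"
      by blast
    obtain e where "e \<in> edges G" "f = \<phi> e"
      using edgesH[OF f(1)] by blast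
    then show "X \<in> ?L"
      using f(2,3) iso_card[of e] iso by auto
  next
    fix X assume "X \<in> ?L"
    then obtain e where e: "e \<in> edges G" "isolated_count (delete_edge G e) = isolated_count G + 1"
      "X = imbalances A (delete_edge G e)"
      by blast
    then show "X \<in> ?L'"
      using deck_bij_edge[OF \<phi> e(1)] iso_card[OF e(1)] iso by (auto intro!: exI[of _ "\<phi> e"])
  qed
  then have "exceptional_pair ?D ?D' \<or> exceptional_pair ?D' ?D"
    using step_family_determines[OF step_family_cards[OF G A no_K2] _ size]
      step_family_cards[OF H A' no_K2'] neqD by auto
  then consider "?D = {#0#}" "?D' = {#2#}" | "?D' = {#0#}" "?D = {#2#}"
    | "?D = {#0, 0#} \<or> ?D = {#0, 2#}" "?D' = {#1, 1#}"
    | "?D' = {#0, 0#} \<or> ?D' = {#0, 2#}" "?D = {#1, 1#}"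
    unfolding exceptional_pair_def by blast
  then show ?thesis
  proof cases
    case 1
    then obtain w where "card (edges G) = 3" "w \<in> verts H" "degree_in H w = 3"
      using balanced_tree_pair[OF G A H A' \<phi> m iso] by blast
    then show ?thesis
      using degree_in_transfer[OF H(1) G(1) dist] by metis
  next
    case 2
    then show ?thesis
      using balanced_tree_pair[OF H A' G A \<psi> mH iso[symmetric]] deck_bij_card_edges[OF \<phi>] by simp
  next
    case 3
    then have "even d" if "d \<in># ?D" for d
      using that by auto
    then show ?thesis
      using no_even_odd_pair[OF G A H A' \<phi> m iso _ 3(2)] by blast
  next
    case 4
    then have "even d" if "d \<in># ?D'" for d
      using that by auto
    then show ?thesis
      using no_even_odd_pair[OF H A' G A \<psi> mH iso[symmetric] _ 4(2)] by blast
  qed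
qed

section \<open>Graphs with at least three edges\<close>

lemma same_deck_different_poly:
  assumes G: "multigraph G" and H: "multigraph H" and \<phi>: "deck_bij \<phi> G H"
    and m: "card (edges G) \<ge> 3" and neq: "bipartition_poly H \<noteq> bipartition_poly G"
  shows "card (edges G) = 3"
    "forest G \<and> (\<exists>v\<in>verts G. degree_in G v = 3) \<or>
     card {v \<in> verts G. degree_in G v = 2} = 3 \<and> (\<forall>v\<in>verts G. degree_in G v = 0 \<or> degree_in G v = 2) \<and>
       card (verts G) \<ge> 4"
proof -
  have \<psi>: "deck_bij (inv_into (edges G) \<phi>) H G"
    by (rule deck_bij_sym[OF \<phi>])
  have mH: "card (edges H) = card (edges G)"
    by (rule deck_bij_card_edges[OF \<phi>])
  have top: "top_coeff G \<noteq> top_coeff H"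
    using bipartition_poly_eq_if_top_coeff_eq[OF G H \<phi>] neq by metis
  have "forest G \<or> forest H"
  proof (rule ccontr)
    assume cyclic: "\<not> ?thesis"
    have "cuts G = {}" "cuts H = {}"
      using top_coeff_eq_if_not_forests[OF G H \<phi>] top_coeff_eq_if_not_forests[OF H G \<psi>] cyclic top
      by metis+
    then show False
      using top_coeff_eq_0_iff[OF G] top_coeff_eq_0_iff[OF H] top by simp
  qed
  then consider "forest G" "forest H" | "forest G" "\<not> forest H" | "\<not> forest G" "forest H"
    by blast
  then have "card (edges G) = 3 \<and> (forest G \<and> (\<exists>v\<in>verts G. degree_in G v = 3) \<or>
     card {v \<in> verts G. degree_in G v = 2} = 3 \<and> (\<forall>v\<in>verts G. degree_in G v = 0 \<or> degree_in G v = 2) \<and>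
       card (verts G) \<ge> 4)"
  proof cases
    case 1
    then show ?thesis
      using forests_same_deck[OF G 1(1) H 1(2) \<phi> m top] by blast
  next
    case 2
    then show ?thesis
      using forest_not_forest_same_deck(1,2)[OF G H \<phi> 2 m] by blast
  next
    case 3
    have "card (edges H) \<ge> 3"
      using m mH by simp
    then show ?thesis
      using forest_not_forest_same_deck[OF H G \<psi> 3(2,1)] mH by simp
  qed
  then show "card (edges G) = 3"
    "forest G \<and> (\<exists>v\<in>verts G. degree_in G v = 3) \<or>
     card {v \<in> verts G. degree_in G v = 2} = 3 \<and> (\<forall>v\<in>verts G. degree_in G v = 0 \<or> degree_in G v = 2) \<and>
       card (verts G) \<ge> 4"
    by blast+
qed

section \<open>Isomorphisms\<close>

lemma bipartition_poly_isomorphic: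
  assumes G: "multigraph G" and iso: "isomorphic G H"
  shows "bipartition_poly H = bipartition_poly G"
proof -
  obtain f g where f: "bij_betw f (verts G) (verts H)" and g: "bij_betw g (edges G) (edges H)"
    and ends: "\<And>e. e \<in> edges G \<Longrightarrow> ends H (g e) = f ` ends G e"
    using iso unfolding isomorphic_def by blast
  have inj: "inj_on f (verts G)" and im: "f ` verts G = verts H"
    using f by (auto simp: bij_betw_def)
  have injg: "inj_on g (edges G)" and img: "g ` edges G = edges H"
    using g by (auto simp: bij_betw_def)
  have sub: "ends G e \<subseteq> verts G" if "e \<in> edges G" for e
    using G that unfolding multigraph_def by blast
  have boundary: "edge_boundary H (f ` W) = g ` edge_boundary G W" if W: "W \<subseteq> verts G" for W
  proof -
    have "card (ends H (g e) \<inter> f ` W) = card (ends G e \<inter> W)" if e: "e \<in> edges G" for e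
    proof -
      have "ends H (g e) \<inter> f ` W = f ` (ends G e \<inter> W)"
        using ends[OF e] inj_on_image_Int[OF inj sub[OF e] W] by simp
      moreover have "inj_on f (ends G e \<inter> W)"
        using inj sub[OF e] by (auto intro: inj_on_subset)
      ultimately show ?thesis
        by (simp add: card_image)
    qed
    then show ?thesis
      unfolding edge_boundary_def img[symmetric] by auto
  qed
  have nbrs: "neighbours (spanning H (g ` F)) (f ` W) = f ` neighbours (spanning G F) W"
    if W: "W \<subseteq> verts G" and F: "F \<subseteq> edges G" for W F
  proof -
    have mem: "f v \<in> f ` W \<longleftrightarrow> v \<in> W" if "v \<in> verts G" for v
      by (rule inj_on_image_mem_iff[OF inj that W])
    have eq: "ends H (g e) = {f v, f w} \<longleftrightarrow> ends G e = {v, w}"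
      if "e \<in> F" "v \<in> verts G" "w \<in> W" for e v w
    proof -
      have "ends H (g e) = f ` ends G e" "ends G e \<subseteq> verts G" "{v, w} \<subseteq> verts G"
        using ends sub that F W by blast+
      then show ?thesis
        using inj_on_image_eq_iff[OF inj, of "ends G e" "{v, w}"] by simp
    qed
    have "f v \<in> neighbours (spanning H (g ` F)) (f ` W) \<longleftrightarrow> v \<in> neighbours (spanning G F) W"
      if v: "v \<in> verts G" for v
      using mem[OF v] eq[OF _ v] v im by (auto simp: neighbours_def)
    moreover have "neighbours (spanning H (g ` F)) (f ` W) \<subseteq> f ` verts G"
      "neighbours (spanning G F) W \<subseteq> verts G"
      unfolding im by (auto simp: neighbours_def)
    ultimately show ?thesis
      by blast
  qed
  have inner: "(\<Sum>F\<in>Pow (edge_boundary H (f ` W)). vary ^ card (neighbours (spanning H F) (f ` W)) * varz ^ card F) =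
      (\<Sum>F\<in>Pow (edge_boundary G W). vary ^ card (neighbours (spanning G F) W) * varz ^ card F)"
    if W: "W \<subseteq> verts G" for W
  proof -
    have "bij_betw g (edge_boundary G W) (edge_boundary H (f ` W))"
      unfolding boundary[OF W] using injg edge_boundary_subset[of G W]
      by (auto intro: inj_on_imp_bij_betw inj_on_subset)
    then have "bij_betw ((`) g) (Pow (edge_boundary G W)) (Pow (edge_boundary H (f ` W)))"
      by (rule bij_betw_Pow)
    then have "(\<Sum>F\<in>Pow (edge_boundary H (f ` W)). vary ^ card (neighbours (spanning H F) (f ` W)) * varz ^ card F) =
        (\<Sum>F\<in>Pow (edge_boundary G W). vary ^ card (neighbours (spanning H (g ` F)) (f ` W)) * varz ^ card (g ` F))"
      by (rule sum.reindex_bij_betw[symmetric])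
    also have "\<dots> = (\<Sum>F\<in>Pow (edge_boundary G W). vary ^ card (neighbours (spanning G F) W) * varz ^ card F)"
    proof (rule sum.cong[OF refl])
      fix F assume "F \<in> Pow (edge_boundary G W)"
      then have F: "F \<subseteq> edges G"
        using edge_boundary_subset[of G W] by blast
      have "card (g ` F) = card F"
        by (rule card_image) (rule inj_on_subset[OF injg F])
      moreover have "card (f ` neighbours (spanning G F) W) = card (neighbours (spanning G F) W)"
        by (rule card_image) (use inj in \<open>auto simp: neighbours_def intro: inj_on_subset\<close>)
      ultimately show "vary ^ card (neighbours (spanning H (g ` F)) (f ` W)) * varz ^ card (g ` F) =
          vary ^ card (neighbours (spanning G F) W) * varz ^ card F"
        by (simp add: nbrs[OF W F])
    qed
    finally show ?thesis .
  qed
  have "bipartition_poly H = (\<Sum>W\<in>Pow (verts G). varx ^ card (f ` W) *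
     (\<Sum>F\<in>Pow (edge_boundary H (f ` W)). vary ^ card (neighbours (spanning H F) (f ` W)) * varz ^ card F))"
    unfolding bipartition_poly_def by (rule sum.reindex_bij_betw[OF bij_betw_Pow[OF f], symmetric])
  also have "\<dots> = bipartition_poly G"
    unfolding bipartition_poly_def
  proof (rule sum.cong[OF refl])
    fix W assume "W \<in> Pow (verts G)"
    then have W: "W \<subseteq> verts G"
      by simp
    have "card (f ` W) = card W"
      by (rule card_image) (rule inj_on_subset[OF inj W])
    then show "varx ^ card (f ` W) *
        (\<Sum>F\<in>Pow (edge_boundary H (f ` W)). vary ^ card (neighbours (spanning H F) (f ` W)) * varz ^ card F) =
      varx ^ card W *
        (\<Sum>F\<in>Pow (edge_boundary G W). vary ^ card (neighbours (spanning G F) W) * varz ^ card F)"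
      by (simp only: inner[OF W])
  qed
  finally show ?thesis .
qed

text \<open>\<open>G\<close> is \<open>X\<close> up to isolated vertices.\<close>

definition isomorphic_core :: "('v, 'e) mgraph \<Rightarrow> ('w, 'f) mgraph \<Rightarrow> bool" where
  "isomorphic_core G X \<longleftrightarrow> (\<exists>U f g. U \<subseteq> verts G \<and> bij_betw f U (verts X) \<and>
     bij_betw g (edges G) (edges X) \<and> (\<forall>e\<in>edges G. ends G e \<subseteq> U \<and> ends X (g e) = f ` ends G e))"

lemma isomorphic_coreI:
  assumes "U \<subseteq> verts G" "bij_betw f U (verts X)" "bij_betw g (edges G) (edges X)"
    and "\<And>e. e \<in> edges G \<Longrightarrow> ends G e \<subseteq> U \<and> ends X (g e) = f ` ends G e"
  shows "isomorphic_core G X"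
  unfolding isomorphic_core_def
  by (intro exI[of _ U] exI[of _ f] exI[of _ g] conjI ballI assms)

lemma isomorphic_coreE:
  assumes "isomorphic_core G X"
  obtains U f g where "U \<subseteq> verts G" "bij_betw f U (verts X)" "bij_betw g (edges G) (edges X)"
    "\<forall>e\<in>edges G. ends G e \<subseteq> U \<and> ends X (g e) = f ` ends G e"
  using assms unfolding isomorphic_core_def by (elim exE conjE) (rule that)

lemma isomorphic_core_card_le:
  assumes "multigraph G" "isomorphic_core G X"
  shows "card (verts X) \<le> card (verts G)"
proof -
  obtain U f where "U \<subseteq> verts G" "bij_betw f U (verts X)"
    using assms(2) by (rule isomorphic_coreE)
  then show ?thesis
    using card_mono[OF multigraph_finite(1)[OF assms(1)], of U] bij_betw_same_card[of f U] by simp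
qed

lemma isomorphic_if_core:
  assumes "multigraph G" "isomorphic_core G X" "card (verts G) = card (verts X)"
  shows "isomorphic G X"
proof -
  obtain U f g where U: "U \<subseteq> verts G" "bij_betw f U (verts X)" "bij_betw g (edges G) (edges X)"
    "\<forall>e\<in>edges G. ends G e \<subseteq> U \<and> ends X (g e) = f ` ends G e"
    using assms(2) by (rule isomorphic_coreE)
  have "card U = card (verts G)"
    using bij_betw_same_card[OF U(2)] assms(3) by simp
  then have "U = verts G"
    by (rule card_subset_eq[OF multigraph_finite(1)[OF assms(1)] U(1)])
  then show ?thesis
    using U unfolding isomorphic_def by (intro exI[of _ f] exI[of _ g]) simp
qed

lemma isomorphic_disjoint_union_if_core:
  assumes G: "multigraph G" and core: "isomorphic_core G X"
    and Y: "finite (verts Y)" "edges Y = {}" and n: "card (verts G) = card (verts X) + card (verts Y)"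
  shows "isomorphic G (X \<uplus> Y)"
proof -
  obtain U f g where U: "U \<subseteq> verts G" and f: "bij_betw f U (verts X)"
    and g: "bij_betw g (edges G) (edges X)"
    and ends': "\<forall>e\<in>edges G. ends G e \<subseteq> U \<and> ends X (g e) = f ` ends G e"
    using core by (rule isomorphic_coreE)
  note ends = bspec[OF ends']
  have finV: "finite (verts G)" and finU: "finite U"
    using G finite_subset[OF U] by simp_all
  have "card (verts G - U) = card (verts Y)"
    using card_Diff_subset[OF finU U] n bij_betw_same_card[OF f] by simp
  then obtain h where h: "bij_betw h (verts G - U) (verts Y)"
    using finite_same_card_bij[of "verts G - U" "verts Y"] finV Y(1) by auto
  define f' where "f' v = (if v \<in> U then Inl (f v) else Inr (h v))" for v
  have "bij_betw (Inl \<circ> f) U (Inl ` verts X)"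
    by (rule bij_betw_trans[OF f]) (simp add: bij_betw_def)
  then have "bij_betw f' U (Inl ` verts X)"
    by (subst bij_betw_cong[of _ _ "Inl \<circ> f"]) (simp_all add: f'_def)
  moreover have "bij_betw (Inr \<circ> h) (verts G - U) (Inr ` verts Y)"
    by (rule bij_betw_trans[OF h]) (simp add: bij_betw_def)
  then have "bij_betw f' (verts G - U) (Inr ` verts Y)"
    by (subst bij_betw_cong[of _ _ "Inr \<circ> h"]) (simp_all add: f'_def)
  ultimately have "bij_betw f' (U \<union> (verts G - U)) (Inl ` verts X \<union> Inr ` verts Y)"
    by (rule bij_betw_combine) blast
  then have "bij_betw f' (verts G) (verts (X \<uplus> Y))"
    using U by (simp add: disjoint_union_def Plus_def Un_absorb1)
  moreover have "bij_betw (Inl \<circ> g) (edges G) (edges (X \<uplus> Y))"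
    using g Y(2) by (auto simp: bij_betw_def disjoint_union_def inj_on_def)
  moreover have "ends (X \<uplus> Y) ((Inl \<circ> g) e) = f' ` ends G e" if "e \<in> edges G" for e
  proof -
    have "f' ` ends G e = (\<lambda>v. Inl (f v)) ` ends G e"
      using ends[OF that] by (intro image_cong refl) (auto simp: f'_def)
    then show ?thesis
      using ends[OF that] by (simp add: disjoint_union_def image_image)
  qed
  ultimately show ?thesis
    unfolding isomorphic_def by blast
qed

lemma copies_path_graph_1:
  "edges (copies t (path_graph 1)) = {}" "card (verts (copies t (path_graph 1))) = t"
  "finite (verts (copies t (path_graph 1)))"
  by (simp_all add: copies_def path_graph_def)

lemma isomorphic_isolated_if_core:
  assumes "multigraph G" "isomorphic_core G X" "card (verts G) = card (verts X) + t"
  shows "isomorphic G (X \<uplus> copies t (path_graph 1))"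
  by (rule isomorphic_disjoint_union_if_core[OF assms(1,2)])
    (simp_all only: copies_path_graph_1 assms(3))

lemma bipartition_poly_eq_if_same_core:
  assumes G: "multigraph G" "isomorphic_core G X" and H: "multigraph H" "isomorphic_core H X"
    and n: "card (verts G) = card (verts H)"
  shows "bipartition_poly G = bipartition_poly H"
proof -
  obtain t where t: "card (verts G) = card (verts X) + t"
    using isomorphic_core_card_le[OF G] le_Suc_ex by blast
  show ?thesis
    using bipartition_poly_isomorphic[OF G(1) isomorphic_isolated_if_core[OF G t]]
      bipartition_poly_isomorphic[OF H(1) isomorphic_isolated_if_core[OF H, of t]] n t by simp
qed

lemma isomorphic_edgeless:
  assumes "multigraph G" "edges G = {}"
  shows "isomorphic G (copies (card (verts G)) (path_graph 1))"
proof -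
  obtain f where "bij_betw f (verts G) (verts (copies (card (verts G)) (path_graph 1)))"
    using finite_same_card_bij[OF multigraph_finite(1)[OF assms(1)] copies_path_graph_1(3)
        copies_path_graph_1(2)[symmetric]] by blast
  moreover have "bij_betw undefined (edges G) (edges (copies (card (verts G)) (path_graph 1)))"
    unfolding copies_path_graph_1 assms(2) by (simp add: bij_betw_def)
  ultimately show ?thesis
    unfolding isomorphic_def using assms(2) by blast
qed

lemma one_edge_core:
  assumes "multigraph G" "card (edges G) = 1"
  shows "isomorphic_core G (path_graph 2)"
proof -
  obtain e where e: "edges G = {e}"
    using assms(2) by (rule card_1_singletonE)
  obtain a b where ab: "ends G e = {a, b}" "a \<noteq> b" "a \<in> verts G" "b \<in> verts G"
    using multigraph_ends[OF assms(1), of e] e by blast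
  have edges: "edges (path_graph 2) = {0}" "verts (path_graph 2) = {0, 1}"
    by (auto simp: path_graph_def)
  show ?thesis
  proof (rule isomorphic_coreI)
    show "{a, b} \<subseteq> verts G"
      using ab by simp
    show "bij_betw (\<lambda>v. if v = a then 0 else 1) {a, b} (verts (path_graph 2))"
      unfolding edges using ab(2) by (auto simp: bij_betw_def inj_on_def)
    show "bij_betw (\<lambda>_. 0) (edges G) (edges (path_graph 2))"
      unfolding edges e by (simp add: bij_betw_def)
  qed (use e ab in \<open>auto simp: path_graph_def\<close>)
qed

lemma parallel_edges_core:
  assumes G: "multigraph G" and E: "edges G = {e, f}" "e \<noteq> f" and par: "ends G e = ends G f"
  shows "isomorphic_core G (cycle_graph 2)"
proof -
  obtain a b where ab: "ends G e = {a, b}" "a \<noteq> b" "a \<in> verts G" "b \<in> verts G"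
    using multigraph_ends[OF G, of e] E by blast
  have C: "edges (cycle_graph 2) = {0, 1}" "verts (cycle_graph 2) = {0, 1}"
    by (auto simp: cycle_graph_def)
  show ?thesis
  proof (rule isomorphic_coreI)
    show "{a, b} \<subseteq> verts G"
      using ab by simp
    show "bij_betw (\<lambda>v. if v = a then 0 else 1) {a, b} (verts (cycle_graph 2))"
      unfolding C using ab(2) by (auto simp: bij_betw_def inj_on_def)
    show "bij_betw (\<lambda>x. if x = e then 0 else 1) (edges G) (edges (cycle_graph 2))"
      unfolding C E using E(2) by (auto simp: bij_betw_def inj_on_def)
  qed (use E ab par in \<open>auto simp: cycle_graph_def\<close>)
qed

lemma two_edges_sharing_one:
  assumes G: "multigraph G" and ef: "e \<in> edges G" "f \<in> edges G" and one: "card (ends G e \<inter> ends G f) = 1"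
  obtains a b c where "ends G e = {a, b}" "ends G f = {b, c}" "a \<noteq> b" "b \<noteq> c" "a \<noteq> c" "{a, b, c} \<subseteq> verts G"
proof -
  obtain b where b: "ends G e \<inter> ends G f = {b}"
    using one by (rule card_1_singletonE)
  have other: "\<exists>x. ends G h = {x, b} \<and> x \<noteq> b \<and> {x, b} \<subseteq> verts G" if h: "h \<in> edges G" "b \<in> ends G h" for h
  proof -
    obtain u v where uv: "ends G h = {u, v}" "u \<noteq> v" "u \<in> verts G" "v \<in> verts G"
      by (rule multigraph_ends[OF G h(1)])
    then have "b = u \<or> b = v"
      using h(2) by blast
    then show ?thesis
    proof
      assume "b = u"
      then show ?thesis
        using uv by (intro exI[of _ v]) auto
    next
      assume "b = v"
      then show ?thesis
        using uv by (intro exI[of _ u]) auto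
    qed
  qed
  have "b \<in> ends G e" "b \<in> ends G f"
    using b by blast+
  then obtain a c where ac: "ends G e = {a, b}" "a \<noteq> b" "{a, b} \<subseteq> verts G"
    "ends G f = {c, b}" "c \<noteq> b" "{c, b} \<subseteq> verts G"
    using other[OF ef(1)] other[OF ef(2)] by blast
  have "a \<noteq> c"
    using b ac by auto
  then show thesis
    using that[of a b c] ac by (auto simp: insert_commute)
qed

lemma adjacent_edges_core:
  assumes G: "multigraph G" and E: "edges G = {e, f}" "e \<noteq> f" and one: "card (ends G e \<inter> ends G f) = 1"
  shows "isomorphic_core G (path_graph 3)"
proof -
  have "e \<in> edges G" "f \<in> edges G"
    using E by simp_all
  then obtain a b c where abc: "ends G e = {a, b}" "ends G f = {b, c}" "a \<noteq> b" "b \<noteq> c" "a \<noteq> c"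
    "{a, b, c} \<subseteq> verts G"
    by (rule two_edges_sharing_one[OF G _ _ one])
  have P: "edges (path_graph 3) = {0, 1}" "verts (path_graph 3) = {0, 1, 2}"
    by (auto simp: path_graph_def)
  show ?thesis
  proof (rule isomorphic_coreI)
    show "{a, b, c} \<subseteq> verts G"
      by (rule abc(6))
    show "bij_betw (\<lambda>v. if v = a then 0 else if v = b then 1 else 2) {a, b, c} (verts (path_graph 3))"
      unfolding P using abc(3-5) by (auto simp: bij_betw_def inj_on_def)
    show "bij_betw (\<lambda>x. if x = e then 0 else 1) (edges G) (edges (path_graph 3))"
      unfolding P E using E(2) by (auto simp: bij_betw_def inj_on_def)
  qed (use E abc in \<open>auto simp: path_graph_def\<close>)
qed

lemma disjoint_edges_core:
  assumes G: "multigraph G" and E: "edges G = {e, f}" "e \<noteq> f" and disj: "ends G e \<inter> ends G f = {}"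
  shows "isomorphic_core G (copies 2 (path_graph 2))"
proof -
  obtain a b where ab: "ends G e = {a, b}" "a \<noteq> b" "a \<in> verts G" "b \<in> verts G"
    using multigraph_ends[OF G, of e] E by blast
  obtain c d where cd: "ends G f = {c, d}" "c \<noteq> d" "c \<in> verts G" "d \<in> verts G"
    using multigraph_ends[OF G, of f] E by blast
  have ne: "a \<noteq> c" "a \<noteq> d" "b \<noteq> c" "b \<noteq> d"
    using disj ab(1) cd(1) by auto
  have P: "edges (copies 2 (path_graph 2)) = {(0, 0), (1, 0)}"
    "verts (copies 2 (path_graph 2)) = {(0, 0), (0, 1), (1, 0), (1, 1)}"
    by (auto simp: path_graph_def copies_def)
  show ?thesis
  proof (rule isomorphic_coreI)
    show "{a, b, c, d} \<subseteq> verts G"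
      using ab cd by simp
    show "bij_betw (\<lambda>v. if v = a then (0, 0) else if v = b then (0, 1) else if v = c then (1, 0) else (1, 1))
        {a, b, c, d} (verts (copies 2 (path_graph 2)))"
      unfolding P using ab(2) cd(2) ne by (auto simp: bij_betw_def inj_on_def)
    show "bij_betw (\<lambda>x. if x = e then (0, 0) else (1, 0)) (edges G) (edges (copies 2 (path_graph 2)))"
      unfolding P E using E(2) by (auto simp: bij_betw_def inj_on_def)
  qed (use E ab cd ne in \<open>auto simp: path_graph_def copies_def\<close>)
qed

lemma two_edges_core:
  assumes G: "multigraph G" and m: "card (edges G) = 2"
  shows "isomorphic_core G (cycle_graph 2) \<or> isomorphic_core G (path_graph 3) \<or>
    isomorphic_core G (copies 2 (path_graph 2))"
proof -
  obtain e f where E: "edges G = {e, f}" "e \<noteq> f"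
    using m by (auto simp: card_2_iff)
  have ends: "card (ends G e) = 2" "card (ends G f) = 2"
    using G E unfolding multigraph_def by blast+
  then have fin: "finite (ends G e)" "finite (ends G f)"
    by (metis card.infinite zero_neq_numeral)+
  have "card (ends G e \<inter> ends G f) \<le> 2"
    using card_mono[OF fin(1), of "ends G e \<inter> ends G f"] ends(1) by simp
  then consider "card (ends G e \<inter> ends G f) = 2" | "card (ends G e \<inter> ends G f) = 1"
    | "card (ends G e \<inter> ends G f) = 0"
    by linarith
  then show ?thesis
  proof cases
    case 1
    then have "ends G e \<inter> ends G f = ends G e" "ends G e \<inter> ends G f = ends G f"
      using ends fin by (metis card_subset_eq inf_le1, metis card_subset_eq inf_le2)
    then show ?thesis
      using parallel_edges_core[OF G E] by simp
  next
    case 2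
    then show ?thesis
      using adjacent_edges_core[OF G E] by simp
  next
    case 3
    then show ?thesis
      using disjoint_edges_core[OF G E] fin by simp
  qed
qed

lemma claw_core:
  assumes G: "multigraph G" "forest G" and m: "card (edges G) = 3" and v: "v \<in> verts G" "degree_in G v = 3"
  shows "isomorphic_core G (star_graph 3)"
proof -
  obtain e\<^sub>1 e\<^sub>2 e\<^sub>3 where E: "edges G = {e\<^sub>1, e\<^sub>2, e\<^sub>3}" "e\<^sub>1 \<noteq> e\<^sub>2" "e\<^sub>2 \<noteq> e\<^sub>3" "e\<^sub>1 \<noteq> e\<^sub>3"
    using m by (auto simp: card_3_iff)
  have "\<exists>a. ends G e = {v, a} \<and> a \<noteq> v \<and> a \<in> verts G" if e: "e \<in> edges G" for e
  proof -
    have "v \<in> ends G e"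
      by (rule full_degree_incident[OF G(1) _ e]) (use v m in simp)
    moreover obtain a b where "ends G e = {a, b}" "a \<noteq> b" "a \<in> verts G" "b \<in> verts G"
      by (rule multigraph_ends[OF G(1) e])
    ultimately show ?thesis
      by (metis doubleton_eq_iff insertE singletonD)
  qed
  then obtain a\<^sub>1 a\<^sub>2 a\<^sub>3 where a: "ends G e\<^sub>1 = {v, a\<^sub>1}" "a\<^sub>1 \<noteq> v" "a\<^sub>1 \<in> verts G"
    "ends G e\<^sub>2 = {v, a\<^sub>2}" "a\<^sub>2 \<noteq> v" "a\<^sub>2 \<in> verts G" "ends G e\<^sub>3 = {v, a\<^sub>3}" "a\<^sub>3 \<noteq> v" "a\<^sub>3 \<in> verts G"
    using E(1) by (metis insertI1 insertI2)
  have ne: "a\<^sub>1 \<noteq> a\<^sub>2" "a\<^sub>2 \<noteq> a\<^sub>3" "a\<^sub>1 \<noteq> a\<^sub>3"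
    using forest_no_parallel_edges[OF G, of e\<^sub>1 e\<^sub>2] forest_no_parallel_edges[OF G, of e\<^sub>2 e\<^sub>3]
      forest_no_parallel_edges[OF G, of e\<^sub>1 e\<^sub>3] E a by auto
  have S: "edges (star_graph 3) = {1, 2, 3}" "verts (star_graph 3) = {0, 1, 2, 3}"
    by (auto simp: star_graph_def)
  show ?thesis
  proof (rule isomorphic_coreI)
    show "{v, a\<^sub>1, a\<^sub>2, a\<^sub>3} \<subseteq> verts G"
      using v a by simp
    show "bij_betw (\<lambda>x. if x = v then 0 else if x = a\<^sub>1 then 1 else if x = a\<^sub>2 then 2 else 3)
        {v, a\<^sub>1, a\<^sub>2, a\<^sub>3} (verts (star_graph 3))"
      unfolding S using a(2,5,8) ne by (auto simp: bij_betw_def inj_on_def)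
    show "bij_betw (\<lambda>x. if x = e\<^sub>1 then 1 else if x = e\<^sub>2 then 2 else 3) (edges G) (edges (star_graph 3))"
      unfolding S E(1) using E(2-4) by (auto simp: bij_betw_def inj_on_def)
  qed (use E a ne in \<open>auto simp: star_graph_def\<close>)
qed

lemma triangle_core:
  assumes G: "multigraph G" and m: "card (edges G) = 3"
    and three: "card {v \<in> verts G. degree_in G v = 2} = 3"
    and deg: "\<And>v. v \<in> verts G \<Longrightarrow> degree_in G v = 0 \<or> degree_in G v = 2"
  shows "isomorphic_core G (cycle_graph 3)"
proof -
  obtain a b c where N: "{v \<in> verts G. degree_in G v = 2} = {a, b, c}" "a \<noteq> b" "b \<noteq> c" "a \<noteq> c"
    using three unfolding card_3_iff by blast
  have ends: "ends G e \<subseteq> {a, b, c}" "card (ends G e) = 2" if e: "e \<in> edges G" for e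
  proof -
    have "v \<in> {v \<in> verts G. degree_in G v = 2}" if "v \<in> ends G e" for v
      using deg[of v] degree_in_eq_0_iff[OF G, of v] e that G unfolding multigraph_def by blast
    then show "ends G e \<subseteq> {a, b, c}" "card (ends G e) = 2"
      using N(1) G e unfolding multigraph_def by blast+
  qed
  have miss: "\<exists>e. {e \<in> edges G. v \<notin> ends G e} = {e}" if v: "degree_in G v = 2" for v
  proof -
    have "{e \<in> edges G. v \<notin> ends G e} = edges G - {e \<in> edges G. v \<in> ends G e}"
      by blast
    then have "card {e \<in> edges G. v \<notin> ends G e} = 1"
      using card_Diff_subset[of "{e \<in> edges G. v \<in> ends G e}" "edges G"] G m v
      by (simp add: degree_in_def)
    then show ?thesis
      by (meson card_1_singletonE)
  qed
  have deg2: "degree_in G a = 2" "degree_in G b = 2" "degree_in G c = 2"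
    using N(1) by blast+
  obtain e\<^sub>a where opp_a: "{e \<in> edges G. a \<notin> ends G e} = {e\<^sub>a}"
    using miss[OF deg2(1)] ..
  obtain e\<^sub>b where opp_b: "{e \<in> edges G. b \<notin> ends G e} = {e\<^sub>b}"
    using miss[OF deg2(2)] ..
  obtain e\<^sub>c where opp_c: "{e \<in> edges G. c \<notin> ends G e} = {e\<^sub>c}"
    using miss[OF deg2(3)] ..
  note opp = opp_a opp_b opp_c
  have cases: "ends G e = {b, c} \<or> ends G e = {a, c} \<or> ends G e = {a, b}" if e: "e \<in> edges G" for e
  proof -
    obtain u v where "ends G e = {u, v}" "u \<noteq> v"
      by (rule multigraph_ends[OF G e])
    then show ?thesis
      using ends(1)[OF e] by auto
  qed
  have e: "e\<^sub>a \<in> edges G" "a \<notin> ends G e\<^sub>a" "e\<^sub>b \<in> edges G" "b \<notin> ends G e\<^sub>b" "e\<^sub>c \<in> edges G" "c \<notin> ends G e\<^sub>c"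
    using opp by blast+
  then have E: "ends G e\<^sub>a = {b, c}" "ends G e\<^sub>b = {a, c}" "ends G e\<^sub>c = {a, b}"
    using cases[of e\<^sub>a] cases[of e\<^sub>b] cases[of e\<^sub>c] by auto
  have edges: "edges G = {e\<^sub>a, e\<^sub>b, e\<^sub>c}"
  proof
    show "edges G \<subseteq> {e\<^sub>a, e\<^sub>b, e\<^sub>c}"
    proof
      fix e assume e: "e \<in> edges G"
      then have "e \<in> {e \<in> edges G. a \<notin> ends G e} \<or> e \<in> {e \<in> edges G. b \<notin> ends G e} \<or>
          e \<in> {e \<in> edges G. c \<notin> ends G e}"
        using cases[OF e] N(2-4) by auto
      then show "e \<in> {e\<^sub>a, e\<^sub>b, e\<^sub>c}"
        unfolding opp by blast
    qed
  qed (use e in blast)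
  have ne: "e\<^sub>a \<noteq> e\<^sub>b" "e\<^sub>b \<noteq> e\<^sub>c" "e\<^sub>a \<noteq> e\<^sub>c"
    using e(2,4,6) E N(2-4) by auto
  have C: "edges (cycle_graph 3) = {0, 1, 2}" "verts (cycle_graph 3) = {0, 1, 2}"
    by (auto simp: cycle_graph_def)
  show ?thesis
  proof (rule isomorphic_coreI)
    show "{a, b, c} \<subseteq> verts G"
      using N(1) by blast
    show "bij_betw (\<lambda>x. if x = a then 0 else if x = b then 1 else 2) {a, b, c} (verts (cycle_graph 3))"
      unfolding C using N(2-4) by (auto simp: bij_betw_def inj_on_def)
    show "bij_betw (\<lambda>x. if x = e\<^sub>c then 0 else if x = e\<^sub>a then 1 else 2) (edges G) (edges (cycle_graph 3))"
      unfolding C edges using ne by (auto simp: bij_betw_def inj_on_def)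
  qed (use edges E ne N(2-4) in \<open>auto simp: cycle_graph_def\<close>)
qed

section \<open>Graphs with two or three edges that are not reconstructible\<close>

lemma poly_deck_eq_if_same_card_core:
  assumes G: "multigraph G" "\<And>e. e \<in> edges G \<Longrightarrow> isomorphic_core (delete_edge G e) X"
    and H: "multigraph H" "\<And>f. f \<in> edges H \<Longrightarrow> isomorphic_core (delete_edge H f) X"
    and m: "card (edges G) = card (edges H)" and n: "card (verts G) = card (verts H)"
  shows "poly_deck H = poly_deck G"
proof -
  have const: "poly_deck K = replicate_mset (card (edges K)) b"
    if "\<And>e. e \<in> edges K \<Longrightarrow> bipartition_poly (delete_edge K e) = b" "multigraph K"
    for K :: "('x, 'y) mgraph" and b
  proof -
    have "poly_deck K = image_mset (\<lambda>_. b) (mset_set (edges K))"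
      unfolding poly_deck_def by (rule image_mset_cong) (use that in simp)
    then show ?thesis
      by (simp add: image_mset_const_eq)
  qed
  show ?thesis
  proof (cases "edges G = {}")
    case True
    then have "edges H = {}"
      using m H(1) by simp
    then show ?thesis
      using True by (simp add: poly_deck_def)
  next
    case False
    then obtain e where e: "e \<in> edges G"
      by blast
    let ?b = "bipartition_poly (delete_edge G e)"
    have "poly_deck G = replicate_mset (card (edges G)) ?b"
    proof (rule const)
      fix f assume "f \<in> edges G"
      then show "bipartition_poly (delete_edge G f) = ?b"
        using bipartition_poly_eq_if_same_core[of "delete_edge G f" X "delete_edge G e"] G e by simp
    qed (rule G(1))
    moreover have "poly_deck H = replicate_mset (card (edges H)) ?b"
    proof (rule const)
      fix f assume "f \<in> edges H"
      then show "bipartition_poly (delete_edge H f) = ?b"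
        using bipartition_poly_eq_if_same_core[of "delete_edge H f" X "delete_edge G e"] G H e n by simp
    qed (rule H(1))
    ultimately show ?thesis
      using m by simp
  qed
qed

text \<open>Two witnesses with different polynomials save the case distinction on \<open>G\<close>: one of them
  has a polynomial different from that of \<open>G\<close>.\<close>

lemma not_reconstructibleI:
  fixes H\<^sub>1 H\<^sub>2 :: "(nat, nat) mgraph"
  assumes "multigraph H\<^sub>1" "poly_deck H\<^sub>1 = poly_deck G" "multigraph H\<^sub>2" "poly_deck H\<^sub>2 = poly_deck G"
    and "card {v \<in> verts H\<^sub>1. degree_in H\<^sub>1 v = j} \<noteq> card {v \<in> verts H\<^sub>2. degree_in H\<^sub>2 v = j}"
  shows "\<not> bp_reconstructible G"
proof
  assume "bp_reconstructible G"
  then have "bipartition_poly H\<^sub>1 = bipartition_poly H\<^sub>2"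
    using assms(1-4) unfolding bp_reconstructible_def by metis
  then show False
    using degree_distribution_eq[OF assms(1,3)] assms(5) by blast
qed

lemma edgeless_not_reconstructible:
  assumes "edges G = {}"
  shows "\<not> bp_reconstructible G"
proof (rule not_reconstructibleI)
  let ?H = "\<lambda>n. \<lparr>verts = {..<n}, edges = {}, ends = \<lambda>_. {}\<rparr> :: (nat, nat) mgraph"
  show "multigraph (?H 0)" "multigraph (?H 1)"
    by (simp_all add: multigraph_def del: multigraph_finite)
  show "poly_deck (?H 0) = poly_deck G" "poly_deck (?H 1) = poly_deck G"
    using assms by (simp_all add: poly_deck_def)
  show "card {v \<in> verts (?H 0). degree_in (?H 0) v = 0} \<noteq> card {v \<in> verts (?H 1). degree_in (?H 1) v = 0}"
    by (simp add: degree_in_def)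
qed

lemma two_edges_not_reconstructible:
  assumes G: "multigraph G" and m: "card (edges G) = 2" and n: "card (verts G) \<ge> 3"
  shows "\<not> bp_reconstructible G"
proof (rule not_reconstructibleI)
  let ?n = "card (verts G)"
  let ?C = "\<lparr>verts = {..<?n}, edges = {0, 1}, ends = \<lambda>_. {0, 1}\<rparr> :: (nat, nat) mgraph"
  let ?P = "\<lparr>verts = {..<?n}, edges = {0, 1}, ends = \<lambda>i. {i, Suc i}\<rparr> :: (nat, nat) mgraph"
  have one: "isomorphic_core (delete_edge K e) (path_graph 2)"
    if "multigraph K" "card (edges K) = 2" "e \<in> edges K" for K :: "('x, 'y) mgraph" and e
    by (rule one_edge_core) (use that in simp_all)
  show C: "multigraph ?C" and P: "multigraph ?P"
    using n by (auto simp: multigraph_def simp del: multigraph_finite)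
  show "poly_deck ?C = poly_deck G"
    by (rule poly_deck_eq_if_same_card_core[OF G one[OF G m] C one[OF C]]) (use m in simp_all)
  show "poly_deck ?P = poly_deck G"
    by (rule poly_deck_eq_if_same_card_core[OF G one[OF G m] P one[OF P]]) (use m in simp_all)
  have "degree_in ?C v = (if v < 2 then 2 else 0)" for v
  proof (cases "v < 2")
    case True
    then have "{e \<in> edges ?C. v \<in> ends ?C e} = {0, 1}"
      by auto
    then show ?thesis
      using True by (simp add: degree_in_def)
  qed (auto simp: degree_in_def)
  then have "{v \<in> verts ?C. degree_in ?C v = 2} = {0, 1}"
    using n by auto
  then have "card {v \<in> verts ?C. degree_in ?C v = 2} = 2"
    by simp
  moreover have "{v \<in> verts ?P. degree_in ?P v = 2} \<subseteq> {1}"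
  proof
    fix v assume v: "v \<in> {v \<in> verts ?P. degree_in ?P v = 2}"
    show "v \<in> {1}"
    proof (rule ccontr)
      assume "v \<notin> {1}"
      then have "{e \<in> edges ?P. v \<in> ends ?P e} \<subseteq> {v - 1}"
        by auto
      then have "degree_in ?P v \<le> 1"
        using card_mono[of "{v - 1}" "{e \<in> edges ?P. v \<in> ends ?P e}"] by (simp add: degree_in_def)
      then show False
        using v by simp
    qed
  qed
  then have "card {v \<in> verts ?P. degree_in ?P v = 2} \<le> card {1 :: nat}"
    by (rule card_mono[rotated]) simp
  then have "card {v \<in> verts ?P. degree_in ?P v = 2} \<le> 1"
    by simp
  ultimately show "card {v \<in> verts ?C. degree_in ?C v = 2} \<noteq> card {v \<in> verts ?P. degree_in ?P v = 2}"
    by simp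
qed

definition pairwise_adjacent :: "('v, 'e) mgraph \<Rightarrow> bool" where
  "pairwise_adjacent G \<longleftrightarrow> (\<forall>e\<in>edges G. \<forall>f\<in>edges G. e \<noteq> f \<longrightarrow> card (ends G e \<inter> ends G f) = 1)"

lemma pairwise_adjacent_card_core:
  assumes G: "multigraph G" and m: "card (edges G) = 3" and adj: "pairwise_adjacent G"
    and e: "e \<in> edges G"
  shows "isomorphic_core (delete_edge G e) (path_graph 3)"
proof -
  have "card (edges G - {e}) = 2"
    using G m e by simp
  then obtain f h where fh: "edges G - {e} = {f, h}" "f \<noteq> h"
    by (auto simp: card_2_iff)
  then have "card (ends G f \<inter> ends G h) = 1"
    using adj unfolding pairwise_adjacent_def by blast
  then show ?thesis
    by (intro adjacent_edges_core[of _ f h]) (use G fh in simp_all)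
qed

lemma three_edges_not_reconstructible:
  assumes G: "multigraph G" and m: "card (edges G) = 3" and n: "card (verts G) \<ge> 4"
    and adj: "pairwise_adjacent G"
  shows "\<not> bp_reconstructible G"
proof (rule not_reconstructibleI)
  let ?n = "card (verts G)"
  let ?S = "\<lparr>verts = {..<?n}, edges = {1, 2, 3}, ends = \<lambda>i. {0, i}\<rparr> :: (nat, nat) mgraph"
  let ?C = "\<lparr>verts = {..<?n}, edges = {0, 1, 2}, ends = \<lambda>i. {i, Suc i mod 3}\<rparr> :: (nat, nat) mgraph"
  show S: "multigraph ?S" and C: "multigraph ?C"
    using n by (auto simp: multigraph_def simp del: multigraph_finite)
  have adj_S: "pairwise_adjacent ?S" and adj_C: "pairwise_adjacent ?C"
    by (auto simp: pairwise_adjacent_def Int_insert_left)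
  note core = pairwise_adjacent_card_core
  show "poly_deck ?S = poly_deck G"
    by (rule poly_deck_eq_if_same_card_core[OF G core[OF G m adj] S core[OF S _ adj_S]]) (use m in simp_all)
  show "poly_deck ?C = poly_deck G"
    by (rule poly_deck_eq_if_same_card_core[OF G core[OF G m adj] C core[OF C _ adj_C]]) (use m in simp_all)
  have "{e \<in> edges ?S. 0 \<in> ends ?S e} = {1, 2, 3}"
    by auto
  then have "degree_in ?S 0 = 3"
    by (simp add: degree_in_def)
  then have "0 \<in> {v \<in> verts ?S. degree_in ?S v = 3}"
    using n by auto
  then have "card {v \<in> verts ?S. degree_in ?S v = 3} \<noteq> 0"
    using S by auto
  moreover have "degree_in ?C v \<noteq> 3" for v
  proof
    assume v: "degree_in ?C v = 3"
    have inc: "v \<in> ends ?C e" if "e \<in> edges ?C" for e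
      by (rule full_degree_incident[OF C _ that]) (use v in simp)
    have "v = 0 \<or> v = 1" "v = 1 \<or> v = 2" "v = 2 \<or> v = 0"
      using inc[of 0] inc[of 1] inc[of 2] by (auto simp: numeral_2_eq_2)
    then show False
      by linarith
  qed
  then have "card {v \<in> verts ?C. degree_in ?C v = 3} = 0"
    by simp
  ultimately show "card {v \<in> verts ?S. degree_in ?S v = 3} \<noteq> card {v \<in> verts ?C. degree_in ?C v = 3}"
    by (simp only: not_False_eq_True)
qed

section \<open>The characterisation\<close>

lemma isomorphic_card:
  assumes "isomorphic G H"
  shows "card (verts G) = card (verts H) \<and> card (edges G) = card (edges H)"
  using assms unfolding isomorphic_def by (metis bij_betw_same_card)

lemma card_disjoint_union:
  assumes "finite (verts X)" "finite (edges X)" "finite (verts Y)" "finite (edges Y)"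
  shows "card (verts (X \<uplus> Y)) = card (verts X) + card (verts Y)"
    "card (edges (X \<uplus> Y)) = card (edges X) + card (edges Y)"
  using assms by (simp_all add: disjoint_union_def card_Plus)

lemma edges_path_graph: "edges (path_graph s) = {..<s - 1}"
  by (auto simp: path_graph_def)

lemma verts_path_graph: "verts (path_graph s) = {..<s}"
  by (simp add: path_graph_def)

lemma pairwise_adjacent_isomorphic:
  assumes G: "multigraph G" and iso: "isomorphic G H" and H: "pairwise_adjacent H"
  shows "pairwise_adjacent G"
  unfolding pairwise_adjacent_def
proof (intro ballI impI)
  obtain f g where f: "inj_on f (verts G)" and g: "bij_betw g (edges G) (edges H)"
    and ends: "\<And>e. e \<in> edges G \<Longrightarrow> ends H (g e) = f ` ends G e"
    using iso unfolding isomorphic_def by (meson bij_betw_imp_inj_on)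
  fix e e' assume e: "e \<in> edges G" "e' \<in> edges G" "e \<noteq> e'"
  then have "g e \<in> edges H" "g e' \<in> edges H" "g e \<noteq> g e'"
    using g by (auto simp: bij_betw_def inj_on_def)
  then have "card (ends H (g e) \<inter> ends H (g e')) = 1"
    using H by (simp add: pairwise_adjacent_def)
  moreover have sub: "ends G e \<subseteq> verts G" "ends G e' \<subseteq> verts G"
    using G e unfolding multigraph_def by blast+
  moreover have "inj_on f (ends G e \<inter> ends G e')"
    by (rule inj_on_subset[OF f]) (use sub in blast)
  then have "card (f ` (ends G e \<inter> ends G e')) = card (ends G e \<inter> ends G e')"
    by (rule card_image)
  ultimately show "card (ends G e \<inter> ends G e') = 1"
    using inj_on_image_Int[OF f sub] ends e(1,2) by simp
qed

lemma card_Inl_image_Int: "card (Inl ` A \<inter> Inl ` B) = card (A \<inter> B)"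
  by (metis card_image image_Int inj_Inl inj_on_subset subset_UNIV)

lemma pairwise_adjacent_disjoint_union:
  "pairwise_adjacent X \<Longrightarrow> edges Y = {} \<Longrightarrow> pairwise_adjacent (X \<uplus> Y)"
  by (auto simp: pairwise_adjacent_def disjoint_union_def card_Inl_image_Int) blast

lemma pairwise_adjacent_cycle_3: "pairwise_adjacent (cycle_graph 3)"
proof -
  have "edges (cycle_graph 3) = {0, 1, 2}"
    by (auto simp: cycle_graph_def)
  then show ?thesis
    by (auto simp: pairwise_adjacent_def cycle_graph_def Int_insert_left)
qed

lemma pairwise_adjacent_star: "pairwise_adjacent (star_graph s)"
  by (auto simp: pairwise_adjacent_def star_graph_def Int_insert_left)

theorem theorem12:
  fixes G :: "('v, 'e) mgraph"
  assumes "multigraph G"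
  shows "(bp_reconstructible G \<longleftrightarrow>
      \<not> ((\<exists>t. isomorphic G (cycle_graph 2 \<uplus> copies (t + 2) (path_graph 1)) \<or>
              isomorphic G (path_graph 3 \<uplus> copies (t + 1) (path_graph 1)) \<or>
              isomorphic G (copies 2 (path_graph 2) \<uplus> copies t (path_graph 1))) \<or>
         (\<exists>t. isomorphic G (cycle_graph 3 \<uplus> copies (t + 1) (path_graph 1)) \<or>
              isomorphic G (star_graph 3 \<uplus> copies t (path_graph 1))) \<or>
         isomorphic G (cycle_graph 2 \<uplus> path_graph 1) \<or>
         isomorphic G (path_graph 3) \<or>
         (\<exists>t. isomorphic G (copies t (path_graph 1))))) \<and>
    (card (edges G) \<ge> 4 \<longrightarrow> bp_reconstructible G)"
    (is "(_ \<longleftrightarrow> \<not> (?two \<or> ?three \<or> ?C2 \<or> ?P3 \<or> ?none)) \<and> _")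
proof -
  note G = assms
  have verts: "card (verts (cycle_graph s)) = s" "card (edges (cycle_graph s)) = s"
    "finite (verts (cycle_graph s))" "finite (edges (cycle_graph s))"
    "card (verts (path_graph s)) = s" "card (edges (path_graph s)) = s - 1"
    "finite (verts (path_graph s))" "finite (edges (path_graph s))"
    "card (verts (star_graph s)) = Suc s" "card (edges (star_graph s)) = s"
    "finite (verts (star_graph s))" "finite (edges (star_graph s))"
    "card (verts (copies s (path_graph r))) = s * r" "card (edges (copies s (path_graph r))) = s * (r - 1)"
    "finite (verts (copies s (path_graph r)))" "finite (edges (copies s (path_graph r)))" for s r
    by (simp_all add: cycle_graph_def star_graph_def copies_def edges_path_graph verts_path_graph)
  have two: "card (edges G) = 2 \<and> card (verts G) \<ge> 3" if "?two \<or> ?C2 \<or> ?P3"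
    using that by (auto dest!: isomorphic_card simp: card_disjoint_union verts)
  have three: "card (edges G) = 3 \<and> card (verts G) \<ge> 4 \<and> pairwise_adjacent G" if ?three
  proof -
    have "pairwise_adjacent G"
      using that pairwise_adjacent_isomorphic[OF G] pairwise_adjacent_cycle_3 pairwise_adjacent_star
        pairwise_adjacent_disjoint_union copies_path_graph_1(1) by metis
    moreover have "card (edges G) = 3 \<and> card (verts G) \<ge> 4"
      using that by (auto dest!: isomorphic_card simp: card_disjoint_union verts)
    ultimately show ?thesis
      by blast
  qed
  have none: "edges G = {}" if ?none
    using that G by (auto dest!: isomorphic_card simp: verts)
  have sound: "\<not> bp_reconstructible G" if "?two \<or> ?three \<or> ?C2 \<or> ?P3 \<or> ?none"
    using that two three none two_edges_not_reconstructible[OF G] three_edges_not_reconstructible[OF G]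
      edgeless_not_reconstructible[of G] by blast
  have complete: "card (edges G) < 4 \<and> (?two \<or> ?three \<or> ?C2 \<or> ?P3 \<or> ?none)"
    if not_rec: "\<not> bp_reconstructible G"
  proof -
    obtain H :: "(nat, nat) mgraph" where H: "multigraph H" "poly_deck H = poly_deck G"
      "bipartition_poly H \<noteq> bipartition_poly G"
      using not_rec unfolding bp_reconstructible_def by blast
    obtain \<phi> where \<phi>: "deck_bij \<phi> G H"
      by (rule deck_bij_if_poly_deck_eq[OF G H(1,2)])
    have mH: "card (edges H) = card (edges G)"
      by (rule deck_bij_card_edges[OF \<phi>])
    have n: "card (verts G) = card (verts H)" if "card (edges G) \<noteq> 0"
      by (rule deck_bij_card_verts[OF G H(1) \<phi>]) (use that in auto)
    consider "card (edges G) = 0" | "card (edges G) = 1" | "card (edges G) = 2" | "card (edges G) \<ge> 3"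
      by linarith
    then show ?thesis
    proof cases
      case 1
      then have "edges G = {}"
        using G by simp
      then show ?thesis
        using isomorphic_edgeless[OF G] by auto
    next
      case 2
      then have "bipartition_poly H = bipartition_poly G"
        using bipartition_poly_eq_if_same_core[OF H(1) one_edge_core[OF H(1)] G one_edge_core[OF G]] mH n
        by simp
      then show ?thesis
        using H(3) by blast
    next
      case 3
      have big: "card (verts G) \<ge> 3"
      proof (rule ccontr)
        assume small: "\<not> ?thesis"
        have core: "isomorphic_core K (cycle_graph 2)"
          if "multigraph K" "card (edges K) = 2" "card (verts K) < 3" for K :: "('x, 'y) mgraph"
          using two_edges_core[OF that(1,2)] isomorphic_core_card_le[OF that(1), of "path_graph 3"]
            isomorphic_core_card_le[OF that(1), of "copies 2 (path_graph 2)"] that(3)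
          by (auto simp: verts)
        have "isomorphic_core G (cycle_graph 2)" "isomorphic_core H (cycle_graph 2)"
          using core[OF G] core[OF H(1)] 3 mH n small by simp_all
        then have "bipartition_poly H = bipartition_poly G"
          using bipartition_poly_eq_if_same_core[OF H(1) _ G] 3 n by simp
        then show False
          using H(3) by blast
      qed
      consider "isomorphic_core G (cycle_graph 2)" | "isomorphic_core G (path_graph 3)"
        | "isomorphic_core G (copies 2 (path_graph 2))"
        using two_edges_core[OF G 3] by blast
      then have "?two \<or> ?C2 \<or> ?P3"
      proof cases
        case core: 1
        show ?thesis
        proof (cases "card (verts G) = 3")
          case True
          then have ?C2
            by (intro isomorphic_disjoint_union_if_core[OF G core]) (simp_all add: verts edges_path_graph)
          then show ?thesis
            by blast
        next
          case False
          then have "card (verts G) = card (verts (cycle_graph 2)) + ((card (verts G) - 4) + 2)"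
            using big by (simp add: verts)
          from isomorphic_isolated_if_core[OF G core this] show ?thesis
            by blast
        qed
      next
        case core: 2
        show ?thesis
        proof (cases "card (verts G) = 3")
          case True
          then have ?P3
            by (intro isomorphic_if_core[OF G core]) (simp add: verts)
          then show ?thesis
            by blast
        next
          case False
          then have "card (verts G) = card (verts (path_graph 3)) + ((card (verts G) - 4) + 1)"
            using big by (simp add: verts)
          from isomorphic_isolated_if_core[OF G core this] show ?thesis
            by blast
        qed
      next
        case core: 3
        have "card (verts G) = card (verts (copies 2 (path_graph 2))) + (card (verts G) - 4)"
          using isomorphic_core_card_le[OF G core] by (simp add: verts)
        from isomorphic_isolated_if_core[OF G core this] show ?thesis
          by blast
      qed
      then show ?thesis
        using 3 by auto
    next
      case 4
      note diff = same_deck_different_poly[OF G H(1) \<phi> 4 H(3)]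
      have ?three
        using diff(2)
      proof
        assume "forest G \<and> (\<exists>v\<in>verts G. degree_in G v = 3)"
        then have core: "isomorphic_core G (star_graph 3)"
          using claw_core[OF G _ diff(1)] by blast
        have "card (verts G) = card (verts (star_graph 3)) + (card (verts G) - 4)"
          using isomorphic_core_card_le[OF G core] by (simp add: verts)
        from isomorphic_isolated_if_core[OF G core this] show ?thesis
          by blast
      next
        assume triangle: "card {v \<in> verts G. degree_in G v = 2} = 3 \<and>
          (\<forall>v\<in>verts G. degree_in G v = 0 \<or> degree_in G v = 2) \<and> card (verts G) \<ge> 4"
        then have core: "isomorphic_core G (cycle_graph 3)"
          using triangle_core[OF G diff(1)] by blast
        have "card (verts G) = card (verts (cycle_graph 3)) + ((card (verts G) - 4) + 1)"
          using triangle by (simp add: verts)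
        from isomorphic_isolated_if_core[OF G core this] show ?thesis
          by blast
      qed
      then show ?thesis
        using diff(1) by simp
    qed
  qed
  show ?thesis
    using sound complete by (meson linorder_not_less)
qed

end
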